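(* Let $d\ge1$ and let $B$ be a two-parameter Brownian sheet in $\mathbf{R}^d$. Define $\mathcal{D}_d:=\{s\ge0:\ B(s,t_1)=B(s,t_2)\text{ for some }t_2>t_1>0\}$. Then for every non-random compact set $F\subset(0,\infty)$, \[ \mathrm{P}\{\mathcal{D}_d\cap F\neq\varnothing\}>0\iff \mathrm{Cap}_{(d-4)/2}(F)>0 . \]
   Context: A two-parameter Brownian sheet in $\mathbf{R}^d$ is a continuous centered Gaussian process $\{B(s,t)\}_{s,t\ge0}$ with values in $\mathbf{R}^d$ and $\mathrm{Cov}(B_i(s,t),B_j(u,v))=\min(s,u)\min(t,v)\delta_{i,j}$. Riesz capacity: for $\beta\in\mathbf{R}$ and $x\neq 0$ let $U_\beta(x)=1$ if $\beta<0$, $U_\beta(x)=\log_+(1/|x|)$ if $\beta=0$, $U_\beta(x)=|x|^{-\beta}$ if $\beta>0$, extended continuously to $x=0$ as a $[0,\infty]$-valued function. For a probability measure $\mu$, $I_\beta(\mu)=\iint U_\beta(x-y)\,\mu(dx)\mu(dy)$, and $\mathrm{Cap}_\beta(F)=[\inf_{\mu\in\mathcal{P}(F)}I_\beta(\mu)]^{-1}$, where $\mathcal{P}(F)$ is the set of Borel probability measures on $F$, $\inf\varnothing=\infty$, $1/\infty=0$. *)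

theory Defs
  imports "HOL-Probability.Probability"
begin

text \<open>Riesz kernel on the real line (the sets F considered are subsets of (0,\<infinity>)),
  with values in [0,\<infinity>], extended continuously to 0.\<close>
definition riesz_kernel :: "real \<Rightarrow> real \<Rightarrow> ennreal" where
  "riesz_kernel \<beta> x =
     (if \<beta> < 0 then 1
      else if x = 0 then \<top>
      else if \<beta> = 0 then ennreal (max 0 (ln (1 / \<bar>x\<bar>)))
      else ennreal (\<bar>x\<bar> powr (- \<beta>)))"

definition riesz_energy :: "real \<Rightarrow> real measure \<Rightarrow> ennreal" where
  "riesz_energy \<beta> \<mu> = (\<integral>\<^sup>+ x. (\<integral>\<^sup>+ y. riesz_kernel \<beta> (x - y) \<partial>\<mu>) \<partial>\<mu>)"

definition prob_measures_on :: "real set \<Rightarrow> real measure set" where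
  "prob_measures_on F =
     {\<mu>. sets \<mu> = sets borel \<and> prob_space \<mu> \<and> emeasure \<mu> F = 1}"

definition riesz_cap :: "real \<Rightarrow> real set \<Rightarrow> ennreal" where
  "riesz_cap \<beta> F = inverse (INF \<mu> \<in> prob_measures_on F. riesz_energy \<beta> \<mu>)"

definition centered_gaussian_rv :: "'a measure \<Rightarrow> ('a \<Rightarrow> real) \<Rightarrow> real \<Rightarrow> bool" where
  "centered_gaussian_rv M X v =
     (if v = 0 then (AE \<omega> in M. X \<omega> = 0)
      else distributed M lborel X (normal_density 0 (sqrt v)))"

text \<open>Two-parameter Brownian sheet in R^d (d = CARD('d)): continuous, centered Gaussian,
  with Cov(B_i(s,t),B_j(u,v)) = min s u * min t v * delta_ij.  Gaussianity with the given
  covariance is expressed by requiring every finite linear combination of coordinates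
  to be centered normal with the corresponding variance.\<close>
definition brownian_sheet ::
    "'a measure \<Rightarrow> (real \<times> real \<Rightarrow> 'a \<Rightarrow> real ^ 'd) \<Rightarrow> bool" where
  "brownian_sheet M B \<longleftrightarrow>
     prob_space M \<and>
     (\<forall>s t. 0 \<le> s \<longrightarrow> 0 \<le> t \<longrightarrow> B (s, t) \<in> borel_measurable M) \<and>
     (\<forall>\<omega> \<in> space M. continuous_on ({0..} \<times> {0..}) (\<lambda>p. B p \<omega>)) \<and>
     (\<forall>xs :: (real \<times> real \<times> 'd \<times> real) list.
        (\<forall>(s, t, i, c) \<in> set xs. 0 \<le> s \<and> 0 \<le> t) \<longrightarrow>
        centered_gaussian_rv M
          (\<lambda>\<omega>. \<Sum>(s, t, i, c) \<leftarrow> xs. c * (B (s, t) \<omega> $ i))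
          (\<Sum>(s, t, i, c) \<leftarrow> xs. \<Sum>(u, v, j, e) \<leftarrow> xs.
              c * e * (min s u * min t v * (if i = j then 1 else 0))))"

definition double_times :: "(real \<times> real \<Rightarrow> 'a \<Rightarrow> real ^ 'd) \<Rightarrow> 'a \<Rightarrow> real set" where
  "double_times B \<omega> =
     {s. 0 \<le> s \<and> (\<exists>t1 t2. 0 < t1 \<and> t1 < t2 \<and> B (s, t1) \<omega> = B (s, t2) \<omega>)}"

end

theory Submission
  imports Defs
begin

text \<open>
  Fix \<open>b < c\<close> and look at \<open>t1\<close> slightly below \<open>b\<close> and \<open>t2\<close> slightly above \<open>c\<close>. The increment
  \<open>B(s,t2) - B(s,t1)\<close> is the white noise of the rectangle \<open>[0,s] \<times> [t1,t2]\<close>, which increases with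
  each of the three parameters \<open>s\<close>, \<open>b - t1\<close> and \<open>t2 - c\<close>. Two such increments at parameter
  distance \<open>r\<close> are both of size \<open>\<epsilon>\<close> with probability of order \<open>\<epsilon>^2d (r + \<epsilon>^2)^(-d/2)\<close>; integrating
  this over the two \<open>t\<close>-parameters leaves the Riesz kernel of order \<open>(d - 4)/2\<close> in \<open>s\<close>. Hence the
  occupation measure of a small ball, weighted by a measure of finite energy on \<open>F\<close>, has bounded second
  moment, and Cauchy-Schwarz gives a hit with probability bounded below.

  Conversely, let \<open>\<mu>\<close> be the law of the \<open>s\<close>-coordinate of a selected hitting time. Given the past of that
  time (the noise of its rectangle), the expected occupation of its future is at least the one-sided
  potential of \<open>\<mu>\<close>, so Cairoli's maximal inequality, used in the dual form
  \<open>\<parallel>\<Sum>\<^sub>t E[g\<^sub>t | F\<^sub>t]\<parallel> \<le> 8 \<parallel>\<Sum>\<^sub>t g\<^sub>t\<parallel>\<close> in L2, bounds the energy of \<open>\<mu>\<close> by a constant divided by the hitting probability.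
  Everything is done on finite grids, where conditioning is resampling of independent Gaussian cells; the
  limit of the resulting measures is taken at the end.
\<close>

subsection \<open>Jointly Gaussian families\<close>

text \<open>The exponent comes from two integrations: averaging (r + u + v)^(-d/2) over both time
  differences u and v raises the power by two, to r^(-(d-4)/2), with a logarithm at d = 4 and a
  bounded function below. The gap [b, c] ensures two things: any two of the rectangles share an area
  bounded below, which pays for one factor \<epsilon>^d, and a change of s changes the area at least
  proportionally. For a hit of probability P whose law has energy E, duality reads c P E \<le> 2 (64
  P)^(1/2) (C E)^(1/2). As E occurs on both sides, it can be cancelled only if it is finite; this is
  one reason for finite grids and for a kernel regularised by \<epsilon>^2. The other is that
  conditional expectations become explicit integrals that commute, and that any measurable choice of
  a hit will do. A hit needs a full window of later times ahead of it, hence occupation is counted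
  over time ranges twice as long as those searched for hits. The order in s costs a factor two,
  since the kernel is symmetric.\<close>

lemma (in prob_space) expectation_weight_eq:
  assumes X[measurable]: "X \<in> borel_measurable M" and w[measurable]: "w \<in> borel_measurable M"
    and w_bounds: "\<And>\<omega>. 1 \<le> w \<omega>" "\<And>\<omega>. w \<omega> \<le> (3::real)"
    and \<nu>: "real_distribution \<nu>"
    and eq: "\<And>t. (\<integral>\<omega>. w \<omega> *\<^sub>R iexp (t * X \<omega>) \<partial>M) = char \<nu> t * (\<integral>\<omega>. w \<omega> \<partial>M)"
    and A[measurable]: "A \<in> sets borel"
  shows "(\<integral>\<omega>. indicator A (X \<omega>) * w \<omega> \<partial>M) = measure \<nu> A * (\<integral>\<omega>. w \<omega> \<partial>M)"
proof -
  interpret \<nu>: real_distribution \<nu> by (rule \<nu>)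
  define m where "m = (\<integral>\<omega>. w \<omega> \<partial>M)"
  have "\<bar>w \<omega>\<bar> \<le> 3" for \<omega>
    using w_bounds[of \<omega>] by linarith
  then have wint[simp]: "integrable M w"
    by (intro integrable_const_bound[where B=3] AE_I2) auto
  have "1 \<le> m"
  proof -
    have "(\<integral>\<omega>. 1 \<partial>M) \<le> m" unfolding m_def using w_bounds by (intro integral_mono) auto
    then show ?thesis by (simp add: prob_space)
  qed
  \<comment> \<open>Under the tilted probability \<open>Q\<close> the hypothesis \<open>eq\<close>
    says that \<open>X\<close> has the characteristic function of \<open>\<nu>\<close>, so
    one-dimensional uniqueness identifies its law. The bounds 1 and 3 make the weight integrable and
    its mass \<open>m\<close> positive.\<close>
  define Q where "Q = density M (\<lambda>\<omega>. ennreal (w \<omega> / m))"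
  have wpos: "0 \<le> w \<omega> / m" for \<omega>
    using w_bounds(1)[of \<omega>] \<open>1 \<le> m\<close> by auto
  have Q: "prob_space Q"
  proof
    have "emeasure Q (space Q) = (\<integral>\<^sup>+\<omega>. ennreal (w \<omega> / m) \<partial>M)"
      unfolding Q_def by (simp add: emeasure_density cong: nn_integral_cong)
    also have "\<dots> = ennreal (\<integral>\<omega>. w \<omega> / m \<partial>M)"
      using wpos by (intro nn_integral_eq_integral) auto
    also have "\<dots> = 1" using \<open>1 \<le> m\<close> by (simp add: m_def)
    finally show "emeasure Q (space Q) = 1" .
  qed
  interpret Q: prob_space Q by (rule Q)
  have XQ[measurable]: "X \<in> borel_measurable Q" unfolding Q_def by simp
  have "distr Q borel X = \<nu>"
  proof (rule Levy_uniqueness[OF _ \<nu>])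
    show "real_distribution (distr Q borel X)" by simp
    show "char (distr Q borel X) = char \<nu>"
    proof
      fix t
      have "char (distr Q borel X) t = (\<integral>\<omega>. iexp (t * X \<omega>) \<partial>Q)"
        unfolding char_def by (subst integral_distr) auto
      also have "\<dots> = (\<integral>\<omega>. (w \<omega> / m) *\<^sub>R iexp (t * X \<omega>) \<partial>M)"
        unfolding Q_def using wpos by (subst integral_density) auto
      also have "\<dots> = (\<integral>\<omega>. (1/m) *\<^sub>R (w \<omega> *\<^sub>R iexp (t * X \<omega>)) \<partial>M)"
        by (intro Bochner_Integration.integral_cong) auto
      also have "\<dots> = (1/m) *\<^sub>R (\<integral>\<omega>. w \<omega> *\<^sub>R iexp (t * X \<omega>) \<partial>M)"
        by (rule integral_scaleR_right)
      also have "\<dots> = char \<nu> t"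
        unfolding eq using \<open>1 \<le> m\<close> by (simp add: m_def[symmetric] scaleR_conv_of_real)
      finally show "char (distr Q borel X) t = char \<nu> t" .
    qed
  qed
  then have "measure \<nu> A = measure (distr Q borel X) A" by simp
  also have "\<dots> = (\<integral>x. indicator A x \<partial>distr Q borel X)" by simp
  also have "\<dots> = (\<integral>\<omega>. indicator A (X \<omega>) \<partial>Q)"
    by (subst integral_distr) auto
  also have "\<dots> = (\<integral>\<omega>. (w \<omega> / m) *\<^sub>R indicator A (X \<omega>) \<partial>M)"
    unfolding Q_def using wpos by (subst integral_density) auto
  also have "\<dots> = (\<integral>\<omega>. (1/m) * (indicator A (X \<omega>) * w \<omega>) \<partial>M)"
    by (intro Bochner_Integration.integral_cong) auto
  also have "\<dots> = (1/m) * (\<integral>\<omega>. indicator A (X \<omega>) * w \<omega> \<partial>M)"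
    by (rule integral_mult_right_zero)
  finally show ?thesis using \<open>1 \<le> m\<close> by (simp add: m_def[symmetric] field_simps)
qed

text \<open>Cosine and sine of \<open>Y\<close> are combinations of the exponentials at frequencies
  1 and -1, and frequency 0 gives the law of \<open>X\<close> alone. Both functions are bounded by
  1, so adding 2 gives positive weights to which the tilting argument applies.\<close>

lemma (in prob_space) expectation_indicator_iexp_eq:
  assumes X[measurable]: "X \<in> borel_measurable M" and Y[measurable]: "Y \<in> borel_measurable M"
    and \<nu>: "real_distribution \<nu>"
    and eq: "\<And>t r. r \<in> {-1, 0, 1} \<Longrightarrow> (\<integral>\<omega>. iexp (t * X \<omega> + r * Y \<omega>) \<partial>M) = char \<nu> t * (\<integral>\<omega>. iexp (r * Y \<omega>) \<partial>M)"
    and A[measurable]: "A \<in> sets borel"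
  shows "(\<integral>\<omega>. indicator A (X \<omega>) *\<^sub>R iexp (Y \<omega>) \<partial>M) = measure \<nu> A *\<^sub>R (\<integral>\<omega>. iexp (Y \<omega>) \<partial>M)"
proof -
  have int_iexp[simp]: "integrable M (\<lambda>\<omega>. iexp (f \<omega>))" if [measurable]: "f \<in> borel_measurable M" for f :: "'a \<Rightarrow> real"
    by (intro integrable_const_bound[where B=1]) auto
  have [simp]: "integrable M (\<lambda>\<omega>. cos (Y \<omega>))" "integrable M (\<lambda>\<omega>. sin (Y \<omega>))"
    by (intro integrable_const_bound[where B=1]; simp)+
  have ind: "integrable M (\<lambda>\<omega>. indicator A (X \<omega>) * f \<omega>)" if "integrable M f" for f :: "'a \<Rightarrow> real"
  proof -
    have "integrable M (\<lambda>\<omega>. indicator (X -` A \<inter> space M) \<omega> *\<^sub>R f \<omega>)"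
      using that by (intro integrable_mult_indicator) auto
    then show ?thesis
      by (rule Bochner_Integration.integrable_cong[THEN iffD1, rotated -1]) (auto simp: indicator_def)
  qed
  have ci: "complex_of_real (cos y) = (iexp (1 * y) + iexp (- 1 * y)) / 2"
           "complex_of_real (sin y) = (iexp (1 * y) - iexp (- 1 * y)) / (2 * \<i>)" for y :: real
    by (simp_all add: cos_of_real[symmetric] sin_of_real[symmetric] cos_exp_eq sin_exp_eq)
  have iexp_add: "iexp (a + b) = iexp a * iexp b" for a b :: real
    by (simp add: distrib_left exp_add)
  have iY: "integrable M (\<lambda>\<omega>. iexp (1 * Y \<omega>))" "integrable M (\<lambda>\<omega>. iexp (- 1 * Y \<omega>))"
    by (rule int_iexp, measurable)+
  have aux: "(p + q) / 2 * r = (r * p + r * q) / 2" "(p - q) / (2 * \<i>) * r = (r * p - r * q) / (2 * \<i>)" for p q r :: complex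
    by (simp_all add: algebra_simps)
  have one: "(\<integral>\<omega>. iexp (t * X \<omega>) \<partial>M) = char \<nu> t" for t
    using eq[of 0 t] by (simp add: prob_space)
  have base: "(\<integral>\<omega>. indicator A (X \<omega>) * w \<omega> \<partial>M) = measure \<nu> A * (\<integral>\<omega>. w \<omega> \<partial>M)"
    if w: "w = (\<lambda>\<omega>. cos (Y \<omega>)) \<or> w = (\<lambda>\<omega>. sin (Y \<omega>)) \<or> w = (\<lambda>\<omega>. 0)" for w
  proof -
    have wi: "integrable M w" using w by auto
    then have [measurable]: "w \<in> borel_measurable M" by auto
    have cw: "complex_of_real (\<integral>\<omega>. w \<omega> \<partial>M) = (\<integral>\<omega>. complex_of_real (w \<omega>) \<partial>M)"
      by simp
    have *: "(\<integral>\<omega>. w \<omega> *\<^sub>R iexp (t * X \<omega>) \<partial>M) = char \<nu> t * (\<integral>\<omega>. w \<omega> \<partial>M)" for t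
    proof -
      consider "w = (\<lambda>\<omega>. cos (Y \<omega>))" | "w = (\<lambda>\<omega>. sin (Y \<omega>))" | "w = (\<lambda>\<omega>. 0)" using w by blast
      then show ?thesis
      proof cases
        case 1
        have "(\<integral>\<omega>. w \<omega> *\<^sub>R iexp (t * X \<omega>) \<partial>M)
            = (\<integral>\<omega>. (iexp (t * X \<omega> + 1 * Y \<omega>) + iexp (t * X \<omega> + -1 * Y \<omega>)) / 2 \<partial>M)"
          unfolding 1 scaleR_conv_of_real ci
          by (intro Bochner_Integration.integral_cong refl) (simp only: iexp_add aux)
        also have "\<dots> = char \<nu> t * (((\<integral>\<omega>. iexp (1 * Y \<omega>) \<partial>M) + (\<integral>\<omega>. iexp (-1 * Y \<omega>) \<partial>M)) / 2)"
          by (subst integral_divide_zero, subst Bochner_Integration.integral_add, (rule int_iexp, measurable)+,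
              simp only: eq insert_iff simp_thms distrib_left times_divide_eq_right)
        also have "((\<integral>\<omega>. iexp (1 * Y \<omega>) \<partial>M) + (\<integral>\<omega>. iexp (-1 * Y \<omega>) \<partial>M)) / 2 = (\<integral>\<omega>. w \<omega> \<partial>M)"
          unfolding cw unfolding 1 ci
          by (simp only: integral_divide_zero Bochner_Integration.integral_add[OF iY])
        finally show ?thesis .
      next
        case 2
        have "(\<integral>\<omega>. w \<omega> *\<^sub>R iexp (t * X \<omega>) \<partial>M)
            = (\<integral>\<omega>. (iexp (t * X \<omega> + 1 * Y \<omega>) - iexp (t * X \<omega> + -1 * Y \<omega>)) / (2 * \<i>) \<partial>M)"
          unfolding 2 scaleR_conv_of_real ci
          by (intro Bochner_Integration.integral_cong refl) (simp only: iexp_add aux)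
        also have "\<dots> = char \<nu> t * (((\<integral>\<omega>. iexp (1 * Y \<omega>) \<partial>M) - (\<integral>\<omega>. iexp (-1 * Y \<omega>) \<partial>M)) / (2 * \<i>))"
          by (subst integral_divide_zero, subst Bochner_Integration.integral_diff, (rule int_iexp, measurable)+,
              simp only: eq insert_iff simp_thms right_diff_distrib times_divide_eq_right)
        also have "((\<integral>\<omega>. iexp (1 * Y \<omega>) \<partial>M) - (\<integral>\<omega>. iexp (-1 * Y \<omega>) \<partial>M)) / (2 * \<i>) = (\<integral>\<omega>. w \<omega> \<partial>M)"
          unfolding cw unfolding 2 ci
          by (simp only: integral_divide_zero Bochner_Integration.integral_diff[OF iY])
        finally show ?thesis .
      qed simp
    qed
    have "\<bar>w \<omega>\<bar> \<le> 1" for \<omega> using w by auto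
    then have wb: "1 \<le> 2 + w \<omega>" "2 + w \<omega> \<le> 3" for \<omega> by (smt (verit))+
    have i2: "(\<integral>\<omega>. 2 + w \<omega> \<partial>M) = 2 + (\<integral>\<omega>. w \<omega> \<partial>M)"
      using wi by (subst Bochner_Integration.integral_add) (auto simp: prob_space)
    have "(\<integral>\<omega>. (2 + w \<omega>) *\<^sub>R iexp (t * X \<omega>) \<partial>M) = char \<nu> t * (\<integral>\<omega>. 2 + w \<omega> \<partial>M)" for t
    proof -
      have iX: "integrable M (\<lambda>\<omega>. iexp (t * X \<omega>))"
        by (rule int_iexp, measurable)
      have "integrable M (\<lambda>\<omega>. w \<omega> *\<^sub>R iexp (t * X \<omega>))"
        by (intro integrable_const_bound[where B=1]) (auto simp: \<open>\<And>\<omega>. \<bar>w \<omega>\<bar> \<le> 1\<close>)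
      then have "(\<integral>\<omega>. (2 + w \<omega>) *\<^sub>R iexp (t * X \<omega>) \<partial>M)
          = 2 *\<^sub>R (\<integral>\<omega>. iexp (t * X \<omega>) \<partial>M) + (\<integral>\<omega>. w \<omega> *\<^sub>R iexp (t * X \<omega>) \<partial>M)"
        unfolding scaleR_left_distrib
        by (simp only: Bochner_Integration.integral_add integrable_scaleR_right iX integral_scaleR_right)
      then show ?thesis unfolding one * i2 by (simp add: algebra_simps scaleR_conv_of_real)
    qed
    \<comment> \<open>The constant weight 2 is treated separately, and subtracting it leaves the
      signed weight \<open>w\<close>.\<close>
    from expectation_weight_eq[OF X _ wb \<nu> this A]
    have "(\<integral>\<omega>. indicator A (X \<omega>) * (2 + w \<omega>) \<partial>M) = measure \<nu> A * (\<integral>\<omega>. 2 + w \<omega> \<partial>M)"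
      by simp
    moreover have "(\<integral>\<omega>. indicator A (X \<omega>) * (2 + w \<omega>) \<partial>M)
        = (\<integral>\<omega>. indicator A (X \<omega>) * 2 \<partial>M) + (\<integral>\<omega>. indicator A (X \<omega>) * w \<omega> \<partial>M)"
      unfolding distrib_left by (rule Bochner_Integration.integral_add; intro ind wi integrable_const)
    moreover have "(\<integral>\<omega>. indicator A (X \<omega>) * 2 \<partial>M) = measure \<nu> A * 2"
      using expectation_weight_eq[OF X, of "\<lambda>_. 2" \<nu> A] one \<nu> by (simp add: prob_space scaleR_conv_of_real mult.commute)
    ultimately show ?thesis using i2 by (simp add: algebra_simps)
  qed
  have "(\<integral>\<omega>. indicator A (X \<omega>) *\<^sub>R iexp (Y \<omega>) \<partial>M)
     = (\<integral>\<omega>. complex_of_real (indicator A (X \<omega>) * cos (Y \<omega>)) + \<i> * complex_of_real (indicator A (X \<omega>) * sin (Y \<omega>)) \<partial>M)"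
    by (intro Bochner_Integration.integral_cong refl) (simp add: cis_conv_exp[symmetric] complex_eq_iff)
  also have "\<dots> = complex_of_real (\<integral>\<omega>. indicator A (X \<omega>) * cos (Y \<omega>) \<partial>M) + \<i> * complex_of_real (\<integral>\<omega>. indicator A (X \<omega>) * sin (Y \<omega>) \<partial>M)"
    by (subst Bochner_Integration.integral_add) (auto simp del: of_real_mult intro!: ind integrable_of_real integrable_mult_right)
  also have "\<dots> = measure \<nu> A *\<^sub>R (complex_of_real (\<integral>\<omega>. cos (Y \<omega>) \<partial>M) + \<i> * complex_of_real (\<integral>\<omega>. sin (Y \<omega>) \<partial>M))"
    by (simp add: base scaleR_conv_of_real distrib_left mult.left_commute)
  also have "complex_of_real (\<integral>\<omega>. cos (Y \<omega>) \<partial>M) + \<i> * complex_of_real (\<integral>\<omega>. sin (Y \<omega>) \<partial>M) 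
     = (\<integral>\<omega>. complex_of_real (cos (Y \<omega>)) + \<i> * complex_of_real (sin (Y \<omega>)) \<partial>M)"
    by (subst Bochner_Integration.integral_add) (auto intro!: integrable_of_real integrable_mult_right)
  also have "\<dots> = (\<integral>\<omega>. iexp (Y \<omega>) \<partial>M)"
    by (intro Bochner_Integration.integral_cong refl) (simp add: cis_conv_exp[symmetric] complex_eq_iff)
  finally show ?thesis .
qed

text \<open>Induction on the family: the one-dimensional uniqueness theorem applies to one of the variables
  under the measures weighted by 2 + cos and 2 + sin of a linear combination of the other ones, and this
  determines the joint characteristic function of the other ones after conditioning on the first.\<close>

lemma prob_Inter_eq_prod_of_char:
  assumes "prob_space M" and "finite I"
    and "\<And>k. k \<in> I \<Longrightarrow> X k \<in> borel_measurable M"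
    and "\<And>k. k \<in> I \<Longrightarrow> real_distribution (\<nu> k)"
    and "\<And>\<theta>. (\<integral>\<omega>. iexp (\<Sum>k\<in>I. \<theta> k * X k \<omega>) \<partial>M) = (\<Prod>k\<in>I. char (\<nu> k) (\<theta> k))"
    and "\<And>k. k \<in> I \<Longrightarrow> A k \<in> sets borel"
  shows "measure M {\<omega>\<in>space M. \<forall>k\<in>I. X k \<omega> \<in> A k} = (\<Prod>k\<in>I. measure (\<nu> k) (A k))"
proof -
  have "prob_space M \<Longrightarrow> (\<And>k. k \<in> I \<Longrightarrow> X k \<in> borel_measurable M) \<Longrightarrow>
    (\<And>k. k \<in> I \<Longrightarrow> real_distribution (\<nu> k)) \<Longrightarrow>
    (\<And>\<theta>. (\<integral>\<omega>. iexp (\<Sum>k\<in>I. \<theta> k * X k \<omega>) \<partial>M) = (\<Prod>k\<in>I. char (\<nu> k) (\<theta> k))) \<Longrightarrow>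
    (\<And>k. k \<in> I \<Longrightarrow> A k \<in> sets borel) \<Longrightarrow>
    measure M {\<omega>\<in>space M. \<forall>k\<in>I. X k \<omega> \<in> A k} = (\<Prod>k\<in>I. measure (\<nu> k) (A k))"
    using \<open>finite I\<close>
  proof (induction I arbitrary: M)
    case empty
    then show ?case by (simp add: prob_space.prob_space)
  next
    case (insert k I)
    interpret prob_space M by fact
    note X[measurable] = insert.prems(2)
    note A[measurable] = insert.prems(5)
    have kX[measurable]: "X k \<in> borel_measurable M" and kA[measurable]: "A k \<in> sets borel"
      using X A by auto
    have distr: "real_distribution (\<nu> j)" if "j \<in> insert k I" for j using insert.prems(3) that .
    define Y where "Y \<theta> \<omega> = (\<Sum>j\<in>I. \<theta> j * X j \<omega>)" for \<theta> \<omega>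
    have Y[measurable]: "Y \<theta> \<in> borel_measurable M" for \<theta>
      unfolding Y_def using X by auto
    have char_tY: "(\<integral>\<omega>. iexp (t * X k \<omega> + Y \<theta> \<omega>) \<partial>M) = char (\<nu> k) t * (\<Prod>j\<in>I. char (\<nu> j) (\<theta> j))" for t \<theta>
    proof -
      have "(\<Sum>j\<in>insert k I. (\<theta>(k := t)) j * X j \<omega>) = t * X k \<omega> + Y \<theta> \<omega>" for \<omega>
        using insert.hyps unfolding Y_def by (auto intro!: sum.cong)
      moreover have "(\<Prod>j\<in>I. char (\<nu> j) ((\<theta>(k := t)) j)) = (\<Prod>j\<in>I. char (\<nu> j) (\<theta> j))"
        using insert.hyps by (auto intro!: prod.cong)
      ultimately show ?thesis
        using insert.prems(4)[of "\<theta>(k := t)"] insert.hyps by simp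
    qed
    have charY: "(\<integral>\<omega>. iexp (Y \<theta> \<omega>) \<partial>M) = (\<Prod>j\<in>I. char (\<nu> j) (\<theta> j))" for \<theta>
      using char_tY[of 0 \<theta>] real_distribution.char_zero[OF distr[of k]] by simp
    have rY: "r * Y \<theta> \<omega> = Y (\<lambda>j. r * \<theta> j) \<omega>" for r \<theta> \<omega>
      unfolding Y_def by (simp add: sum_distrib_left mult.assoc)
    have key: "(\<integral>\<omega>. indicator (A k) (X k \<omega>) *\<^sub>R iexp (Y \<theta> \<omega>) \<partial>M)
        = measure (\<nu> k) (A k) *\<^sub>R (\<Prod>j\<in>I. char (\<nu> j) (\<theta> j))" for \<theta>
    proof (subst expectation_indicator_iexp_eq[of "X k" "Y \<theta>" "\<nu> k" "A k"])
      show "(\<integral>\<omega>. iexp (t * X k \<omega> + r * Y \<theta> \<omega>) \<partial>M) = char (\<nu> k) t * (\<integral>\<omega>. iexp (r * Y \<theta> \<omega>) \<partial>M)" for t r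
        unfolding rY char_tY charY ..
    qed (simp_all add: distr charY)
    define E where "E = {\<omega>\<in>space M. X k \<omega> \<in> A k}"
    have E[measurable]: "E \<in> sets M" unfolding E_def by measurable
    have pE: "measure M E = measure (\<nu> k) (A k)"
    proof -
      have "(\<integral>\<omega>. indicator (A k) (X k \<omega>) *\<^sub>R (1::complex) \<partial>M) = measure (\<nu> k) (A k) *\<^sub>R 1"
        using key[of "\<lambda>_. 0"] real_distribution.char_zero[OF distr] by (simp add: Y_def)
      moreover have "(\<integral>\<omega>. indicator (A k) (X k \<omega>) *\<^sub>R (1::complex) \<partial>M) = (\<integral>\<omega>. complex_of_real (indicator E \<omega>) \<partial>M)"
        by (intro Bochner_Integration.integral_cong) (auto simp: E_def indicator_def)
      moreover have "(\<integral>\<omega>. complex_of_real (indicator E \<omega>) \<partial>M) = complex_of_real (measure M E)"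
        by simp
      ultimately have "complex_of_real (measure M E) = complex_of_real (measure (\<nu> k) (A k))"
        by (simp add: scaleR_conv_of_real)
      then show ?thesis by simp
    qed
    show ?case
    proof (cases "measure M E = 0")
      case True
      have "measure M {\<omega>\<in>space M. \<forall>k\<in>insert k I. X k \<omega> \<in> A k} \<le> measure M E"
        by (intro finite_measure_mono) (auto simp: E_def)
      then have "measure M {\<omega>\<in>space M. \<forall>k\<in>insert k I. X k \<omega> \<in> A k} = 0"
        using True by (simp add: antisym)
      then show ?thesis using True pE insert.hyps by simp
    next
      case False
      then have Epos: "measure M E > 0" by (simp add: zero_less_measure_iff)
      then have E0: "emeasure M E \<noteq> 0" "emeasure M E \<noteq> \<infinity>" by (auto simp: emeasure_eq_measure)
      \<comment> \<open>By \<open>key\<close>, conditioning on \<open>E\<close> does not change the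
        joint characteristic function of the remaining variables, so the induction hypothesis
        applies to \<open>Q\<close>; this is why the induction leaves the measure arbitrary.\<close>
      define Q where "Q = uniform_measure M E"
      have Q: "prob_space Q" unfolding Q_def using E0 by (intro prob_space_uniform_measure) auto
      have Qint: "(\<integral>\<omega>. f \<omega> \<partial>Q) = (1 / measure M E) *\<^sub>R (\<integral>\<omega>. indicator (A k) (X k \<omega>) *\<^sub>R f \<omega> \<partial>M)"
        if [measurable]: "f \<in> borel_measurable M" for f :: "'a \<Rightarrow> complex"
      proof -
        have "(\<integral>\<omega>. f \<omega> \<partial>Q) = (\<integral>\<omega>. (indicator E \<omega> / measure M E) *\<^sub>R f \<omega> \<partial>M)"
        proof -
          have "Q = density M (\<lambda>\<omega>. ennreal (indicator E \<omega> / measure M E))"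
            unfolding Q_def uniform_measure_def
            by (intro density_cong) (auto simp: emeasure_eq_measure indicator_def divide_ennreal[symmetric] Epos)
          then show ?thesis by (simp add: integral_density)
        qed
        also have "\<dots> = (\<integral>\<omega>. (1 / measure M E) *\<^sub>R (indicator (A k) (X k \<omega>) *\<^sub>R f \<omega>) \<partial>M)"
          by (intro Bochner_Integration.integral_cong) (auto simp: E_def indicator_def)
        finally show ?thesis by (simp only: integral_scaleR_right)
      qed
      have IH: "measure Q {\<omega>\<in>space Q. \<forall>k\<in>I. X k \<omega> \<in> A k} = (\<Prod>k\<in>I. measure (\<nu> k) (A k))"
      proof (rule insert.IH)
        show "X j \<in> borel_measurable Q" if "j \<in> I" for j using X that unfolding Q_def by simp
        show "(\<integral>\<omega>. iexp (\<Sum>k\<in>I. \<theta> k * X k \<omega>) \<partial>Q) = (\<Prod>k\<in>I. char (\<nu> k) (\<theta> k))" for \<theta>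
          unfolding Y_def[symmetric] using Epos by (subst Qint) (auto simp: key pE)
      qed (use Q distr A in auto)
      have S[measurable]: "{\<omega>\<in>space M. \<forall>k\<in>I. X k \<omega> \<in> A k} \<in> sets M"
      proof (rule sets.sets_Collect_finite_All[OF _ insert.hyps(1)])
        show "{\<omega> \<in> space M. X j \<omega> \<in> A j} \<in> sets M" if "j \<in> I" for j
        proof -
          have [measurable]: "X j \<in> borel_measurable M" "A j \<in> sets borel" using X A that by auto
          show ?thesis by measurable
        qed
      qed
      have "measure M {\<omega>\<in>space M. \<forall>k\<in>insert k I. X k \<omega> \<in> A k} = measure M (E \<inter> {\<omega>\<in>space M. \<forall>k\<in>I. X k \<omega> \<in> A k})"
        by (intro arg_cong[where f="measure M"]) (auto simp: E_def)
      also have "\<dots> = measure M E * measure Q {\<omega>\<in>space M. \<forall>k\<in>I. X k \<omega> \<in> A k}"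
        unfolding Q_def using E0 Epos by (subst measure_uniform_measure) auto
      also have "measure Q {\<omega>\<in>space M. \<forall>k\<in>I. X k \<omega> \<in> A k} = (\<Prod>k\<in>I. measure (\<nu> k) (A k))"
        using IH by (simp add: Q_def)
      finally show ?thesis using insert.hyps pE by simp
    qed
  qed
  then show ?thesis using assms by blast
qed

section \<open>Joint law of a Gaussian family with diagonal covariance\<close>

lemma (in prob_space) expectation_iexp_centered_gaussian_rv:
  assumes "centered_gaussian_rv M X v" "0 \<le> v" and [measurable]: "X \<in> borel_measurable M"
  shows "(\<integral>\<omega>. iexp (X \<omega>) \<partial>M) = exp (- v / 2)"
proof (cases "v = 0")
  case True
  then have "AE \<omega> in M. X \<omega> = 0" using assms by (simp add: centered_gaussian_rv_def)
  then have "(\<integral>\<omega>. iexp (X \<omega>) \<partial>M) = (\<integral>\<omega>. 1 \<partial>M)"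
    by (intro integral_cong_AE) auto
  then show ?thesis using True by (simp add: prob_space)
next
  case False
  then have v: "0 < sqrt v" using assms(2) by simp
  have "distributed M lborel X (normal_density 0 (sqrt v))"
    using assms(1) False by (simp add: centered_gaussian_rv_def)
  then have "distributed M lborel (\<lambda>x. (X x - 0) / sqrt v) std_normal_density"
    by (subst (asm) normal_standard_normal_convert[OF v])
  then have d: "distr M lborel (\<lambda>x. X x / sqrt v) = std_normal_distribution"
    by (simp add: distributed_def)
  have "(\<integral>\<omega>. iexp (X \<omega>) \<partial>M) = (\<integral>\<omega>. iexp (sqrt v * (X \<omega> / sqrt v)) \<partial>M)"
    using v by simp
  also have "\<dots> = (\<integral>x. iexp (sqrt v * x) \<partial>distr M lborel (\<lambda>x. X x / sqrt v))"
    by (subst integral_distr) auto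
  also have "\<dots> = char std_normal_distribution (sqrt v)"
    unfolding d char_def ..
  also have "\<dots> = exp (- v / 2)"
    unfolding char_std_normal_distribution using assms(2) by simp
  finally show ?thesis .
qed

text \<open>Parametrised by the variance instead of the standard deviation, because variances add
  over disjoint cells.\<close>

definition normal_law :: "real \<Rightarrow> real measure" where
  "normal_law v = density lborel (\<lambda>x. ennreal (normal_density 0 (sqrt v) x))"

lemma sets_normal_law[simp, measurable_cong]: "sets (normal_law v) = sets borel"
  and space_normal_law[simp]: "space (normal_law v) = UNIV"
  by (simp_all add: normal_law_def)

lemma prob_space_normal_law: "0 < v \<Longrightarrow> prob_space (normal_law v)"
  unfolding normal_law_def by (rule prob_space_normal_density) simp

text \<open>A multiple of the identity under \<open>normal_law v\<close> is centred Gaussian in the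
  sense used for the sheet, the degenerate multiple 0 included, so the transform has to be computed
  only once.\<close>

lemma char_normal_law:
  assumes "0 < v"
  shows "char (normal_law v) t = exp (- (t\<^sup>2 * v) / 2)"
proof -
  interpret prob_space "normal_law v" by (rule prob_space_normal_law[OF assms])
  have id: "distributed (normal_law v) lborel (\<lambda>x. x) (normal_density 0 (sqrt v))"
    unfolding distributed_def
    by (auto simp: normal_law_def intro!: measure_eqI) (auto simp: emeasure_distr)
  have "centered_gaussian_rv (normal_law v) (\<lambda>x. t * x) (t\<^sup>2 * v)"
  proof (cases "t = 0")
    case False
    then have "distributed (normal_law v) lborel (\<lambda>x. 0 + t * x) (normal_density (0 + t * 0) (\<bar>t\<bar> * sqrt v))"
      using assms by (intro normal_density_affine[OF id]) auto
    moreover have "\<bar>t\<bar> * sqrt v = sqrt (t\<^sup>2 * v)" by (simp add: real_sqrt_mult)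
    ultimately show ?thesis using False assms by (simp add: centered_gaussian_rv_def)
  qed (simp add: centered_gaussian_rv_def)
  from expectation_iexp_centered_gaussian_rv[OF this] assms show ?thesis
    by (simp add: char_def)
qed

text \<open>A diagonal variance for every linear combination makes the joint characteristic function
  a product, and \<open>prob_Inter_eq_prod_of_char\<close> turns this into a product law on boxes.
  Independence comes out instead of being assumed.\<close>

lemma (in prob_space) distr_PiM_gaussian_family:
  assumes K: "finite K" and X[measurable]: "\<And>k. k \<in> K \<Longrightarrow> X k \<in> borel_measurable M"
    and v: "\<And>k. k \<in> K \<Longrightarrow> 0 < v k"
    and gauss: "\<And>\<theta>. centered_gaussian_rv M (\<lambda>\<omega>. \<Sum>k\<in>K. \<theta> k * X k \<omega>) (\<Sum>k\<in>K. (\<theta> k)\<^sup>2 * v k)"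
  shows "distr M (\<Pi>\<^sub>M k\<in>K. borel) (\<lambda>\<omega>. \<lambda>k\<in>K. X k \<omega>) = (\<Pi>\<^sub>M k\<in>K. normal_law (v k))"
proof -
  \<comment> \<open>The value 1 outside \<open>K\<close> makes every factor a probability measure,
    as the product construction expects a family over all indices.\<close>
  define v' where "v' k = (if k \<in> K then v k else 1)" for k
  have v': "0 < v' k" for k using v by (simp add: v'_def)
  interpret P: product_sigma_finite "\<lambda>k. normal_law (v' k)"
    unfolding product_sigma_finite_def
    using prob_space_normal_law[OF v'] by (auto intro: prob_space_imp_sigma_finite)
  have m[measurable]: "(\<lambda>\<omega>. \<lambda>k\<in>K. X k \<omega>) \<in> M \<rightarrow>\<^sub>M (\<Pi>\<^sub>M k\<in>K. borel)"
    by (rule measurable_restrict) (rule X)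
  have "distr M (\<Pi>\<^sub>M k\<in>K. borel) (\<lambda>\<omega>. \<lambda>k\<in>K. X k \<omega>) = (\<Pi>\<^sub>M k\<in>K. normal_law (v' k))"
  proof (rule P.PiM_eqI[OF K])
    show "sets (distr M (\<Pi>\<^sub>M k\<in>K. borel) (\<lambda>\<omega>. \<lambda>k\<in>K. X k \<omega>)) = sets (\<Pi>\<^sub>M k\<in>K. normal_law (v' k))"
      by (auto intro!: sets_PiM_cong)
    fix A assume "\<And>k. k \<in> K \<Longrightarrow> A k \<in> sets (normal_law (v' k))"
    then have A: "A k \<in> sets borel" if "k \<in> K" for k using that by simp
    have "emeasure (distr M (\<Pi>\<^sub>M k\<in>K. borel) (\<lambda>\<omega>. \<lambda>k\<in>K. X k \<omega>)) (Pi\<^sub>E K A)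
        = emeasure M {\<omega>\<in>space M. \<forall>k\<in>K. X k \<omega> \<in> A k}"
      using A K by (subst emeasure_distr) (auto intro!: arg_cong[where f="emeasure M"] sets_PiM_I_finite)
    also have "\<dots> = ennreal (\<Prod>k\<in>K. measure (normal_law (v' k)) (A k))"
      unfolding emeasure_eq_measure
    proof (intro arg_cong[where f=ennreal] prob_Inter_eq_prod_of_char)
      show "real_distribution (normal_law (v' k))" for k
        using prob_space_normal_law[OF v'] by (intro real_distribution.intro) (auto simp: real_distribution_axioms_def)
      fix \<theta>
      have "(\<integral>\<omega>. iexp (\<Sum>k\<in>K. \<theta> k * X k \<omega>) \<partial>M) = exp (- (\<Sum>k\<in>K. (\<theta> k)\<^sup>2 * v k) / 2)"
        by (rule expectation_iexp_centered_gaussian_rv[OF gauss])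
           (auto intro!: sum_nonneg mult_nonneg_nonneg less_imp_le[OF v] borel_measurable_sum borel_measurable_times X)
      also have "\<dots> = (\<Prod>k\<in>K. complex_of_real (exp (- ((\<theta> k)\<^sup>2 * v k) / 2)))"
        using K by (simp add: sum_negf[symmetric] sum_divide_distrib exp_sum exp_of_real[symmetric])
      also have "\<dots> = (\<Prod>k\<in>K. char (normal_law (v' k)) (\<theta> k))"
        unfolding char_normal_law[OF v'] by (auto simp: v'_def intro!: prod.cong)
      finally show "(\<integral>\<omega>. iexp (\<Sum>k\<in>K. \<theta> k * X k \<omega>) \<partial>M) = (\<Prod>k\<in>K. char (normal_law (v' k)) (\<theta> k))" .
    qed (use K X A prob_space_axioms in auto)
    also have "\<dots> = (\<Prod>k\<in>K. emeasure (normal_law (v' k)) (A k))"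
    proof -
      interpret N: prob_space "normal_law (v' k)" for k by (rule prob_space_normal_law[OF v'])
      show ?thesis by (simp add: N.emeasure_eq_measure prod_ennreal)
    qed
    finally show "emeasure (distr M (\<Pi>\<^sub>M k\<in>K. borel) (\<lambda>\<omega>. \<lambda>k\<in>K. X k \<omega>)) (Pi\<^sub>E K A)
      = (\<Prod>k\<in>K. emeasure (normal_law (v' k)) (A k))" .
  qed
  also have "\<dots> = (\<Pi>\<^sub>M k\<in>K. normal_law (v k))"
    by (intro PiM_cong) (auto simp: v'_def)
  finally show ?thesis .
qed

subsection \<open>Resampling in finite product spaces\<close>

text \<open>This is (2a - b)^2 \<ge> 0. The coefficients are those needed in
  \<open>resample_sum_square_le\<close>, where the square of b stands on the left with coefficient
  two and one copy of it is cancelled.\<close>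

lemma ennreal_amgm: "4 * a * b \<le> 4 * a\<^sup>2 + (b::ennreal)\<^sup>2"
proof (cases a; cases b)
  fix x y :: real assume *: "a = ennreal x" "0 \<le> x" "b = ennreal y" "0 \<le> y"
  have "4 * x * y \<le> 4 * x\<^sup>2 + y\<^sup>2"
    using zero_le_power2[of "2 * x - y"] by (simp add: power2_eq_square algebra_simps)
  moreover have "4 * a * b = ennreal (4 * x * y)" "4 * a\<^sup>2 + b\<^sup>2 = ennreal (4 * x\<^sup>2 + y\<^sup>2)"
    using * by (simp_all add: ennreal_mult ennreal_power[symmetric])
  ultimately show ?thesis by (metis ennreal_leI)
qed (auto simp: power2_eq_square ennreal_mult_top ennreal_top_mult)

text \<open>Scaling the two functions by free constants in \<open>ennreal_amgm\<close> gives a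
  quadratic inequality, and the constants are then optimised. Finiteness of both norms allows this
  to be done over the reals.\<close>

lemma nn_integral_Cauchy_Schwarz:
  assumes [measurable]: "f \<in> borel_measurable M" "g \<in> borel_measurable M"
    and fin: "(\<integral>\<^sup>+x. (f x)\<^sup>2 \<partial>M) < \<top>" "(\<integral>\<^sup>+x. (g x)\<^sup>2 \<partial>M) < \<top>"
  shows "(\<integral>\<^sup>+x. f x * g x \<partial>M)\<^sup>2 \<le> (\<integral>\<^sup>+x. (f x)\<^sup>2 \<partial>M) * (\<integral>\<^sup>+x. (g x)\<^sup>2 \<partial>M)"
proof -
  obtain a where a: "(\<integral>\<^sup>+x. (f x)\<^sup>2 \<partial>M) = ennreal a" "0 \<le> a"
    using fin(1) by (cases "(\<integral>\<^sup>+x. (f x)\<^sup>2 \<partial>M)") auto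
  obtain b where b: "(\<integral>\<^sup>+x. (g x)\<^sup>2 \<partial>M) = ennreal b" "0 \<le> b"
    using fin(2) by (cases "(\<integral>\<^sup>+x. (g x)\<^sup>2 \<partial>M)") auto
  have scaled: "4 * ennreal (s * t) * (\<integral>\<^sup>+x. f x * g x \<partial>M) \<le> ennreal (4 * s\<^sup>2 * a + t\<^sup>2 * b)"
    if st: "0 \<le> s" "0 \<le> t" for s t :: real
  proof -
    have "4 * ennreal (s * t) * (\<integral>\<^sup>+x. f x * g x \<partial>M) = (\<integral>\<^sup>+x. 4 * (ennreal s * f x) * (ennreal t * g x) \<partial>M)"
      using st by (subst nn_integral_cmult[symmetric]) (auto intro!: nn_integral_cong simp: ennreal_mult ac_simps)
    also have "\<dots> \<le> (\<integral>\<^sup>+x. 4 * (ennreal s * f x)\<^sup>2 + (ennreal t * g x)\<^sup>2 \<partial>M)"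
      by (intro nn_integral_mono ennreal_amgm)
    also have "\<dots> = (\<integral>\<^sup>+x. ennreal (4 * s\<^sup>2) * (f x)\<^sup>2 + ennreal (t\<^sup>2) * (g x)\<^sup>2 \<partial>M)"
      using st by (auto intro!: nn_integral_cong simp: power_mult_distrib ennreal_mult ennreal_power ac_simps)
    also have "\<dots> = ennreal (4 * s\<^sup>2) * ennreal a + ennreal (t\<^sup>2) * ennreal b"
      by (subst nn_integral_add) (auto simp: nn_integral_cmult a b)
    also have "\<dots> = ennreal (4 * s\<^sup>2 * a + t\<^sup>2 * b)"
      using a b by (simp add: ennreal_mult)
    finally show ?thesis .
  qed
  have "(\<integral>\<^sup>+x. f x * g x \<partial>M) \<noteq> \<top>"
    using scaled[of 1 1] by (auto simp: top_unique ennreal_mult_top)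
  then obtain c where c: "(\<integral>\<^sup>+x. f x * g x \<partial>M) = ennreal c" "0 \<le> c"
    by (cases "\<integral>\<^sup>+x. f x * g x \<partial>M") auto
  have sc: "4 * (s * t) * c \<le> 4 * s\<^sup>2 * a + t\<^sup>2 * b" if st: "0 \<le> s" "0 \<le> t" for s t :: real
  proof -
    have "ennreal (4 * (s * t) * c) \<le> ennreal (4 * s\<^sup>2 * a + t\<^sup>2 * b)"
      using scaled[OF st] c st by (simp add: ennreal_mult mult.assoc)
    then show ?thesis using a b st by (subst (asm) ennreal_le_iff) auto
  qed
  have "c\<^sup>2 \<le> a * b"
  proof (cases "a = 0 \<or> b = 0")
    case True
    have "c = 0"
    proof (rule ccontr)
      \<comment> \<open>If one norm vanishes, its function can be scaled up without cost, and a
        factor of order 1 / c already contradicts c > 0.\<close>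
      assume "c \<noteq> 0"
      then have "0 < c" using c by simp
      from True show False
      proof
        assume "a = 0"
        with sc[of "(b + 1) / c" 1] \<open>0 \<le> b\<close> \<open>0 < c\<close> show False by simp
      next
        assume "b = 0"
        with sc[of 1 "(a + 1) / c"] \<open>0 \<le> a\<close> \<open>0 < c\<close> show False by simp
      qed
    qed
    then show ?thesis using a b by simp
  next
    case False
    then have pos: "0 < a" "0 < b" using a b by auto
    \<comment> \<open>With these scalings 2 s sqrt a = t sqrt b, the equality case of
      \<open>ennreal_amgm\<close>.\<close>
    have "4 * (sqrt b * (2 * sqrt a)) * c \<le> 4 * (sqrt b)\<^sup>2 * a + (2 * sqrt a)\<^sup>2 * b"
      using pos by (intro sc) auto
    also have "\<dots> = 8 * (a * b)" using pos by (simp add: power_mult_distrib)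
    finally have "8 * (sqrt (a * b) * c) \<le> 8 * (sqrt (a * b) * sqrt (a * b))"
      using pos by (simp add: real_sqrt_mult algebra_simps)
    then have "sqrt (a * b) * c \<le> sqrt (a * b) * sqrt (a * b)" by (rule mult_left_le_imp_le) simp
    moreover have "0 < sqrt (a * b)" using pos by simp
    ultimately have "c \<le> sqrt (a * b)" by (rule mult_left_le_imp_le)
    then have "c\<^sup>2 \<le> (sqrt (a * b))\<^sup>2" using c by (intro power_mono) auto
    then show ?thesis using pos by simp
  qed
  then have "ennreal (c\<^sup>2) \<le> ennreal (a * b)" by (rule ennreal_leI)
  then show ?thesis unfolding a b c using a b c by (simp add: ennreal_mult ennreal_power)
qed

locale resampling = finite_product_prob_space M I
  for M :: "'i \<Rightarrow> 'a measure" and I :: "'i set"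
begin

definition mix :: "'i set \<Rightarrow> ('i \<Rightarrow> 'a) \<Rightarrow> ('i \<Rightarrow> 'a) \<Rightarrow> 'i \<Rightarrow> 'a" where
  "mix S \<omega> \<omega>' = (\<lambda>k\<in>I. if k \<in> S then \<omega>' k else \<omega> k)"

text \<open>The conditional expectation given the coordinates outside \<open>S\<close>, in the
  version that integrates the coordinates in \<open>S\<close> over an independent copy. It is
  defined at every point, so identities hold without exceptional null sets.\<close>

definition resample :: "'i set \<Rightarrow> (('i \<Rightarrow> 'a) \<Rightarrow> ennreal) \<Rightarrow> ('i \<Rightarrow> 'a) \<Rightarrow> ennreal" where
  "resample S f \<omega> = (\<integral>\<^sup>+\<omega>'. f (mix S \<omega> \<omega>') \<partial>PiM I M)"

lemma measurable_mix[measurable]: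
  "(\<lambda>p. mix S (fst p) (snd p)) \<in> PiM I M \<Otimes>\<^sub>M PiM I M \<rightarrow>\<^sub>M PiM I M"
  unfolding mix_def
proof (rule measurable_restrict)
  fix k assume [measurable]: "k \<in> I"
  show "(\<lambda>p. if k \<in> S then snd p k else fst p k) \<in> PiM I M \<Otimes>\<^sub>M PiM I M \<rightarrow>\<^sub>M M k"
    by (cases "k \<in> S") auto
qed

lemma measurable_mix2[measurable]:
  assumes \<omega>: "\<omega> \<in> space (PiM I M)"
  shows "mix S \<omega> \<in> PiM I M \<rightarrow>\<^sub>M PiM I M"
  using measurable_compose[OF measurable_Pair1'[OF \<omega>] measurable_mix[of S]] by simp

lemma mix_in_space: "\<omega> \<in> space (PiM I M) \<Longrightarrow> \<omega>' \<in> space (PiM I M) \<Longrightarrow> mix S \<omega> \<omega>' \<in> space (PiM I M)"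
  by (auto simp: space_PiM mix_def PiE_iff)

lemma mix_mix: "mix T (mix S \<omega> \<omega>') \<omega>'' = mix (S \<union> T) \<omega> (mix T \<omega>' \<omega>'')"
  by (auto simp: mix_def restrict_def)

lemma mix_mix_subset: "S \<subseteq> T \<Longrightarrow> mix T (mix S \<omega> \<omega>') \<omega>'' = mix T \<omega> \<omega>''"
  by (auto simp: mix_def restrict_def fun_eq_iff)

lemma prob_space_PiM_I: "prob_space (PiM I M)"
  by unfold_locales

sublocale PP: pair_prob_space "PiM I M" "PiM I M"
  by unfold_locales

text \<open>Replacing some coordinates by those of an independent copy preserves a product law. On a
  box, the sides in \<open>S\<close> are tested on the copy and the other sides on the
  original.\<close>

lemma distr_mix: "distr (PiM I M \<Otimes>\<^sub>M PiM I M) (PiM I M) (\<lambda>p. mix S (fst p) (snd p)) = PiM I M"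
proof (rule PiM_eqI[OF finite_index])
  show "sets (distr (PiM I M \<Otimes>\<^sub>M PiM I M) (PiM I M) (\<lambda>p. mix S (fst p) (snd p))) = sets (PiM I M)"
    by (rule sets_distr)
  fix A assume A: "\<And>k. k \<in> I \<Longrightarrow> A k \<in> sets (M k)"
  let ?B = "\<lambda>k. if k \<in> S then space (M k) else A k" and ?C = "\<lambda>k. if k \<in> S then A k else space (M k)"
  have BC: "\<And>k. k \<in> I \<Longrightarrow> ?B k \<in> sets (M k)" "\<And>k. k \<in> I \<Longrightarrow> ?C k \<in> sets (M k)"
    using A by auto
  have "(\<lambda>p. mix S (fst p) (snd p)) -` (Pi\<^sub>E I A) \<inter> space (PiM I M \<Otimes>\<^sub>M PiM I M) = Pi\<^sub>E I ?B \<times> Pi\<^sub>E I ?C"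
    using sets.sets_into_space[OF A]
    by (auto simp: space_pair_measure space_PiM mix_def PiE_iff split: if_splits) blast+
  then have "emeasure (distr (PiM I M \<Otimes>\<^sub>M PiM I M) (PiM I M) (\<lambda>p. mix S (fst p) (snd p))) (Pi\<^sub>E I A)
      = emeasure (PiM I M \<Otimes>\<^sub>M PiM I M) (Pi\<^sub>E I ?B \<times> Pi\<^sub>E I ?C)"
    using A by (subst emeasure_distr) (auto intro!: sets_PiM_I_finite finite_index)
  also have "\<dots> = emeasure (PiM I M) (Pi\<^sub>E I ?B) * emeasure (PiM I M) (Pi\<^sub>E I ?C)"
    using BC by (intro sigma_finite_measure.emeasure_pair_measure_Times prob_space_imp_sigma_finite prob_space_PiM_I sets_PiM_I_finite finite_index) auto
  also have "\<dots> = (\<Prod>k\<in>I. emeasure (M k) (?B k)) * (\<Prod>k\<in>I. emeasure (M k) (?C k))"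
    using BC by (simp only: emeasure_PiM finite_index)
  also have "\<dots> = (\<Prod>k\<in>I. emeasure (M k) (A k))"
    unfolding prod.distrib[symmetric] by (intro prod.cong) (auto simp: M.emeasure_space_1)
  finally show "emeasure (distr (PiM I M \<Otimes>\<^sub>M PiM I M) (PiM I M) (\<lambda>p. mix S (fst p) (snd p))) (Pi\<^sub>E I A) = (\<Prod>k\<in>I. emeasure (M k) (A k))" .
qed

section \<open>Calculus of conditional expectations given sets of coordinates\<close>

lemma borel_measurable_resample[measurable]:
  assumes [measurable]: "f \<in> borel_measurable (PiM I M)"
  shows "resample S f \<in> borel_measurable (PiM I M)"
proof -
  have "(\<lambda>\<omega>. \<integral>\<^sup>+\<omega>'. f (mix S (fst (\<omega>, \<omega>')) (snd (\<omega>, \<omega>'))) \<partial>PiM I M) \<in> borel_measurable (PiM I M)"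
    by measurable
  then show ?thesis by (simp add: resample_def[abs_def])
qed

lemma nn_integral_resample:
  assumes [measurable]: "f \<in> borel_measurable (PiM I M)"
  shows "(\<integral>\<^sup>+\<omega>. resample S f \<omega> \<partial>PiM I M) = (\<integral>\<^sup>+\<omega>. f \<omega> \<partial>PiM I M)"
proof -
  have "(\<integral>\<^sup>+\<omega>. resample S f \<omega> \<partial>PiM I M) = (\<integral>\<^sup>+\<omega>. \<integral>\<^sup>+\<omega>'. (\<lambda>p. f (mix S (fst p) (snd p))) (\<omega>, \<omega>') \<partial>PiM I M \<partial>PiM I M)"
    by (simp add: resample_def)
  also have "\<dots> = (\<integral>\<^sup>+p. f (mix S (fst p) (snd p)) \<partial>(PiM I M \<Otimes>\<^sub>M PiM I M))"
    by (intro sigma_finite_measure.nn_integral_fst prob_space_imp_sigma_finite prob_space_PiM_I) simp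
  also have "\<dots> = (\<integral>\<^sup>+\<omega>. f \<omega> \<partial>distr (PiM I M \<Otimes>\<^sub>M PiM I M) (PiM I M) (\<lambda>p. mix S (fst p) (snd p)))"
    by (subst nn_integral_distr) simp_all
  finally show ?thesis unfolding distr_mix .
qed

lemma resample_mono: "(\<And>\<omega>. \<omega> \<in> space (PiM I M) \<Longrightarrow> f \<omega> \<le> g \<omega>) \<Longrightarrow> \<omega> \<in> space (PiM I M) \<Longrightarrow> resample S f \<omega> \<le> resample S g \<omega>"
  unfolding resample_def by (intro nn_integral_mono) (simp add: mix_in_space)

lemma resample_const[simp]: "resample S (\<lambda>_. c) \<omega> = c"
  unfolding resample_def using prob_space.emeasure_space_1[OF prob_space_PiM_I] by simp

lemma resample_mult:
  assumes [measurable]: "f \<in> borel_measurable (PiM I M)" and \<omega>: "\<omega> \<in> space (PiM I M)"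
    and g: "\<And>\<omega>'. \<omega>' \<in> space (PiM I M) \<Longrightarrow> g (mix S \<omega> \<omega>') = g \<omega>"
  shows "resample S (\<lambda>\<omega>. g \<omega> * f \<omega>) \<omega> = g \<omega> * resample S f \<omega>"
proof -
  have [measurable]: "mix S \<omega> \<in> PiM I M \<rightarrow>\<^sub>M PiM I M" using \<omega> by simp
  have "resample S (\<lambda>\<omega>. g \<omega> * f \<omega>) \<omega> = (\<integral>\<^sup>+\<omega>'. g \<omega> * f (mix S \<omega> \<omega>') \<partial>PiM I M)"
    unfolding resample_def using g by (intro nn_integral_cong) simp
  also have "\<dots> = g \<omega> * resample S f \<omega>"
    unfolding resample_def by (rule nn_integral_cmult) simp
  finally show ?thesis .
qed

lemma resample_cmult:
  assumes [measurable]: "f \<in> borel_measurable (PiM I M)" and \<omega>: "\<omega> \<in> space (PiM I M)"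
  shows "resample S (\<lambda>\<omega>. c * f \<omega>) \<omega> = c * resample S f \<omega>"
  using resample_mult[OF assms, of "\<lambda>_. c"] by simp

lemma resample_sum:
  assumes [measurable]: "\<And>j. j \<in> J \<Longrightarrow> f j \<in> borel_measurable (PiM I M)" and \<omega>: "\<omega> \<in> space (PiM I M)"
  shows "resample S (\<lambda>\<omega>. \<Sum>j\<in>J. f j \<omega>) \<omega> = (\<Sum>j\<in>J. resample S (f j) \<omega>)"
  unfolding resample_def
  by (intro nn_integral_sum) (rule measurable_compose[OF measurable_mix2[OF \<omega>] assms(1)])

text \<open>Resampling twice involves two independent copies, but in each coordinate only one of
  them survives, so together they act as one copy. In particular resamplings of different sets
  commute, the property on which the iteration over several parameters rests.\<close>

lemma resample_resample:
  assumes [measurable]: "f \<in> borel_measurable (PiM I M)" and \<omega>: "\<omega> \<in> space (PiM I M)"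
  shows "resample S (resample T f) \<omega> = resample (S \<union> T) f \<omega>"
proof -
  have [measurable]: "mix (S \<union> T) \<omega> \<in> PiM I M \<rightarrow>\<^sub>M PiM I M" using \<omega> by simp
  have "resample S (resample T f) \<omega> = (\<integral>\<^sup>+\<omega>'. resample T (\<lambda>\<omega>''. f (mix (S \<union> T) \<omega> \<omega>'')) \<omega>' \<partial>PiM I M)"
    unfolding resample_def by (simp add: mix_mix)
  also have "\<dots> = (\<integral>\<^sup>+\<omega>'. f (mix (S \<union> T) \<omega> \<omega>') \<partial>PiM I M)"
    by (intro nn_integral_resample) simp
  finally show ?thesis by (simp add: resample_def)
qed

lemma resample_mix: "S \<subseteq> T \<Longrightarrow> resample T f (mix S \<omega> \<omega>') = resample T f \<omega>"
  by (simp add: resample_def mix_mix_subset)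

lemma nn_integral_resample_mult:
  assumes [measurable]: "f \<in> borel_measurable (PiM I M)" "g \<in> borel_measurable (PiM I M)"
    and g: "\<And>\<omega> \<omega>'. \<omega> \<in> space (PiM I M) \<Longrightarrow> \<omega>' \<in> space (PiM I M) \<Longrightarrow> g (mix S \<omega> \<omega>') = g \<omega>"
  shows "(\<integral>\<^sup>+\<omega>. g \<omega> * resample S f \<omega> \<partial>PiM I M) = (\<integral>\<^sup>+\<omega>. g \<omega> * f \<omega> \<partial>PiM I M)"
proof -
  have "(\<integral>\<^sup>+\<omega>. g \<omega> * f \<omega> \<partial>PiM I M) = (\<integral>\<^sup>+\<omega>. resample S (\<lambda>\<omega>. g \<omega> * f \<omega>) \<omega> \<partial>PiM I M)"
    by (rule nn_integral_resample[symmetric]) simp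
  also have "\<dots> = (\<integral>\<^sup>+\<omega>. g \<omega> * resample S f \<omega> \<partial>PiM I M)"
    using g by (intro nn_integral_cong resample_mult) auto
  finally show ?thesis by simp
qed

text \<open>Both sides equal the integral of \<open>resample S f\<close> times
  \<open>resample S g\<close>, as each of the two is unaffected by mixing on
  \<open>S\<close>.\<close>

lemma resample_self_adjoint:
  assumes [measurable]: "f \<in> borel_measurable (PiM I M)" "g \<in> borel_measurable (PiM I M)"
  shows "(\<integral>\<^sup>+\<omega>. resample S f \<omega> * g \<omega> \<partial>PiM I M) = (\<integral>\<^sup>+\<omega>. f \<omega> * resample S g \<omega> \<partial>PiM I M)"
  using nn_integral_resample_mult[of g "resample S f" S] nn_integral_resample_mult[of f "resample S g" S]
  by (simp add: resample_mix mult.commute)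

text \<open>The dual form of Doob's maximal inequality in L2: expanding the square, each mixed term
  with i <= j loses its outer conditional expectation.\<close>

lemma resample_sum_square_le:
  fixes S :: "'j::linorder \<Rightarrow> 'i set"
  assumes J: "finite J" and S: "\<And>i j. i \<in> J \<Longrightarrow> j \<in> J \<Longrightarrow> i \<le> j \<Longrightarrow> S j \<subseteq> S i"
    and g[measurable]: "\<And>j. j \<in> J \<Longrightarrow> g j \<in> borel_measurable (PiM I M)"
    and bounded: "\<And>j \<omega>. j \<in> J \<Longrightarrow> \<omega> \<in> space (PiM I M) \<Longrightarrow> g j \<omega> \<le> c" and c: "c < \<top>"
  shows "(\<integral>\<^sup>+\<omega>. (\<Sum>j\<in>J. resample (S j) (g j) \<omega>)\<^sup>2 \<partial>PiM I M) \<le> 4 * (\<integral>\<^sup>+\<omega>. (\<Sum>j\<in>J. g j \<omega>)\<^sup>2 \<partial>PiM I M)"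
proof -
  let ?P = "PiM I M"
  let ?b = "\<lambda>j. resample (S j) (g j)"
  let ?B = "\<lambda>\<omega>. \<Sum>j\<in>J. ?b j \<omega>" and ?G = "\<lambda>\<omega>. \<Sum>j\<in>J. g j \<omega>"
  let ?A = "\<integral>\<^sup>+\<omega>. (?B \<omega>)\<^sup>2 \<partial>?P"
  have b[measurable]: "?b j \<in> borel_measurable ?P" if "j \<in> J" for j using g[OF that] by simp
  \<comment> \<open>At the end one copy of \<open>?A\<close> is cancelled from both sides; the
    uniform bound \<open>c\<close> makes it finite.\<close>
  have fin: "?A < \<top>"
  proof -
    have "?b j \<omega> \<le> c" if "j \<in> J" "\<omega> \<in> space ?P" for j \<omega>
      using resample_mono[of "g j" "\<lambda>_. c" \<omega> "S j"] bounded that by simp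
    then have "?A \<le> (\<integral>\<^sup>+\<omega>. (of_nat (card J) * c)\<^sup>2 \<partial>?P)"
      by (intro nn_integral_mono power_mono sum_bounded_above) auto
    also have "\<dots> = (of_nat (card J) * c)\<^sup>2"
      using prob_space.emeasure_space_1[OF prob_space_PiM_I] by simp
    also have "\<dots> < \<top>" using c by (simp add: power2_eq_square ennreal_mult_less_top of_nat_less_top)
    finally show ?thesis .
  qed
  \<comment> \<open>Each pair of indices is ordered one way or the other, the diagonal both ways; by
    symmetry one ordering is kept and doubled.\<close>
  have "(?B \<omega>)\<^sup>2 \<le> 2 * (\<Sum>j\<in>J. \<Sum>i\<in>{i\<in>J. i \<le> j}. ?b i \<omega> * ?b j \<omega>)" for \<omega>
  proof -
    let ?t = "\<lambda>i j. ?b i \<omega> * ?b j \<omega>"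
    have "(?B \<omega>)\<^sup>2 = (\<Sum>j\<in>J. \<Sum>i\<in>J. ?t i j)"
      unfolding power2_eq_square sum_product by (rule sum.swap)
    also have "\<dots> \<le> (\<Sum>j\<in>J. \<Sum>i\<in>J. (if i \<le> j then ?t i j else 0) + (if j \<le> i then ?t i j else 0))"
      by (intro sum_mono) auto
    also have "\<dots> = (\<Sum>j\<in>J. \<Sum>i\<in>J. if i \<le> j then ?t i j else 0) + (\<Sum>j\<in>J. \<Sum>i\<in>J. if j \<le> i then ?t i j else 0)"
      by (simp add: sum.distrib)
    also have "(\<Sum>j\<in>J. \<Sum>i\<in>J. if j \<le> i then ?t i j else 0) = (\<Sum>j\<in>J. \<Sum>i\<in>J. if i \<le> j then ?t i j else 0)"
      by (subst sum.swap, intro sum.cong refl) (simp add: mult.commute)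
    also have "(\<Sum>j\<in>J. \<Sum>i\<in>J. if i \<le> j then ?t i j else 0) = (\<Sum>j\<in>J. \<Sum>i\<in>{i\<in>J. i \<le> j}. ?t i j)"
      using J by (simp add: sum.inter_filter)
    finally show ?thesis by (simp add: mult_2)
  qed
  then have "?A \<le> (\<integral>\<^sup>+\<omega>. 2 * (\<Sum>j\<in>J. \<Sum>i\<in>{i\<in>J. i \<le> j}. ?b i \<omega> * ?b j \<omega>) \<partial>?P)"
    by (intro nn_integral_mono)
  also have "\<dots> = 2 * (\<Sum>j\<in>J. \<Sum>i\<in>{i\<in>J. i \<le> j}. \<integral>\<^sup>+\<omega>. ?b i \<omega> * ?b j \<omega> \<partial>?P)"
    by (subst nn_integral_cmult, (auto intro!: borel_measurable_sum borel_measurable_times b)[],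
        subst nn_integral_sum, (auto intro!: borel_measurable_sum borel_measurable_times b)[],
        intro arg_cong[where f="\<lambda>x. 2 * x"] sum.cong refl nn_integral_sum borel_measurable_times b) auto
  also have "\<dots> = 2 * (\<Sum>j\<in>J. \<Sum>i\<in>{i\<in>J. i \<le> j}. \<integral>\<^sup>+\<omega>. ?b i \<omega> * g j \<omega> \<partial>?P)"
  proof (intro arg_cong[where f="\<lambda>x. 2 * x"] sum.cong refl)
    fix i j assume "j \<in> J" "i \<in> {i\<in>J. i \<le> j}"
    then show "(\<integral>\<^sup>+\<omega>. ?b i \<omega> * ?b j \<omega> \<partial>?P) = (\<integral>\<^sup>+\<omega>. ?b i \<omega> * g j \<omega> \<partial>?P)"
      by (intro nn_integral_resample_mult) (auto simp: resample_mix S)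
  qed
  also have "\<dots> \<le> 2 * (\<Sum>j\<in>J. \<Sum>i\<in>J. \<integral>\<^sup>+\<omega>. ?b i \<omega> * g j \<omega> \<partial>?P)"
    using J by (intro mult_left_mono sum_mono sum_mono2) auto
  also have "\<dots> = 2 * (\<integral>\<^sup>+\<omega>. ?G \<omega> * ?B \<omega> \<partial>?P)"
  proof -
    have "(\<Sum>j\<in>J. \<Sum>i\<in>J. \<integral>\<^sup>+\<omega>. ?b i \<omega> * g j \<omega> \<partial>?P) = (\<Sum>j\<in>J. \<integral>\<^sup>+\<omega>. (\<Sum>i\<in>J. ?b i \<omega> * g j \<omega>) \<partial>?P)"
      by (intro sum.cong refl nn_integral_sum[symmetric]) simp
    also have "\<dots> = (\<integral>\<^sup>+\<omega>. (\<Sum>j\<in>J. \<Sum>i\<in>J. ?b i \<omega> * g j \<omega>) \<partial>?P)"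
      by (intro nn_integral_sum[symmetric]) simp
    also have "\<dots> = (\<integral>\<^sup>+\<omega>. ?G \<omega> * ?B \<omega> \<partial>?P)"
      by (intro nn_integral_cong) (simp add: sum_product mult.commute)
    finally show ?thesis by simp
  qed
  finally have "?A + ?A \<le> 2 * (\<integral>\<^sup>+\<omega>. ?G \<omega> * ?B \<omega> \<partial>?P) + 2 * (\<integral>\<^sup>+\<omega>. ?G \<omega> * ?B \<omega> \<partial>?P)"
    by (intro add_mono)
  also have "\<dots> = (\<integral>\<^sup>+\<omega>. 4 * ?G \<omega> * ?B \<omega> \<partial>?P)"
    by (simp add: nn_integral_cmult mult.assoc flip: distrib_right)
  also have "\<dots> \<le> (\<integral>\<^sup>+\<omega>. 4 * (?G \<omega>)\<^sup>2 + (?B \<omega>)\<^sup>2 \<partial>?P)"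
    by (intro nn_integral_mono ennreal_amgm)
  also have "\<dots> = 4 * (\<integral>\<^sup>+\<omega>. (?G \<omega>)\<^sup>2 \<partial>?P) + ?A"
    by (subst nn_integral_add) (simp_all add: nn_integral_cmult)
  finally have "?A + ?A \<le> ?A + 4 * (\<integral>\<^sup>+\<omega>. (?G \<omega>)\<^sup>2 \<partial>?P)" by (simp only: add.commute)
  then show ?thesis using fin by (subst (asm) ennreal_add_left_cancel_le) auto
qed

text \<open>Each direction contributes the factor 4 of \<open>resample_sum_square_le\<close>.
  Resampling a union is a composition, so the directions can be peeled off one at a time: the sum
  over the index being peeled is brought outside, and the other two sums move under its resampling
  by linearity.\<close>

lemma cairoli_dual:
  fixes S1 :: "'j1::linorder \<Rightarrow> 'i set" and S2 :: "'j2::linorder \<Rightarrow> 'i set" and S3 :: "'j3::linorder \<Rightarrow> 'i set"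
  assumes J: "finite J1" "finite J2" "finite J3"
    and S1: "\<And>i j. i \<in> J1 \<Longrightarrow> j \<in> J1 \<Longrightarrow> i \<le> j \<Longrightarrow> S1 j \<subseteq> S1 i"
    and S2: "\<And>i j. i \<in> J2 \<Longrightarrow> j \<in> J2 \<Longrightarrow> i \<le> j \<Longrightarrow> S2 j \<subseteq> S2 i"
    and S3: "\<And>i j. i \<in> J3 \<Longrightarrow> j \<in> J3 \<Longrightarrow> i \<le> j \<Longrightarrow> S3 j \<subseteq> S3 i"
    and g[measurable]: "\<And>i j k. g i j k \<in> borel_measurable (PiM I M)"
    and bounded: "\<And>i j k \<omega>. \<omega> \<in> space (PiM I M) \<Longrightarrow> g i j k \<omega> \<le> c" and c: "c < \<top>"
  shows "(\<integral>\<^sup>+\<omega>. (\<Sum>i\<in>J1. \<Sum>j\<in>J2. \<Sum>k\<in>J3. resample (S1 i \<union> S2 j \<union> S3 k) (g i j k) \<omega>)\<^sup>2 \<partial>PiM I M)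
    \<le> 64 * (\<integral>\<^sup>+\<omega>. (\<Sum>i\<in>J1. \<Sum>j\<in>J2. \<Sum>k\<in>J3. g i j k \<omega>)\<^sup>2 \<partial>PiM I M)" (is "?L \<le> 64 * ?R")
proof -
  let ?P = "PiM I M"
  have res_le: "resample T f \<omega> \<le> c'" if "\<And>\<omega>. \<omega> \<in> space ?P \<Longrightarrow> f \<omega> \<le> c'" "\<omega> \<in> space ?P" for T f \<omega> c'
    using resample_mono[of f "\<lambda>_. c'" \<omega> T] that by simp
  define h3 where "h3 i j k = resample (S3 k) (g i j k)" for i j k
  define h2 where "h2 i j = resample (S2 j) (\<lambda>\<omega>. \<Sum>k\<in>J3. h3 i j k \<omega>)" for i j
  have h3[measurable]: "h3 i j k \<in> borel_measurable ?P" for i j k unfolding h3_def by simp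
  have h2[measurable]: "h2 i j \<in> borel_measurable ?P" for i j unfolding h2_def by simp
  have h3_le: "h3 i j k \<omega> \<le> c" if "\<omega> \<in> space ?P" for i j k \<omega>
    unfolding h3_def by (intro res_le bounded that)
  have sum_h3_le: "(\<Sum>k\<in>J3. h3 i j k \<omega>) \<le> of_nat (card J3) * c" if "\<omega> \<in> space ?P" for i j \<omega>
    by (intro sum_bounded_above h3_le that)
  have h2_le: "h2 i j \<omega> \<le> of_nat (card J3) * c" if "\<omega> \<in> space ?P" for i j \<omega>
    unfolding h2_def by (intro res_le sum_h3_le that)
  have sum_h2_le: "(\<Sum>j\<in>J2. h2 i j \<omega>) \<le> of_nat (card J2) * (of_nat (card J3) * c)" if "\<omega> \<in> space ?P" for i \<omega>
    by (intro sum_bounded_above h2_le that)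
  have top: "of_nat n * x < \<top>" if "x < \<top>" for n and x :: ennreal
    using that by (simp add: ennreal_mult_less_top of_nat_less_top)
  have unfolded: "(\<Sum>i\<in>J1. \<Sum>j\<in>J2. \<Sum>k\<in>J3. resample (S1 i \<union> S2 j \<union> S3 k) (g i j k) \<omega>)
      = (\<Sum>i\<in>J1. resample (S1 i) (\<lambda>\<omega>. \<Sum>j\<in>J2. h2 i j \<omega>) \<omega>)" if \<omega>: "\<omega> \<in> space ?P" for \<omega>
  proof (intro sum.cong refl)
    fix i
    have "resample (S1 i) (\<lambda>\<omega>. \<Sum>j\<in>J2. h2 i j \<omega>) \<omega> = (\<Sum>j\<in>J2. resample (S1 i) (h2 i j) \<omega>)"
      by (rule resample_sum[OF _ \<omega>]) simp
    also have "\<dots> = (\<Sum>j\<in>J2. resample (S1 i \<union> S2 j) (\<lambda>\<omega>. \<Sum>k\<in>J3. h3 i j k \<omega>) \<omega>)"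
      unfolding h2_def by (intro sum.cong refl resample_resample \<omega>) simp
    also have "\<dots> = (\<Sum>j\<in>J2. \<Sum>k\<in>J3. resample (S1 i \<union> S2 j) (h3 i j k) \<omega>)"
      by (intro sum.cong refl resample_sum \<omega>) simp
    also have "\<dots> = (\<Sum>j\<in>J2. \<Sum>k\<in>J3. resample (S1 i \<union> S2 j \<union> S3 k) (g i j k) \<omega>)"
      unfolding h3_def by (intro sum.cong refl resample_resample \<omega>) simp
    finally show "(\<Sum>j\<in>J2. \<Sum>k\<in>J3. resample (S1 i \<union> S2 j \<union> S3 k) (g i j k) \<omega>)
      = resample (S1 i) (\<lambda>\<omega>. \<Sum>j\<in>J2. h2 i j \<omega>) \<omega>" ..
  qed
  have "(\<integral>\<^sup>+\<omega>. (\<Sum>i\<in>J1. \<Sum>j\<in>J2. \<Sum>k\<in>J3. resample (S1 i \<union> S2 j \<union> S3 k) (g i j k) \<omega>)\<^sup>2 \<partial>?P)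
      = (\<integral>\<^sup>+\<omega>. (\<Sum>i\<in>J1. resample (S1 i) (\<lambda>\<omega>. \<Sum>j\<in>J2. h2 i j \<omega>) \<omega>)\<^sup>2 \<partial>?P)"
    by (intro nn_integral_cong) (simp add: unfolded)
  also have "\<dots> \<le> 4 * (\<integral>\<^sup>+\<omega>. (\<Sum>i\<in>J1. \<Sum>j\<in>J2. h2 i j \<omega>)\<^sup>2 \<partial>?P)"
    by (rule resample_sum_square_le[where c="of_nat (card J2) * (of_nat (card J3) * c)"];
        (intro J S1 sum_h2_le top c borel_measurable_sum h2 h3 g)?; assumption?)
  finally have le1: "?L \<le> 4 * (\<integral>\<^sup>+\<omega>. (\<Sum>i\<in>J1. \<Sum>j\<in>J2. h2 i j \<omega>)\<^sup>2 \<partial>?P)" .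
  have "(\<integral>\<^sup>+\<omega>. (\<Sum>i\<in>J1. \<Sum>j\<in>J2. h2 i j \<omega>)\<^sup>2 \<partial>?P)
      = (\<integral>\<^sup>+\<omega>. (\<Sum>j\<in>J2. resample (S2 j) (\<lambda>\<omega>. \<Sum>i\<in>J1. \<Sum>k\<in>J3. h3 i j k \<omega>) \<omega>)\<^sup>2 \<partial>?P)"
  proof (rule nn_integral_cong, rule arg_cong[where f="\<lambda>x. x\<^sup>2"])
    fix \<omega> assume \<omega>: "\<omega> \<in> space ?P"
    have "(\<Sum>i\<in>J1. \<Sum>j\<in>J2. h2 i j \<omega>) = (\<Sum>j\<in>J2. \<Sum>i\<in>J1. h2 i j \<omega>)" by (rule sum.swap)
    also have "\<dots> = (\<Sum>j\<in>J2. resample (S2 j) (\<lambda>\<omega>. \<Sum>i\<in>J1. \<Sum>k\<in>J3. h3 i j k \<omega>) \<omega>)"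
      unfolding h2_def by (intro sum.cong refl resample_sum[symmetric] \<omega>) simp
    finally show "(\<Sum>i\<in>J1. \<Sum>j\<in>J2. h2 i j \<omega>)
      = (\<Sum>j\<in>J2. resample (S2 j) (\<lambda>\<omega>. \<Sum>i\<in>J1. \<Sum>k\<in>J3. h3 i j k \<omega>) \<omega>)" .
  qed
  also have "\<dots> \<le> 4 * (\<integral>\<^sup>+\<omega>. (\<Sum>j\<in>J2. \<Sum>i\<in>J1. \<Sum>k\<in>J3. h3 i j k \<omega>)\<^sup>2 \<partial>?P)"
    by (rule resample_sum_square_le[where c="of_nat (card J1) * (of_nat (card J3) * c)"];
        (intro J S2 sum_h3_le top c sum_bounded_above borel_measurable_sum h2 h3 g)?; assumption?)
  finally have le2: "(\<integral>\<^sup>+\<omega>. (\<Sum>i\<in>J1. \<Sum>j\<in>J2. h2 i j \<omega>)\<^sup>2 \<partial>?P)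
    \<le> 4 * (\<integral>\<^sup>+\<omega>. (\<Sum>j\<in>J2. \<Sum>i\<in>J1. \<Sum>k\<in>J3. h3 i j k \<omega>)\<^sup>2 \<partial>?P)" .
  have "(\<integral>\<^sup>+\<omega>. (\<Sum>j\<in>J2. \<Sum>i\<in>J1. \<Sum>k\<in>J3. h3 i j k \<omega>)\<^sup>2 \<partial>?P)
      = (\<integral>\<^sup>+\<omega>. (\<Sum>k\<in>J3. resample (S3 k) (\<lambda>\<omega>. \<Sum>j\<in>J2. \<Sum>i\<in>J1. g i j k \<omega>) \<omega>)\<^sup>2 \<partial>?P)"
  proof (rule nn_integral_cong, rule arg_cong[where f="\<lambda>x. x\<^sup>2"])
    fix \<omega> assume \<omega>: "\<omega> \<in> space ?P"
    have "(\<Sum>j\<in>J2. \<Sum>i\<in>J1. \<Sum>k\<in>J3. h3 i j k \<omega>) = (\<Sum>j\<in>J2. \<Sum>k\<in>J3. \<Sum>i\<in>J1. h3 i j k \<omega>)"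
      by (intro sum.cong refl sum.swap)
    also have "\<dots> = (\<Sum>k\<in>J3. \<Sum>j\<in>J2. \<Sum>i\<in>J1. h3 i j k \<omega>)" by (rule sum.swap)
    also have "\<dots> = (\<Sum>k\<in>J3. \<Sum>j\<in>J2. resample (S3 k) (\<lambda>\<omega>. \<Sum>i\<in>J1. g i j k \<omega>) \<omega>)"
      unfolding h3_def by (intro sum.cong refl resample_sum[symmetric] \<omega>) simp
    also have "\<dots> = (\<Sum>k\<in>J3. resample (S3 k) (\<lambda>\<omega>. \<Sum>j\<in>J2. \<Sum>i\<in>J1. g i j k \<omega>) \<omega>)"
      by (intro sum.cong refl resample_sum[symmetric] \<omega>) simp
    finally show "(\<Sum>j\<in>J2. \<Sum>i\<in>J1. \<Sum>k\<in>J3. h3 i j k \<omega>)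
      = (\<Sum>k\<in>J3. resample (S3 k) (\<lambda>\<omega>. \<Sum>j\<in>J2. \<Sum>i\<in>J1. g i j k \<omega>) \<omega>)" .
  qed
  also have "\<dots> \<le> 4 * (\<integral>\<^sup>+\<omega>. (\<Sum>k\<in>J3. \<Sum>j\<in>J2. \<Sum>i\<in>J1. g i j k \<omega>)\<^sup>2 \<partial>?P)"
    by (rule resample_sum_square_le[where c="of_nat (card J2) * (of_nat (card J1) * c)"];
        (intro J S3 bounded top c sum_bounded_above borel_measurable_sum h2 h3 g)?; assumption?)
  also have "(\<lambda>\<omega>. \<Sum>k\<in>J3. \<Sum>j\<in>J2. \<Sum>i\<in>J1. g i j k \<omega>) = (\<lambda>\<omega>. \<Sum>i\<in>J1. \<Sum>j\<in>J2. \<Sum>k\<in>J3. g i j k \<omega>)"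
  proof
    fix \<omega>
    have "(\<Sum>k\<in>J3. \<Sum>j\<in>J2. \<Sum>i\<in>J1. g i j k \<omega>) = (\<Sum>j\<in>J2. \<Sum>k\<in>J3. \<Sum>i\<in>J1. g i j k \<omega>)" by (rule sum.swap)
    also have "\<dots> = (\<Sum>j\<in>J2. \<Sum>i\<in>J1. \<Sum>k\<in>J3. g i j k \<omega>)" by (intro sum.cong refl sum.swap)
    also have "\<dots> = (\<Sum>i\<in>J1. \<Sum>j\<in>J2. \<Sum>k\<in>J3. g i j k \<omega>)" by (rule sum.swap)
    finally show "(\<Sum>k\<in>J3. \<Sum>j\<in>J2. \<Sum>i\<in>J1. g i j k \<omega>) = (\<Sum>i\<in>J1. \<Sum>j\<in>J2. \<Sum>k\<in>J3. g i j k \<omega>)" .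
  qed
  finally have le3: "(\<integral>\<^sup>+\<omega>. (\<Sum>j\<in>J2. \<Sum>i\<in>J1. \<Sum>k\<in>J3. h3 i j k \<omega>)\<^sup>2 \<partial>?P) \<le> 4 * ?R" .
  have "?L \<le> 4 * (4 * (4 * ?R))"
    by (rule order_trans[OF le1 mult_left_mono[OF order_trans[OF le2 mult_left_mono[OF le3]]]]) simp_all
  also have "\<dots> = 64 * ?R" by (simp add: mult.assoc[symmetric])
  finally show ?thesis .
qed

end

subsection \<open>Gaussian white noise with finitely many cells\<close>

text \<open>The density is at most 1 / sqrt (2 pi v) with 4 \<le> 2 pi, and the interval has length
  2 \<epsilon>. Uniformity in the centre y is what allows the bound to be used
  conditionally.\<close>

lemma normal_law_interval_le:
  assumes v: "0 < v" and \<epsilon>: "0 \<le> \<epsilon>"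
  shows "measure (normal_law v) {y - \<epsilon>..y + \<epsilon>} \<le> \<epsilon> / sqrt v"
proof -
  interpret prob_space "normal_law v" by (rule prob_space_normal_law[OF v])
  have pi: "4 \<le> 2 * pi" using pi_ge_two by simp
  have dens: "normal_density 0 (sqrt v) x \<le> 1 / (2 * sqrt v)" for x
  proof -
    have "normal_density 0 (sqrt v) x \<le> 1 / sqrt (2 * pi * v) * 1"
      unfolding normal_density_def using v by (intro mult_mono) (auto simp: field_simps)
    also have "\<dots> \<le> 1 / sqrt (4 * v)"
      using v pi by (auto intro!: divide_left_mono mult_pos_pos)
    finally show ?thesis using v by (simp add: real_sqrt_mult)
  qed
  have "emeasure (normal_law v) {y - \<epsilon>..y + \<epsilon>} = (\<integral>\<^sup>+x. ennreal (normal_density 0 (sqrt v) x) * indicator {y - \<epsilon>..y + \<epsilon>} x \<partial>lborel)"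
    unfolding normal_law_def by (simp add: emeasure_density)
  also have "\<dots> \<le> (\<integral>\<^sup>+x. ennreal (1 / (2 * sqrt v)) * indicator {y - \<epsilon>..y + \<epsilon>} x \<partial>lborel)"
    by (intro nn_integral_mono mult_right_mono ennreal_leI dens) auto
  also have "\<dots> = ennreal (1 / (2 * sqrt v)) * ennreal (2 * \<epsilon>)"
    using \<epsilon> by (subst nn_integral_cmult_indicator) auto
  also have "\<dots> = ennreal (\<epsilon> / sqrt v)"
    using v \<epsilon> by (subst ennreal_mult[symmetric]) auto
  finally show ?thesis
    unfolding emeasure_eq_measure using v \<epsilon> by (subst (asm) ennreal_le_iff) auto
qed

text \<open>For \<epsilon> below the standard deviation the density is of order 1 / sqrt v on the
  whole interval; for larger \<epsilon> one standard deviation already carries a fixed mass. Writing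
  v + \<epsilon>^2 merges the two cases in one formula.\<close>

lemma normal_law_interval_ge:
  assumes v: "0 < v" and \<epsilon>: "0 < \<epsilon>"
  shows "\<epsilon> / (4 * sqrt (v + \<epsilon>\<^sup>2)) \<le> measure (normal_law v) {- \<epsilon>..\<epsilon>}"
proof -
  interpret prob_space "normal_law v" by (rule prob_space_normal_law[OF v])
  define t where "t = min \<epsilon> (sqrt v)"
  have t: "0 < t" "t \<le> \<epsilon>" "t \<le> sqrt v" using v \<epsilon> by (auto simp: t_def)
  have dens: "1 / (8 * sqrt v) \<le> normal_density 0 (sqrt v) x" if "x \<in> {- t..t}" for x
  proof -
    have "\<bar>x\<bar> \<le> sqrt v" using that t by auto
    then have "\<bar>x\<bar>\<^sup>2 \<le> (sqrt v)\<^sup>2" by (intro power_mono) auto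
    then have "x\<^sup>2 / (2 * v) \<le> 1/2" using v by (simp add: field_simps)
    then have "1/2 \<le> exp (- x\<^sup>2 / (2 * v))"
      using exp_ge_add_one_self[of "- (x\<^sup>2 / (2 * v))"] by simp
    moreover have "1 / sqrt (16 * v) \<le> 1 / sqrt (2 * pi * v)"
      using v pi_less_4 by (intro divide_left_mono) (auto intro!: mult_pos_pos)
    ultimately have "1 / sqrt (16 * v) * (1/2) \<le> 1 / sqrt (2 * pi * v) * exp (- x\<^sup>2 / (2 * v))"
      using v by (intro mult_mono) auto
    then show ?thesis using v by (simp add: normal_density_def real_sqrt_mult)
  qed
  have "ennreal (t / (4 * sqrt v)) = ennreal (1 / (8 * sqrt v)) * ennreal (2 * t)"
    using v t by (subst ennreal_mult[symmetric]) auto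
  also have "\<dots> = (\<integral>\<^sup>+x. ennreal (1 / (8 * sqrt v)) * indicator {- t..t} x \<partial>lborel)"
    using t by (subst nn_integral_cmult_indicator) auto
  also have "\<dots> \<le> (\<integral>\<^sup>+x. ennreal (normal_density 0 (sqrt v) x) * indicator {- \<epsilon>..\<epsilon>} x \<partial>lborel)"
    using dens t by (intro nn_integral_mono) (auto simp: indicator_def intro!: ennreal_leI)
  also have "\<dots> = emeasure (normal_law v) {- \<epsilon>..\<epsilon>}"
    unfolding normal_law_def by (simp add: emeasure_density)
  finally have "t / (4 * sqrt v) \<le> measure (normal_law v) {- \<epsilon>..\<epsilon>}"
    unfolding emeasure_eq_measure by (subst (asm) ennreal_le_iff) auto
  moreover have "\<epsilon> / sqrt (v + \<epsilon>\<^sup>2) \<le> t / sqrt v"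
  proof (cases "\<epsilon> \<le> sqrt v")
    case True
    then have "t = \<epsilon>" by (simp add: t_def)
    then show ?thesis using v \<epsilon> by (auto intro!: divide_left_mono mult_pos_pos add_pos_pos)
  next
    case False
    then have "t = sqrt v" by (simp add: t_def)
    moreover have "\<epsilon> \<le> sqrt (v + \<epsilon>\<^sup>2)" using v \<epsilon> by (intro real_le_rsqrt) auto
    moreover have "0 < v + \<epsilon>\<^sup>2" using v \<epsilon> by (auto intro!: add_pos_pos)
    ultimately show ?thesis using v by simp
  qed
  ultimately show ?thesis by simp
qed

text \<open>The maximum norm is used because a box factorises over the independent coordinates.
  Values in \<open>ennreal\<close> avoid integrability conditions.\<close>

definition small :: "real \<Rightarrow> ('d \<Rightarrow> real) \<Rightarrow> ennreal" where
  "small \<epsilon> f = (if \<forall>l. \<bar>f l\<bar> \<le> \<epsilon> then 1 else 0)"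

lemma small_le_1: "small \<epsilon> f \<le> 1"
  by (simp add: small_def)

lemma small_uminus: "small \<epsilon> (\<lambda>l. - f l) = small \<epsilon> f"
  by (simp add: small_def)

lemma borel_measurable_small[measurable]:
  fixes f :: "'a \<Rightarrow> 'd::finite \<Rightarrow> real"
  assumes [measurable]: "\<And>l. (\<lambda>\<omega>. f \<omega> l) \<in> borel_measurable M"
  shows "(\<lambda>\<omega>. small \<epsilon> (f \<omega>)) \<in> borel_measurable M"
  unfolding small_def by measurable

text \<open>Weights are positive off \<open>C\<close> as well, because the product construction
  wants a probability measure at every index. The argument \<open>dim\<close> fixes the type of the
  coordinates.\<close>

locale white_noise =
  fixes C :: "'c set" and w :: "'c \<Rightarrow> real" and dim :: "'d::finite itself"
  assumes finite_cells: "finite C" and w_pos: "\<And>c. 0 < w c"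
begin

sublocale resampling "\<lambda>k::'c \<times> 'd. normal_law (w (fst k))" "C \<times> (UNIV::'d set)"
proof -
  interpret N: prob_space "normal_law (w (fst k))" for k :: "'c \<times> 'd"
    by (rule prob_space_normal_law[OF w_pos])
  show "resampling (\<lambda>k::'c \<times> 'd. normal_law (w (fst k))) (C \<times> (UNIV::'d set))"
    using finite_cells by unfold_locales auto
qed

abbreviation noise_space :: "('c \<times> 'd \<Rightarrow> real) measure" where
  "noise_space \<equiv> PiM (C \<times> UNIV) (\<lambda>k. normal_law (w (fst k)))"

definition noise :: "'c set \<Rightarrow> ('c \<times> 'd \<Rightarrow> real) \<Rightarrow> 'd \<Rightarrow> real" where
  "noise S \<omega> l = (\<Sum>c\<in>S. \<omega> (c, l))"

lemma measurable_noise_space_component[measurable]: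
  "c \<in> C \<Longrightarrow> (\<lambda>\<omega>. \<omega> (c, l)) \<in> borel_measurable noise_space"
  using measurable_component_singleton[of "(c, l)" "C \<times> UNIV" "\<lambda>k. normal_law (w (fst k))"] by simp

lemma measurable_noise: "S \<subseteq> C \<Longrightarrow> (\<lambda>\<omega>. noise S \<omega> l) \<in> borel_measurable noise_space"
  unfolding noise_def by (rule borel_measurable_sum) (rule measurable_noise_space_component, auto)

section \<open>Small-ball probabilities of the noise\<close>

lemma noise_empty[simp]: "noise {} \<omega> l = 0"
  by (simp add: noise_def)

lemma noise_Un: "finite S \<Longrightarrow> finite T \<Longrightarrow> S \<inter> T = {} \<Longrightarrow> noise (S \<union> T) \<omega> l = noise S \<omega> l + noise T \<omega> l"
  unfolding noise_def by (rule sum.union_disjoint)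

lemma noise_mix_disjoint:
  assumes "S \<subseteq> C" "S \<inter> T = {}"
  shows "noise S (mix (T \<times> UNIV) \<omega> \<omega>') = noise S \<omega>"
  using assms unfolding noise_def mix_def by (intro ext sum.cong) auto

lemma noise_mix_subset:
  assumes "S \<subseteq> C" "S \<subseteq> T"
  shows "noise S (mix (T \<times> UNIV) \<omega> \<omega>') = noise S \<omega>'"
  using assms unfolding noise_def mix_def by (intro ext sum.cong) auto

text \<open>Different coordinates l use disjoint blocks of independent variables, and within a block
  the variances add up to \<open>sum w S\<close>. The set has to be nonempty, as
  \<open>normal_law 0\<close> is not the point mass at 0.\<close>

lemma prob_noise:
  assumes S: "S \<subseteq> C" "S \<noteq> {}" and A: "\<And>l. A l \<in> sets borel"
  shows "measure noise_space {\<omega>\<in>space noise_space. \<forall>l. noise S \<omega> l \<in> A l}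
    = (\<Prod>l\<in>UNIV. measure (normal_law (sum w S)) (A l))"
proof -
  let ?P = noise_space
  have "C \<noteq> {}" "finite S" using S finite_cells by (auto intro: finite_subset)
  have comp: "(\<lambda>\<omega>. \<omega> k) \<in> borel_measurable ?P" if "k \<in> C \<times> UNIV" for k
    using measurable_noise_space_component[of "fst k" "snd k"] that by auto
  have dcomp: "distr ?P borel (\<lambda>\<omega>. \<omega> k) = normal_law (w (fst k))" if "k \<in> C \<times> UNIV" for k :: "'c \<times> 'd"
  proof -
    have "distr ?P borel (\<lambda>\<omega>. \<omega> k) = distr ?P (normal_law (w (fst k))) (\<lambda>\<omega>. \<omega> k)"
      by (rule distr_cong) auto
    also have "\<dots> = normal_law (w (fst k))"
      using distr_PiM_component[of "C \<times> UNIV" "\<lambda>k. normal_law (w (fst k))" k] that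
      by (simp add: prob_space_normal_law[OF w_pos])
    finally show ?thesis .
  qed
  have ind: "P.indep_vars (\<lambda>_. borel) (\<lambda>k \<omega>. \<omega> k) (C \<times> (UNIV::'d set))"
  proof (subst P.indep_vars_iff_distr_eq_PiM'[OF _ comp])
    have sets: "sets (\<Pi>\<^sub>M i\<in>C \<times> (UNIV::'d set). borel::real measure) = sets ?P"
      by (intro sets_PiM_cong) auto
    have "distr ?P (\<Pi>\<^sub>M i\<in>C \<times> UNIV. borel) (\<lambda>x. \<lambda>i\<in>C \<times> UNIV. x i) = distr ?P ?P (\<lambda>x. x)"
      by (intro distr_cong sets) (auto simp: space_PiM)
    also have "\<dots> = ?P" by (rule distr_id)
    also have "\<dots> = (\<Pi>\<^sub>M i\<in>C \<times> UNIV. distr ?P borel (\<lambda>\<omega>. \<omega> i))"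
      by (intro PiM_cong) (auto simp: dcomp)
    finally show "distr ?P (\<Pi>\<^sub>M i\<in>C \<times> UNIV. borel) (\<lambda>x. \<lambda>i\<in>C \<times> UNIV. x i) = (\<Pi>\<^sub>M i\<in>C \<times> UNIV. distr ?P borel (\<lambda>\<omega>. \<omega> i))" .
  qed (use \<open>C \<noteq> {}\<close> in auto)
  have "P.indep_vars (\<lambda>l. PiM (S \<times> {l}) (\<lambda>_. borel)) (\<lambda>l \<omega>. restrict (\<lambda>k. \<omega> k) (S \<times> {l})) (UNIV::'d set)"
    using S by (intro P.indep_vars_restrict[OF ind]) (auto simp: disjoint_family_on_def)
  then have "P.indep_vars (\<lambda>l. borel) (\<lambda>l \<omega>. (\<lambda>f. \<Sum>c\<in>S. f (c, l)) (restrict (\<lambda>k. \<omega> k) (S \<times> {l}))) (UNIV::'d set)"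
    by (rule P.indep_vars_compose2) simp
  moreover have "(\<lambda>l \<omega>. (\<lambda>f. \<Sum>c\<in>S. f (c, l)) (restrict (\<lambda>k. \<omega> k) (S \<times> {l}))) = (\<lambda>l \<omega>. noise S \<omega> l)"
    by (auto simp: noise_def fun_eq_iff intro!: sum.cong)
  ultimately have indn: "P.indep_vars (\<lambda>l. borel) (\<lambda>l \<omega>. noise S \<omega> l) (UNIV::'d set)" by simp
  have nl: "measure ?P ((\<lambda>\<omega>. noise S \<omega> l) -` A l \<inter> space ?P) = measure (normal_law (sum w S)) (A l)" for l
  proof -
    have *: "(\<Sum>k\<in>S \<times> {l}. f k) = (\<Sum>c\<in>S. f (c, l))" for f :: "'c \<times> 'd \<Rightarrow> real"
      by (rule sum.reindex_bij_witness[of _ "\<lambda>c. (c, l)" fst]) auto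
    have "distributed ?P lborel (\<lambda>\<omega>. \<Sum>k\<in>S \<times> {l}. \<omega> k) (normal_density (\<Sum>k\<in>S \<times> {l}. 0) (sqrt (\<Sum>k\<in>S \<times> {l}. (sqrt (w (fst k)))\<^sup>2)))"
    proof (rule P.sum_indep_normal)
      show "finite (S \<times> {l})" "S \<times> {l} \<noteq> {}" using S \<open>finite S\<close> by auto
      show "P.indep_vars (\<lambda>i. borel) (\<lambda>k \<omega>. \<omega> k) (S \<times> {l})"
        by (rule P.indep_vars_subset[OF ind]) (use S in auto)
      show "0 < sqrt (w (fst k))" for k :: "'c \<times> 'd" using w_pos by simp
      fix k assume k: "k \<in> S \<times> {l}"
      then have "k \<in> C \<times> UNIV" using S by auto
      moreover have "distr ?P lborel (\<lambda>\<omega>. \<omega> k) = distr ?P borel (\<lambda>\<omega>. \<omega> k)" by (rule distr_cong) auto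
      ultimately show "distributed ?P lborel (\<lambda>\<omega>. \<omega> k) (normal_density 0 (sqrt (w (fst k))))"
        using dcomp[of k] comp[of k] unfolding distributed_def normal_law_def by simp
    qed
    then have d: "distr ?P lborel (\<lambda>\<omega>. noise S \<omega> l) = normal_law (sum w S)"
      unfolding * noise_def[symmetric] using w_pos by (simp add: distributed_def normal_law_def less_imp_le)
    have "measure (normal_law (sum w S)) (A l) = measure (distr ?P lborel (\<lambda>\<omega>. noise S \<omega> l)) (A l)"
      unfolding d ..
    also have "\<dots> = measure ?P ((\<lambda>\<omega>. noise S \<omega> l) -` A l \<inter> space ?P)"
      using measurable_noise[OF S(1)] A by (intro measure_distr) auto
    finally show ?thesis ..
  qed
  have "{\<omega>\<in>space ?P. \<forall>l. noise S \<omega> l \<in> A l} = (\<Inter>l\<in>UNIV. (\<lambda>\<omega>. noise S \<omega> l) -` A l \<inter> space ?P)"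
    by auto
  then show ?thesis
    using P.indep_varsD_finite[OF indn, of A] A by (simp add: nl)
qed

text \<open>The shift \<open>y\<close> stands for noise that is held fixed under conditioning. A
  lower bound \<open>v\<close> for the variance is enough, since the estimate decreases in the
  variance.\<close>

lemma nn_integral_small_noise_le:
  assumes S: "S \<subseteq> C" and v: "0 < v" "v \<le> sum w S" and \<epsilon>: "0 \<le> \<epsilon>"
  shows "(\<integral>\<^sup>+\<omega>. small \<epsilon> (\<lambda>l. noise S \<omega> l + y l) \<partial>noise_space) \<le> ennreal ((\<epsilon> / sqrt v) ^ CARD('d))"
proof -
  have "S \<noteq> {}" using v by auto
  have [measurable]: "(\<lambda>\<omega>. noise S \<omega> l) \<in> borel_measurable noise_space" for l by (rule measurable_noise[OF S])
  let ?A = "\<lambda>l. {- y l - \<epsilon>..- y l + \<epsilon>}"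
  have "(\<integral>\<^sup>+\<omega>. small \<epsilon> (\<lambda>l. noise S \<omega> l + y l) \<partial>noise_space)
      = (\<integral>\<^sup>+\<omega>. indicator {\<omega>\<in>space noise_space. \<forall>l. noise S \<omega> l \<in> ?A l} \<omega> \<partial>noise_space)"
    by (intro nn_integral_cong) (auto simp: small_def indicator_def abs_le_iff algebra_simps; smt (verit))
  also have "\<dots> = emeasure noise_space {\<omega>\<in>space noise_space. \<forall>l. noise S \<omega> l \<in> ?A l}"
    by (rule nn_integral_indicator) measurable
  also have "\<dots> = ennreal (\<Prod>l\<in>UNIV. measure (normal_law (sum w S)) (?A l))"
    unfolding P.emeasure_eq_measure using S \<open>S \<noteq> {}\<close> by (subst prob_noise) auto
  also have "\<dots> \<le> ennreal (\<Prod>l\<in>(UNIV::'d set). \<epsilon> / sqrt v)"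
  proof (intro ennreal_leI prod_mono conjI)
    fix l
    have "measure (normal_law (sum w S)) (?A l) \<le> \<epsilon> / sqrt (sum w S)"
      using v \<epsilon> by (intro normal_law_interval_le) auto
    also have "\<dots> \<le> \<epsilon> / sqrt v" using v \<epsilon> by (intro divide_left_mono) (auto intro!: mult_pos_pos)
    finally show "measure (normal_law (sum w S)) (?A l) \<le> \<epsilon> / sqrt v" .
  qed auto
  also have "\<dots> = ennreal ((\<epsilon> / sqrt v) ^ CARD('d))" by simp
  finally show ?thesis .
qed

text \<open>The empty set is treated apart because its noise is identically 0; the estimate persists
  there, as \<epsilon> \<le> sqrt (v + \<epsilon>^2).\<close>

lemma nn_integral_small_noise_ge:
  assumes S: "S \<subseteq> C" and v: "sum w S \<le> v" and \<epsilon>: "0 < \<epsilon>"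
  shows "ennreal ((\<epsilon> / (4 * sqrt (v + \<epsilon>\<^sup>2))) ^ CARD('d)) \<le> (\<integral>\<^sup>+\<omega>. small \<epsilon> (noise S \<omega>) \<partial>noise_space)"
proof (cases "S = {}")
  case True
  have "\<epsilon> \<le> sqrt (v + \<epsilon>\<^sup>2)" using v True \<epsilon> by (intro real_le_rsqrt) auto
  then have "\<epsilon> / (4 * sqrt (v + \<epsilon>\<^sup>2)) \<le> 1" using \<epsilon> by (subst divide_le_eq_1) linarith
  then have "(\<epsilon> / (4 * sqrt (v + \<epsilon>\<^sup>2))) ^ CARD('d) \<le> 1"
    using \<epsilon> v True by (intro power_le_one) auto
  then have "ennreal ((\<epsilon> / (4 * sqrt (v + \<epsilon>\<^sup>2))) ^ CARD('d)) \<le> 1"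
    by (metis ennreal_1 ennreal_leI)
  moreover have "(\<integral>\<^sup>+\<omega>. small \<epsilon> (noise S \<omega>) \<partial>noise_space) = 1"
    using \<epsilon> True P.emeasure_space_1 by (simp add: small_def)
  ultimately show ?thesis by simp
next
  case False
  have sS: "0 < sum w S" using False S finite_cells w_pos by (intro sum_pos) (auto intro: finite_subset)
  have [measurable]: "(\<lambda>\<omega>. noise S \<omega> l) \<in> borel_measurable noise_space" for l by (rule measurable_noise[OF S])
  let ?A = "\<lambda>l. {- \<epsilon>..\<epsilon>}"
  have "ennreal ((\<epsilon> / (4 * sqrt (v + \<epsilon>\<^sup>2))) ^ CARD('d)) = ennreal (\<Prod>l\<in>(UNIV::'d set). \<epsilon> / (4 * sqrt (v + \<epsilon>\<^sup>2)))"
    by simp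
  also have "\<dots> \<le> ennreal (\<Prod>l\<in>UNIV. measure (normal_law (sum w S)) (?A (l::'d)))"
  proof (intro ennreal_leI prod_mono conjI)
    have "\<epsilon> / (4 * sqrt (v + \<epsilon>\<^sup>2)) \<le> \<epsilon> / (4 * sqrt (sum w S + \<epsilon>\<^sup>2))"
      using v \<epsilon> sS by (intro divide_left_mono) (auto intro!: mult_pos_pos add_pos_pos)
    also have "\<dots> \<le> measure (normal_law (sum w S)) (?A l)"
      by (rule normal_law_interval_ge[OF sS \<epsilon>])
    finally show "\<epsilon> / (4 * sqrt (v + \<epsilon>\<^sup>2)) \<le> measure (normal_law (sum w S)) (?A l)" for l :: 'd .
  qed (use \<epsilon> v sS in auto)
  also have "\<dots> = emeasure noise_space {\<omega>\<in>space noise_space. \<forall>l. noise S \<omega> l \<in> ?A l}"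
    unfolding P.emeasure_eq_measure using S False by (subst prob_noise) auto
  also have "\<dots> = (\<integral>\<^sup>+\<omega>. indicator {\<omega>\<in>space noise_space. \<forall>l. noise S \<omega> l \<in> ?A l} \<omega> \<partial>noise_space)"
    by (rule nn_integral_indicator[symmetric]) measurable
  also have "\<dots> = (\<integral>\<^sup>+\<omega>. small \<epsilon> (noise S \<omega>) \<partial>noise_space)"
    by (intro nn_integral_cong) (auto simp: small_def indicator_def abs_le_iff; smt (verit))
  finally show ?thesis .
qed

text \<open>Given the cells outside \<open>S\<close>, the noise of \<open>T\<close> is a constant
  shift.\<close>

lemma nn_integral_small_shifted_noise_le:
  assumes S: "S \<subseteq> C" "T \<subseteq> C" "S \<inter> T = {}" and v: "0 < v" "v \<le> sum w S" and \<epsilon>: "0 \<le> \<epsilon>"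
  shows "(\<integral>\<^sup>+\<omega>. small \<epsilon> (\<lambda>l. noise S \<omega> l - noise T \<omega> l) \<partial>noise_space) \<le> ennreal ((\<epsilon> / sqrt v) ^ CARD('d))"
proof -
  have [measurable]: "(\<lambda>\<omega>. noise S \<omega> l) \<in> borel_measurable noise_space" "(\<lambda>\<omega>. noise T \<omega> l) \<in> borel_measurable noise_space" for l
    using measurable_noise S by auto
  let ?f = "\<lambda>\<omega>. small \<epsilon> (\<lambda>l. noise S \<omega> l - noise T \<omega> l)"
  have "(\<integral>\<^sup>+\<omega>. ?f \<omega> \<partial>noise_space) = (\<integral>\<^sup>+\<omega>. resample (S \<times> UNIV) ?f \<omega> \<partial>noise_space)"
    by (rule nn_integral_resample[symmetric]) simp
  also have "\<dots> \<le> (\<integral>\<^sup>+\<omega>. ennreal ((\<epsilon> / sqrt v) ^ CARD('d)) \<partial>noise_space)"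
  proof (rule nn_integral_mono)
    fix \<omega>
    have "resample (S \<times> UNIV) ?f \<omega> = (\<integral>\<^sup>+\<omega>'. small \<epsilon> (\<lambda>l. noise S \<omega>' l + - noise T \<omega> l) \<partial>noise_space)"
      unfolding resample_def using S by (simp add: noise_mix_subset noise_mix_disjoint Int_commute)
    also have "\<dots> \<le> ennreal ((\<epsilon> / sqrt v) ^ CARD('d))"
      by (rule nn_integral_small_noise_le[OF S(1) v \<epsilon>])
    finally show "resample (S \<times> UNIV) ?f \<omega> \<le> ennreal ((\<epsilon> / sqrt v) ^ CARD('d))" .
  qed
  also have "\<dots> = ennreal ((\<epsilon> / sqrt v) ^ CARD('d))" using P.emeasure_space_1 by simp
  finally show ?thesis .
qed

text \<open>Average first over the common part of the two regions, then over the larger one of the two differences.\<close>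

lemma two_point_le:
  assumes R: "R \<subseteq> C" "R' \<subseteq> C" and \<alpha>: "0 < \<alpha>" "\<alpha> \<le> sum w (R \<inter> R')" and \<epsilon>: "0 < \<epsilon>"
    and \<kappa>: "0 \<le> \<kappa>" "\<kappa> \<le> sum w (R - R') \<or> \<kappa> \<le> sum w (R' - R)"
  shows "(\<integral>\<^sup>+\<omega>. small \<epsilon> (noise R \<omega>) * small \<epsilon> (noise R' \<omega>) \<partial>noise_space)
    \<le> ennreal ((\<epsilon> / sqrt \<alpha>) ^ CARD('d) * (4 * \<epsilon> / sqrt (\<kappa> + \<epsilon>\<^sup>2)) ^ CARD('d))"
proof -
  let ?d = "CARD('d)"
  let ?D = "\<lambda>\<omega>. small (2 * \<epsilon>) (\<lambda>l. noise (R - R') \<omega> l - noise (R' - R) \<omega> l)"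
  let ?f = "\<lambda>\<omega>. small \<epsilon> (noise R \<omega>) * small \<epsilon> (noise R' \<omega>)"
  have sub: "R \<inter> R' \<subseteq> C" "R - R' \<subseteq> C" "R' - R \<subseteq> C" using R by auto
  have fin: "finite R" "finite R'" using R finite_cells by (auto intro: finite_subset)
  have [measurable]: "(\<lambda>\<omega>. noise R \<omega> l) \<in> borel_measurable noise_space" "(\<lambda>\<omega>. noise R' \<omega> l) \<in> borel_measurable noise_space"
     "(\<lambda>\<omega>. noise (R - R') \<omega> l) \<in> borel_measurable noise_space" "(\<lambda>\<omega>. noise (R' - R) \<omega> l) \<in> borel_measurable noise_space" for l
    using measurable_noise R sub by auto
  have dec: "noise R \<omega> l = noise (R \<inter> R') \<omega> l + noise (R - R') \<omega> l"
            "noise R' \<omega> l = noise (R \<inter> R') \<omega> l + noise (R' - R) \<omega> l" for \<omega> l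
  proof -
    have "R = (R \<inter> R') \<union> (R - R')" "R' = (R \<inter> R') \<union> (R' - R)" by auto
    then show "noise R \<omega> l = noise (R \<inter> R') \<omega> l + noise (R - R') \<omega> l"
              "noise R' \<omega> l = noise (R \<inter> R') \<omega> l + noise (R' - R) \<omega> l"
      using noise_Un[of "R \<inter> R'" "R - R'" \<omega> l] noise_Un[of "R \<inter> R'" "R' - R" \<omega> l] fin by auto
  qed
  have "(\<integral>\<^sup>+\<omega>. ?f \<omega> \<partial>noise_space) = (\<integral>\<^sup>+\<omega>. resample ((R \<inter> R') \<times> UNIV) ?f \<omega> \<partial>noise_space)"
    by (rule nn_integral_resample[symmetric]) simp
  also have "\<dots> \<le> (\<integral>\<^sup>+\<omega>. ?D \<omega> * ennreal ((\<epsilon> / sqrt \<alpha>) ^ ?d) \<partial>noise_space)"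
  proof (rule nn_integral_mono)
    fix \<omega>
    \<comment> \<open>If both noises are small, so is their difference, from which the common part
      drops out. What is left of the first event confines the common part to a box whose centre
      depends only on the other cells.\<close>
    have le: "small \<epsilon> (noise R \<omega>) * small \<epsilon> (noise R' \<omega>) \<le>
       small (2 * \<epsilon>) (\<lambda>l. noise (R - R') \<omega> l - noise (R' - R) \<omega> l) * small \<epsilon> (\<lambda>l. noise (R \<inter> R') \<omega> l + noise (R - R') \<omega> l)" for \<omega>
    proof -
      have "\<bar>noise (R - R') \<omega> l - noise (R' - R) \<omega> l\<bar> \<le> 2 * \<epsilon>" if "\<bar>noise R \<omega> l\<bar> \<le> \<epsilon>" "\<bar>noise R' \<omega> l\<bar> \<le> \<epsilon>" for l
        using that dec[of \<omega> l] by (simp add: abs_le_iff)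
      then show ?thesis by (auto simp: small_def dec(1)[symmetric])
    qed
    have "resample ((R \<inter> R') \<times> UNIV) ?f \<omega>
        \<le> (\<integral>\<^sup>+\<omega>'. ?D (mix ((R \<inter> R') \<times> UNIV) \<omega> \<omega>') * small \<epsilon> (\<lambda>l. noise (R \<inter> R') (mix ((R \<inter> R') \<times> UNIV) \<omega> \<omega>') l + noise (R - R') (mix ((R \<inter> R') \<times> UNIV) \<omega> \<omega>') l) \<partial>noise_space)"
      unfolding resample_def by (intro nn_integral_mono le)
    also have "\<dots> = (\<integral>\<^sup>+\<omega>'. ?D \<omega> * small \<epsilon> (\<lambda>l. noise (R \<inter> R') \<omega>' l + noise (R - R') \<omega> l) \<partial>noise_space)"
    proof -
      have "noise (R - R') (mix ((R \<inter> R') \<times> UNIV) \<omega> \<omega>') = noise (R - R') \<omega>" 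
         "noise (R' - R) (mix ((R \<inter> R') \<times> UNIV) \<omega> \<omega>') = noise (R' - R) \<omega>"
         "noise (R \<inter> R') (mix ((R \<inter> R') \<times> UNIV) \<omega> \<omega>') = noise (R \<inter> R') \<omega>'" for \<omega>'
        by (intro noise_mix_disjoint noise_mix_subset sub; auto)+
      then show ?thesis by simp
    qed
    also have "\<dots> = ?D \<omega> * (\<integral>\<^sup>+\<omega>'. small \<epsilon> (\<lambda>l. noise (R \<inter> R') \<omega>' l + noise (R - R') \<omega> l) \<partial>noise_space)"
    proof -
      have [measurable]: "(\<lambda>\<omega>. noise (R \<inter> R') \<omega> l) \<in> borel_measurable noise_space" for l
        using measurable_noise sub by auto
      show ?thesis by (rule nn_integral_cmult) measurable
    qed
    also have "\<dots> \<le> ?D \<omega> * ennreal ((\<epsilon> / sqrt \<alpha>) ^ ?d)"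
      using \<epsilon> by (intro mult_left_mono nn_integral_small_noise_le sub \<alpha>) auto
    finally show "resample ((R \<inter> R') \<times> UNIV) ?f \<omega> \<le> ?D \<omega> * ennreal ((\<epsilon> / sqrt \<alpha>) ^ ?d)" .
  qed
  also have "\<dots> = (\<integral>\<^sup>+\<omega>. ?D \<omega> \<partial>noise_space) * ennreal ((\<epsilon> / sqrt \<alpha>) ^ ?d)"
    by (rule nn_integral_multc) measurable
  also have "\<dots> \<le> ennreal ((4 * \<epsilon> / sqrt (\<kappa> + \<epsilon>\<^sup>2)) ^ ?d) * ennreal ((\<epsilon> / sqrt \<alpha>) ^ ?d)"
  proof (intro mult_right_mono)
    show "(\<integral>\<^sup>+\<omega>. ?D \<omega> \<partial>noise_space) \<le> ennreal ((4 * \<epsilon> / sqrt (\<kappa> + \<epsilon>\<^sup>2)) ^ ?d)"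
    \<comment> \<open>For \<kappa> \<le> \<epsilon>^2 the right-hand side is at least 1. Otherwise
      \<kappa> + \<epsilon>^2 \<le> 4 \<kappa>, so the added \<epsilon>^2 costs a factor two in the
      root.\<close>
    proof (cases "\<kappa> \<le> \<epsilon>\<^sup>2")
      case True
      then have "\<kappa> + \<epsilon>\<^sup>2 \<le> (2 * \<epsilon>)\<^sup>2"
        using zero_le_power2[of \<epsilon>] four_x_squared[of \<epsilon>] by linarith
      then have "sqrt (\<kappa> + \<epsilon>\<^sup>2) \<le> sqrt ((2 * \<epsilon>)\<^sup>2)" by (rule real_sqrt_le_mono)
      also have "\<dots> = 2 * \<epsilon>" using \<epsilon> by (subst real_sqrt_abs) simp
      finally have "1 \<le> 4 * \<epsilon> / sqrt (\<kappa> + \<epsilon>\<^sup>2)"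
        using \<epsilon> \<kappa> by (subst le_divide_eq_1_pos) (auto intro!: add_nonneg_pos)
      then have "1 \<le> (4 * \<epsilon> / sqrt (\<kappa> + \<epsilon>\<^sup>2)) ^ ?d" by (rule one_le_power)
      then have "1 \<le> ennreal ((4 * \<epsilon> / sqrt (\<kappa> + \<epsilon>\<^sup>2)) ^ ?d)" by (metis ennreal_1 ennreal_leI)
      moreover have "(\<integral>\<^sup>+\<omega>. ?D \<omega> \<partial>noise_space) \<le> (\<integral>\<^sup>+\<omega>. 1 \<partial>noise_space)"
        by (intro nn_integral_mono small_le_1)
      ultimately show ?thesis using P.emeasure_space_1 by (auto intro: order_trans)
    next
      case False
      then have \<kappa>0: "0 < \<kappa>" using \<epsilon> by (smt (verit) zero_le_power2)
      have "(\<integral>\<^sup>+\<omega>. ?D \<omega> \<partial>noise_space) \<le> ennreal ((2 * \<epsilon> / sqrt \<kappa>) ^ ?d)"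
        using \<kappa>(2)
      proof
        assume "\<kappa> \<le> sum w (R - R')"
        then show ?thesis using \<kappa>0 \<epsilon> sub by (intro nn_integral_small_shifted_noise_le) auto
      next
        assume "\<kappa> \<le> sum w (R' - R)"
        then have "(\<integral>\<^sup>+\<omega>. small (2 * \<epsilon>) (\<lambda>l. noise (R' - R) \<omega> l - noise (R - R') \<omega> l) \<partial>noise_space) \<le> ennreal ((2 * \<epsilon> / sqrt \<kappa>) ^ ?d)"
          using \<kappa>0 \<epsilon> sub by (intro nn_integral_small_shifted_noise_le) auto
        moreover have "small (2 * \<epsilon>) (\<lambda>l. noise (R' - R) \<omega> l - noise (R - R') \<omega> l) = ?D \<omega>" for \<omega>
          using small_uminus[of "2 * \<epsilon>" "\<lambda>l. noise (R - R') \<omega> l - noise (R' - R) \<omega> l"] by simp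
        ultimately show ?thesis by simp
      qed
      also have "\<dots> \<le> ennreal ((4 * \<epsilon> / sqrt (\<kappa> + \<epsilon>\<^sup>2)) ^ ?d)"
      proof (intro ennreal_leI power_mono)
        have "sqrt (\<kappa> + \<epsilon>\<^sup>2) \<le> sqrt (4 * \<kappa>)" using False \<kappa>0 by (intro real_sqrt_le_mono) simp
        also have "\<dots> = 2 * sqrt \<kappa>" by (simp add: real_sqrt_mult)
        finally have "4 * \<epsilon> / (2 * sqrt \<kappa>) \<le> 4 * \<epsilon> / sqrt (\<kappa> + \<epsilon>\<^sup>2)"
          using \<kappa>0 \<epsilon> by (intro divide_left_mono) (auto intro!: mult_pos_pos add_pos_pos)
        then show "2 * \<epsilon> / sqrt \<kappa> \<le> 4 * \<epsilon> / sqrt (\<kappa> + \<epsilon>\<^sup>2)" by simp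
      qed (use \<epsilon> \<kappa>0 in auto)
      finally show ?thesis .
    qed
  qed simp
  also have "\<dots> = ennreal ((\<epsilon> / sqrt \<alpha>) ^ ?d * (4 * \<epsilon> / sqrt (\<kappa> + \<epsilon>\<^sup>2)) ^ ?d)"
    using \<epsilon> \<alpha> \<kappa> by (subst mult.commute, subst ennreal_mult[symmetric]) auto
  finally show ?thesis .
qed

end

subsection \<open>Comparison of lattice sums with the Riesz kernel\<close>

text \<open>A Riemann sum with mesh \<open>h\<close> for the mean of (r + u + v +
  \<epsilon>^2)^(-d/2) over u and v in [0, N h]: up to powers of \<epsilon>, the conditional
  probability of a second small increment at distance r in s, averaged over the differences of the
  two times. The term \<epsilon>^2 keeps it finite at r = 0.\<close>

definition grid_kernel :: "nat \<Rightarrow> nat \<Rightarrow> real \<Rightarrow> real \<Rightarrow> real \<Rightarrow> real" where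
  "grid_kernel d N h \<epsilon> r = (\<Sum>j<N. \<Sum>k<N. (1 / sqrt (r + (real j + real k) * h + \<epsilon>\<^sup>2)) ^ d) / (real N)\<^sup>2"

definition power_primitive :: "real \<Rightarrow> real \<Rightarrow> real" where
  "power_primitive p y = (if p = 1 then ln y else y powr (1 - p) / (1 - p))"

section \<open>Integral comparison for sums of powers\<close>

lemma DERIV_power_primitive:
  assumes "0 < y"
  shows "(power_primitive p has_real_derivative y powr (- p)) (at y)"
proof (cases "p = 1")
  case True
  then show ?thesis
    using assms unfolding power_primitive_def[abs_def]
    by (auto intro!: derivative_eq_intros simp: powr_minus divide_inverse)
next
  case False
  have "((\<lambda>y. y powr (1 - p) / (1 - p)) has_real_derivative y powr (- p)) (at y)"
    using DERIV_cdivide[OF has_real_derivative_powr[OF assms, of "1 - p"], of "1 - p"] False by simp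
  then show ?thesis using False unfolding power_primitive_def[abs_def] by simp
qed

lemma power_primitive_step:
  assumes y: "0 < y" and h: "0 < h" and p: "0 \<le> p"
  shows "power_primitive p (y + h) - power_primitive p y \<le> h * y powr (- p)"
    and "h * (y + h) powr (- p) \<le> power_primitive p (y + h) - power_primitive p y"
proof -
  have "\<exists>z>y. z < y + h \<and> power_primitive p (y + h) - power_primitive p y = (y + h - y) * z powr (- p)"
    using y h by (intro MVT2 DERIV_power_primitive) auto
  then obtain z where z: "y < z" "z < y + h" "power_primitive p (y + h) - power_primitive p y = h * z powr (- p)" by auto
  show "power_primitive p (y + h) - power_primitive p y \<le> h * y powr (- p)"
    unfolding z(3) using y h p z by (intro mult_left_mono powr_mono2') auto
  show "h * (y + h) powr (- p) \<le> power_primitive p (y + h) - power_primitive p y"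
    unfolding z(3) using y h p z by (intro mult_left_mono powr_mono2') auto
qed

lemma sum_powr_ge:
  assumes a: "0 < a" and h: "0 < h" and p: "0 \<le> p"
  shows "power_primitive p (a + real N * h) - power_primitive p a \<le> (\<Sum>k<N. h * (a + real k * h) powr (- p))"
proof (induction N)
  case (Suc N)
  have "0 < a + real N * h" using a h by (simp add: add_pos_nonneg)
  from power_primitive_step(1)[OF this h p] Suc show ?case by (simp add: algebra_simps)
qed simp

text \<open>The sum evaluates the function at left end points, where it is largest. By h \<le> a a
  step at most doubles the argument, and \<open>2 powr p\<close> pays for moving to the right end
  point.\<close>

lemma sum_powr_le:
  assumes a: "0 < a" and h: "0 < h" "h \<le> a" and p: "0 \<le> p"
  shows "(\<Sum>k<N. h * (a + real k * h) powr (- p)) \<le> 2 powr p * (power_primitive p (a + real N * h) - power_primitive p a)"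
proof (induction N)
  case (Suc N)
  let ?y = "a + real N * h"
  have y: "0 < ?y" "h \<le> ?y" using a h by (auto simp: add_pos_nonneg add_increasing2)
  have "?y + h \<le> ?y + ?y" using y(2) by (rule add_left_mono)
  then have "(2 * ?y) powr (- p) \<le> (?y + h) powr (- p)" using y h p by (intro powr_mono2') (simp_all only: mult_2 neg_le_0_iff_le add_pos_pos)
  then have "2 powr p * (2 * ?y) powr (- p) \<le> 2 powr p * (?y + h) powr (- p)" by (intro mult_left_mono) auto
  moreover have zz: "2 powr p * (2 * z) powr (- p) = z powr (- p)" if "0 < z" for z :: real
    using that by (simp add: powr_mult powr_minus)
  ultimately have "?y powr (- p) \<le> 2 powr p * (?y + h) powr (- p)" by (simp only: zz[OF y(1)])
  then have "h * ?y powr (- p) \<le> h * (2 powr p * (?y + h) powr (- p))" using h by (intro mult_left_mono) auto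
  also have "\<dots> = 2 powr p * (h * (?y + h) powr (- p))" by (rule mult.left_commute)
  also have "\<dots> \<le> 2 powr p * (power_primitive p (?y + h) - power_primitive p ?y)"
    using power_primitive_step(2)[OF y(1) h(1) p] by (intro mult_left_mono) auto
  finally show ?case using Suc by (simp add: algebra_simps)
qed simp

lemma inverse_sqrt_power: "0 < y \<Longrightarrow> (1 / sqrt y) ^ d = y powr (- (real d / 2))"
proof -
  assume y: "0 < y"
  have "1 / sqrt y = y powr (- (1/2))" using y by (simp add: powr_minus_divide powr_half_sqrt)
  then have "(1 / sqrt y) ^ d = (y powr (- (1/2))) powr real d" using y by (simp only: powr_realpow powr_gt_zero)
  then show ?thesis unfolding powr_powr by simp
qed

lemma grid_kernel_eq:
  assumes r: "0 < r + \<epsilon>\<^sup>2" and h: "0 < h" and N: "0 < N" and U: "real N * h = U"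
  shows "U\<^sup>2 * grid_kernel d N h \<epsilon> r = (\<Sum>j<N. h * (\<Sum>k<N. h * ((r + \<epsilon>\<^sup>2 + real j * h) + real k * h) powr (- (real d / 2))))"
proof -
  have "(1 / sqrt (r + (real j + real k) * h + \<epsilon>\<^sup>2)) ^ d = ((r + \<epsilon>\<^sup>2 + real j * h) + real k * h) powr (- (real d / 2))" for j k :: nat
  proof -
    have "r + (real j + real k) * h + \<epsilon>\<^sup>2 = (r + \<epsilon>\<^sup>2 + real j * h) + real k * h" by (simp add: algebra_simps)
    moreover have "0 < (r + \<epsilon>\<^sup>2 + real j * h) + real k * h" using r h by (simp add: add_pos_nonneg)
    ultimately show ?thesis by (simp only: inverse_sqrt_power)
  qed
  then have "U\<^sup>2 * grid_kernel d N h \<epsilon> r = h\<^sup>2 * (\<Sum>j<N. \<Sum>k<N. ((r + \<epsilon>\<^sup>2 + real j * h) + real k * h) powr (- (real d / 2)))"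
    using N unfolding grid_kernel_def U[symmetric] by (simp add: power_mult_distrib)
  then show ?thesis by (simp add: sum_distrib_left power2_eq_square mult.assoc)
qed

lemma grid_kernel_nonneg: "0 \<le> r \<Longrightarrow> 0 \<le> h \<Longrightarrow> 0 \<le> grid_kernel d N h \<epsilon> r"
  unfolding grid_kernel_def by (intro divide_nonneg_nonneg sum_nonneg zero_le_power) auto

text \<open>The Riesz kernel of order (d - 4) / 2 as a real function of a positive distance; the
  infinite value at 0 is left to \<open>riesz_kernel\<close>.\<close>

definition real_kernel :: "nat \<Rightarrow> real \<Rightarrow> real" where
  "real_kernel d a = (if d < 4 then 1 else if d = 4 then max 0 (ln (1 / a)) else a powr (- ((real d - 4) / 2)))"

lemma real_kernel_nonneg: "0 \<le> real_kernel d a"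
  by (simp add: real_kernel_def)

lemma riesz_kernel_eq:
  "riesz_kernel ((real d - 4) / 2) r = (if d < 4 then 1 else if r = 0 then \<top> else ennreal (real_kernel d \<bar>r\<bar>))"
  by (auto simp: riesz_kernel_def real_kernel_def)

lemma real_kernel_antimono: "0 < a \<Longrightarrow> a \<le> a' \<Longrightarrow> real_kernel d a' \<le> real_kernel d a"
  using ln_mono[of a a'] by (auto simp: real_kernel_def ln_div max_def intro!: powr_mono2')

text \<open>Meant for points that have been moved to a grid, whose distances are then controlled up
  to a factor 3. For d = 4 the change is additive, which is why 1 is added on the right.\<close>

lemma real_kernel_third:
  obtains C where "0 \<le> C" "\<And>a. 0 < a \<Longrightarrow> real_kernel d (a / 3) \<le> C * (1 + real_kernel d a)"
proof
  let ?C = "1 + ln 3 + 3 powr ((real d - 4) / 2) :: real"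
  have ln3: "0 \<le> ln (3::real)" by simp
  show "0 \<le> ?C" using ln3 by (intro add_nonneg_nonneg) auto
  fix a :: real assume a: "0 < a"
  consider "d < 4" | "d = 4" | "4 < d" by linarith
  then show "real_kernel d (a / 3) \<le> ?C * (1 + real_kernel d a)"
  proof cases
    case 1
    then have "1 \<le> ?C" using ln3 by simp
    then show ?thesis using 1 ln3 by (simp add: real_kernel_def)
  next
    case 2
    have "real_kernel d (a / 3) \<le> ln 3 + real_kernel d a"
      using 2 a ln3 by (auto simp: real_kernel_def ln_div max_def)
    also have "\<dots> \<le> ?C * 1 + ?C * real_kernel d a"
      using ln3 mult_right_mono[of 1 ?C "real_kernel d a"] real_kernel_nonneg[of d a] by (intro add_mono) auto
    finally show ?thesis by (simp add: distrib_left)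
  next
    case 3
    have "real_kernel d (a / 3) = 3 powr ((real d - 4) / 2) * real_kernel d a"
      using 3 a by (simp add: real_kernel_def powr_divide powr_minus field_simps)
    also have "\<dots> \<le> ?C * (1 + real_kernel d a)"
      using ln3 real_kernel_nonneg[of d a] by (intro mult_mono) auto
    finally show ?thesis .
  qed
qed

lemma power_primitive_neg: "1 < p \<Longrightarrow> power_primitive p y = - (y powr (1 - p) / (p - 1))"
  by (simp add: power_primitive_def field_simps)

text \<open>Summing (a + u + v)^(-p) with p = d / 2 over one time leaves a power of order p - 1, and
  over the other time a primitive of it, of order p - 2 or logarithmic for d = 4. The far ends of
  the ranges, at distance \<open>U\<close>, contribute constants that the 1 absorbs.\<close>

lemma grid_kernel_lower:
  assumes U: "0 < U"
  obtains C where "0 \<le> C" "\<And>N h \<epsilon> r. 0 < N \<Longrightarrow> 0 < h \<Longrightarrow> real N * h = U \<Longrightarrow> 0 < \<epsilon> \<Longrightarrow> 0 \<le> r \<Longrightarrow>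
    real_kernel d (r + \<epsilon>\<^sup>2) \<le> C * (1 + grid_kernel d N h \<epsilon> r)"
proof (cases "d < 4")
  case True
  show ?thesis
  proof (rule that[of 1])
    show "real_kernel d (r + \<epsilon>\<^sup>2) \<le> 1 * (1 + grid_kernel d N h \<epsilon> r)" if "0 < h" "0 \<le> r" for N h \<epsilon> r
      using True grid_kernel_nonneg[of r h d N \<epsilon>] that by (simp add: real_kernel_def)
  qed simp
next
  case False
  define p where "p = real d / 2"
  have p: "2 \<le> p" using False by (simp add: p_def)
  let ?P = "power_primitive (p - 1)"
  have low: "?P (r + \<epsilon>\<^sup>2 + U) - ?P (r + \<epsilon>\<^sup>2) \<le> (p - 1) * U\<^sup>2 * grid_kernel d N h \<epsilon> r + U powr (2 - p)"
    if N: "0 < N" and h: "0 < h" and NU: "real N * h = U" and \<epsilon>: "0 < \<epsilon>" and r: "0 \<le> r" for N h \<epsilon> r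
  proof -
    define a where "a = r + \<epsilon>\<^sup>2"
    have a: "0 < a" using r \<epsilon> by (simp add: a_def add_nonneg_pos)
    have inner: "((a + real j * h) powr (1 - p) - U powr (1 - p)) / (p - 1) \<le> (\<Sum>k<N. h * ((a + real j * h) + real k * h) powr (- p))" for j :: nat
    proof -
      have aj: "0 < a + real j * h" using a h by (simp add: add_pos_nonneg)
      have "(a + real j * h + U) powr (1 - p) \<le> U powr (1 - p)" using aj U p by (intro powr_mono2') auto
      then have "((a + real j * h) powr (1 - p) - U powr (1 - p)) / (p - 1) \<le> ((a + real j * h) powr (1 - p) - (a + real j * h + U) powr (1 - p)) / (p - 1)"
        using p by (intro divide_right_mono) auto
      also have "\<dots> = power_primitive p (a + real j * h + real N * h) - power_primitive p (a + real j * h)"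
        using p NU by (simp add: power_primitive_neg diff_divide_distrib)
      also have "\<dots> \<le> (\<Sum>k<N. h * ((a + real j * h) + real k * h) powr (- p))"
        using aj h p by (intro sum_powr_ge) auto
      finally show ?thesis .
    qed
    have "?P (a + U) - ?P a \<le> (\<Sum>j<N. h * (a + real j * h) powr (- (p - 1)))"
      using sum_powr_ge[OF a h, of "p - 1" N] p NU by simp
    \<comment> \<open>Subtracting U^(1-p) in each of the N steps loses N h U^(1-p) = U^(2-p)
      altogether.\<close>
    also have "\<dots> = (\<Sum>j<N. h * ((a + real j * h) powr (1 - p) - U powr (1 - p))) + real N * h * U powr (1 - p)"
      by (simp add: sum_distrib_left sum_subtractf right_diff_distrib)
    also have "real N * h * U powr (1 - p) = U powr (2 - p)"
      unfolding NU using U powr_add[of U 1 "1 - p"] by simp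
    also have "(\<Sum>j<N. h * ((a + real j * h) powr (1 - p) - U powr (1 - p)))
        = (p - 1) * (\<Sum>j<N. h * (((a + real j * h) powr (1 - p) - U powr (1 - p)) / (p - 1)))"
      using p by (simp add: sum_distrib_left)
    also have "\<dots> \<le> (p - 1) * (\<Sum>j<N. h * (\<Sum>k<N. h * ((a + real j * h) + real k * h) powr (- p)))"
      using p h inner by (intro mult_left_mono sum_mono) auto
    also have "(\<Sum>j<N. h * (\<Sum>k<N. h * ((a + real j * h) + real k * h) powr (- p))) = U\<^sup>2 * grid_kernel d N h \<epsilon> r"
      using grid_kernel_eq[of r \<epsilon> h N U d] a h N NU by (simp add: a_def p_def)
    finally show ?thesis by (simp add: a_def mult.assoc)
  qed
  define C1 where "C1 = (p - 1) * U\<^sup>2"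
  have C1: "0 \<le> C1" using p by (simp add: C1_def)
  show ?thesis
  proof (cases "d = 4")
    case True
    then have "p = 2" by (simp add: p_def)
    let ?C = "C1 + U powr (2 - p) + \<bar>ln U\<bar>"
    show ?thesis
    proof (rule that[of ?C])
      fix N :: nat and h \<epsilon> r :: real assume *: "0 < N" "0 < h" "real N * h = U" "0 < \<epsilon>" "0 \<le> (r::real)"
      have g: "0 \<le> grid_kernel d N h \<epsilon> r" using * by (intro grid_kernel_nonneg) auto
      have a: "0 < r + \<epsilon>\<^sup>2" using * by (simp add: add_nonneg_pos)
      have "ln (1 / (r + \<epsilon>\<^sup>2)) + ln U \<le> ln (r + \<epsilon>\<^sup>2 + U) - ln (r + \<epsilon>\<^sup>2)"
        using a U by (simp add: ln_div)
      also have "\<dots> \<le> C1 * grid_kernel d N h \<epsilon> r + U powr (2 - p)"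
        using low[OF *] \<open>p = 2\<close> by (simp add: C1_def power_primitive_def)
      finally have "ln (1 / (r + \<epsilon>\<^sup>2)) \<le> C1 * grid_kernel d N h \<epsilon> r + U powr (2 - p) + \<bar>ln U\<bar>" by linarith
      moreover have "0 \<le> C1 * grid_kernel d N h \<epsilon> r" using C1 g by simp
      moreover have "0 \<le> U powr (2 - p)" by simp
      moreover have "0 \<le> (U powr (2 - p) + \<bar>ln U\<bar>) * grid_kernel d N h \<epsilon> r" using g by (intro mult_nonneg_nonneg) auto
      ultimately show "real_kernel d (r + \<epsilon>\<^sup>2) \<le> ?C * (1 + grid_kernel d N h \<epsilon> r)"
        using True C1 by (simp add: real_kernel_def distrib_left distrib_right)
    qed (use C1 in simp)
  next
    case d5: False
    then have p: "2 < p" using False by (simp add: p_def)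
    let ?C = "(p - 2) * C1 + ((p - 2) * U powr (2 - p) + U powr (2 - p))"
    show ?thesis
    proof (rule that[of ?C])
      fix N :: nat and h \<epsilon> r :: real assume *: "0 < N" "0 < h" "real N * h = U" "0 < \<epsilon>" "0 \<le> (r::real)"
      have g: "0 \<le> grid_kernel d N h \<epsilon> r" using * by (intro grid_kernel_nonneg) auto
      have a: "0 < r + \<epsilon>\<^sup>2" using * by (simp add: add_nonneg_pos)
      have PP: "?P y = - (y powr (2 - p) / (p - 2))" for y using p by (subst power_primitive_neg) auto
      have "(r + \<epsilon>\<^sup>2) powr (2 - p) - (r + \<epsilon>\<^sup>2 + U) powr (2 - p) = (p - 2) * (?P (r + \<epsilon>\<^sup>2 + U) - ?P (r + \<epsilon>\<^sup>2))"
        unfolding PP using p by (simp add: right_diff_distrib)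
      also have "\<dots> \<le> (p - 2) * (C1 * grid_kernel d N h \<epsilon> r + U powr (2 - p))"
        using low[OF *] p by (intro mult_left_mono) (auto simp: C1_def)
      finally have "(r + \<epsilon>\<^sup>2) powr (2 - p) \<le> (p - 2) * (C1 * grid_kernel d N h \<epsilon> r + U powr (2 - p)) + (r + \<epsilon>\<^sup>2 + U) powr (2 - p)"
        by simp
      also have "(r + \<epsilon>\<^sup>2 + U) powr (2 - p) \<le> U powr (2 - p)" using a U p by (intro powr_mono2') auto
      finally have "(r + \<epsilon>\<^sup>2) powr (2 - p) \<le> (p - 2) * C1 * grid_kernel d N h \<epsilon> r + ((p - 2) * U powr (2 - p) + U powr (2 - p))"
        by (simp add: distrib_left mult.assoc)
      moreover have "0 \<le> (p - 2) * C1" using C1 p by simp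
      moreover have "0 \<le> ((p - 2) * U powr (2 - p) + U powr (2 - p)) * grid_kernel d N h \<epsilon> r" using g p by (intro mult_nonneg_nonneg add_nonneg_nonneg) auto
      moreover have "real_kernel d (r + \<epsilon>\<^sup>2) = (r + \<epsilon>\<^sup>2) powr (2 - p)"
        using False d5 by (simp add: real_kernel_def p_def diff_divide_distrib)
      ultimately show "real_kernel d (r + \<epsilon>\<^sup>2) \<le> ?C * (1 + grid_kernel d N h \<epsilon> r)"
        by (simp add: distrib_left distrib_right)
    qed (use C1 p in \<open>auto intro!: add_nonneg_nonneg mult_nonneg_nonneg\<close>)
  qed
qed

text \<open>The inner sum needs p > 1, hence d \<ge> 3, and h \<le> \<epsilon>^2 puts every argument
  above the mesh width, as \<open>sum_powr_le\<close> requires. The outer primitive grows with the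
  range for d = 3 and d = 4; there \<open>A\<close> bounds it.\<close>

lemma grid_kernel_upper_ge3:
  assumes U: "0 < U" and d: "3 \<le> d"
  obtains C where "0 \<le> C" "\<And>N h \<epsilon> r. 0 < N \<Longrightarrow> 0 < h \<Longrightarrow> real N * h = U \<Longrightarrow> 0 < \<epsilon> \<Longrightarrow> h \<le> \<epsilon>\<^sup>2 \<Longrightarrow> 0 \<le> r \<Longrightarrow> r + \<epsilon>\<^sup>2 \<le> A \<Longrightarrow>
    grid_kernel d N h \<epsilon> r \<le> C * (1 + real_kernel d (r + \<epsilon>\<^sup>2))"
proof -
  define p where "p = real d / 2"
  have p: "3 / 2 \<le> p" using d by (simp add: p_def)
  let ?P = "power_primitive (p - 1)"
  define C1 where "C1 = 2 powr p / (p - 1) * 2 powr (p - 1) / U\<^sup>2"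
  have C1: "0 \<le> C1" using p by (simp add: C1_def)
  have up: "grid_kernel d N h \<epsilon> r \<le> C1 * (?P (r + \<epsilon>\<^sup>2 + U) - ?P (r + \<epsilon>\<^sup>2))"
    if N: "0 < N" and h: "0 < h" and NU: "real N * h = U" and \<epsilon>: "0 < \<epsilon>" "h \<le> \<epsilon>\<^sup>2" and r: "0 \<le> r" for N h \<epsilon> r
  proof -
    define a where "a = r + \<epsilon>\<^sup>2"
    have a: "0 < a" "h \<le> a" using r \<epsilon> by (auto simp: a_def add_nonneg_pos)
    have inner: "(\<Sum>k<N. h * ((a + real j * h) + real k * h) powr (- p)) \<le> 2 powr p / (p - 1) * (a + real j * h) powr (- (p - 1))" for j :: nat
    proof -
      have aj: "0 < a + real j * h" "h \<le> a + real j * h" using a h by (auto simp: add_pos_nonneg add_increasing2)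
      have "(\<Sum>k<N. h * ((a + real j * h) + real k * h) powr (- p)) \<le> 2 powr p * (power_primitive p (a + real j * h + real N * h) - power_primitive p (a + real j * h))"
        using aj h p by (intro sum_powr_le) auto
      also have "\<dots> \<le> 2 powr p * ((a + real j * h) powr (1 - p) / (p - 1))"
        using p by (intro mult_left_mono) (auto simp: power_primitive_neg)
      finally show ?thesis by simp
    qed
    have "U\<^sup>2 * grid_kernel d N h \<epsilon> r = (\<Sum>j<N. h * (\<Sum>k<N. h * ((a + real j * h) + real k * h) powr (- p)))"
      using grid_kernel_eq[of r \<epsilon> h N U d] a h N NU by (simp add: a_def p_def)
    also have "\<dots> \<le> (\<Sum>j<N. h * (2 powr p / (p - 1) * (a + real j * h) powr (- (p - 1))))"
      using h inner by (intro sum_mono mult_left_mono) auto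
    also have "\<dots> = 2 powr p / (p - 1) * (\<Sum>j<N. h * (a + real j * h) powr (- (p - 1)))"
      by (simp add: sum_distrib_left mult.left_commute)
    also have "\<dots> \<le> 2 powr p / (p - 1) * (2 powr (p - 1) * (?P (a + real N * h) - ?P a))"
      using p a h by (intro mult_left_mono sum_powr_le) auto
    finally have "grid_kernel d N h \<epsilon> r \<le> (2 powr p / (p - 1) * (2 powr (p - 1) * (?P (a + real N * h) - ?P a))) / U\<^sup>2"
      using U by (subst pos_le_divide_eq) (simp_all add: mult.commute)
    then show ?thesis unfolding C1_def NU a_def by (simp add: mult.assoc)
  qed
  consider "d = 3" | "d = 4" | "4 < d" using d by linarith
  then show ?thesis
  proof cases
    case 1
    then have "p = 3/2" by (simp add: p_def)
    let ?C = "C1 * (2 * sqrt (\<bar>A\<bar> + U))"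
    show ?thesis
    proof (rule that[of ?C])
      fix N :: nat and h \<epsilon> r :: real assume *: "0 < N" "0 < h" "real N * h = U" "0 < \<epsilon>" "h \<le> \<epsilon>\<^sup>2" "0 \<le> (r::real)" and A: "r + \<epsilon>\<^sup>2 \<le> A"
      have a: "0 < r + \<epsilon>\<^sup>2" using * by (simp add: add_nonneg_pos)
      have PP: "?P y = 2 * sqrt y" if "0 < y" for y unfolding power_primitive_def \<open>p = 3/2\<close> using that by (simp add: powr_half_sqrt[symmetric])
      have "?P (r + \<epsilon>\<^sup>2 + U) - ?P (r + \<epsilon>\<^sup>2) \<le> 2 * sqrt (\<bar>A\<bar> + U)"
      proof -
        have "sqrt (r + \<epsilon>\<^sup>2 + U) \<le> sqrt (\<bar>A\<bar> + U)" using A by (intro real_sqrt_le_mono) auto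
        moreover have "0 \<le> sqrt (r + \<epsilon>\<^sup>2)" using a by simp
        ultimately show ?thesis using PP[of "r + \<epsilon>\<^sup>2 + U"] PP[of "r + \<epsilon>\<^sup>2"] a U by linarith
      qed
      then have "C1 * (?P (r + \<epsilon>\<^sup>2 + U) - ?P (r + \<epsilon>\<^sup>2)) \<le> ?C" by (rule mult_left_mono[OF _ C1])
      with up[OF *] have "grid_kernel d N h \<epsilon> r \<le> ?C" by linarith
      moreover have "0 \<le> ?C * real_kernel d (r + \<epsilon>\<^sup>2)" using C1 U real_kernel_nonneg by (intro mult_nonneg_nonneg) auto
      ultimately show "grid_kernel d N h \<epsilon> r \<le> ?C * (1 + real_kernel d (r + \<epsilon>\<^sup>2))" by (simp add: distrib_left)
    qed (use C1 U in auto)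
  next
    case 2
    then have "p = 2" by (simp add: p_def)
    let ?C = "C1 * (1 + \<bar>ln (\<bar>A\<bar> + U)\<bar>)"
    show ?thesis
    proof (rule that[of ?C])
      fix N :: nat and h \<epsilon> r :: real assume *: "0 < N" "0 < h" "real N * h = U" "0 < \<epsilon>" "h \<le> \<epsilon>\<^sup>2" "0 \<le> (r::real)" and A: "r + \<epsilon>\<^sup>2 \<le> A"
      have a: "0 < r + \<epsilon>\<^sup>2" using * by (simp add: add_nonneg_pos)
      have PP: "?P y = ln y" for y using \<open>p = 2\<close> by (simp add: power_primitive_def)
      have "ln (r + \<epsilon>\<^sup>2 + U) \<le> ln (\<bar>A\<bar> + U)" using a U A by (intro ln_mono) auto
      moreover have "- ln (r + \<epsilon>\<^sup>2) \<le> real_kernel d (r + \<epsilon>\<^sup>2)" using a 2 by (simp add: real_kernel_def ln_div)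
      ultimately have "?P (r + \<epsilon>\<^sup>2 + U) - ?P (r + \<epsilon>\<^sup>2) \<le> \<bar>ln (\<bar>A\<bar> + U)\<bar> + real_kernel d (r + \<epsilon>\<^sup>2)"
        unfolding PP by linarith
      also have "\<dots> \<le> (1 + \<bar>ln (\<bar>A\<bar> + U)\<bar>) * (1 + real_kernel d (r + \<epsilon>\<^sup>2))"
        using real_kernel_nonneg[of d "r + \<epsilon>\<^sup>2"] by (simp add: distrib_left distrib_right)
      finally have "C1 * (?P (r + \<epsilon>\<^sup>2 + U) - ?P (r + \<epsilon>\<^sup>2)) \<le> C1 * ((1 + \<bar>ln (\<bar>A\<bar> + U)\<bar>) * (1 + real_kernel d (r + \<epsilon>\<^sup>2)))"
        by (rule mult_left_mono[OF _ C1])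
      with up[OF *] show "grid_kernel d N h \<epsilon> r \<le> ?C * (1 + real_kernel d (r + \<epsilon>\<^sup>2))" by (simp add: mult.assoc)
    qed (use C1 in auto)
  next
    case 3
    then have p2: "2 < p" by (simp add: p_def)
    let ?C = "C1 * (1 / (p - 2))"
    show ?thesis
    proof (rule that[of ?C])
      fix N :: nat and h \<epsilon> r :: real assume *: "0 < N" "0 < h" "real N * h = U" "0 < \<epsilon>" "h \<le> \<epsilon>\<^sup>2" "0 \<le> (r::real)" and A: "r + \<epsilon>\<^sup>2 \<le> A"
      have PP: "?P y = - (y powr (2 - p) / (p - 2))" for y using p2 by (subst power_primitive_neg) auto
      have "?P (r + \<epsilon>\<^sup>2 + U) - ?P (r + \<epsilon>\<^sup>2) \<le> (1 / (p - 2)) * (r + \<epsilon>\<^sup>2) powr (2 - p)"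
        unfolding PP using p2 by simp
      also have "(r + \<epsilon>\<^sup>2) powr (2 - p) = real_kernel d (r + \<epsilon>\<^sup>2)"
        using 3 by (simp add: real_kernel_def p_def diff_divide_distrib)
      also have "1 / (p - 2) * real_kernel d (r + \<epsilon>\<^sup>2) \<le> 1 / (p - 2) * (1 + real_kernel d (r + \<epsilon>\<^sup>2))"
        using p2 by (intro mult_left_mono) auto
      finally have "C1 * (?P (r + \<epsilon>\<^sup>2 + U) - ?P (r + \<epsilon>\<^sup>2)) \<le> C1 * (1 / (p - 2) * (1 + real_kernel d (r + \<epsilon>\<^sup>2)))"
        by (rule mult_left_mono[OF _ C1])
      with up[OF *] show "grid_kernel d N h \<epsilon> r \<le> ?C * (1 + real_kernel d (r + \<epsilon>\<^sup>2))" by (simp only: mult.assoc)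
    qed (use C1 p2 in auto)
  qed
qed

text \<open>For d < 3 the arguments are bounded, so the summand is at most a constant times that of
  dimension 3, and the Riesz kernel is 1 in both dimensions.\<close>

lemma grid_kernel_upper:
  assumes U: "0 < U"
  obtains C where "0 \<le> C" "\<And>N h \<epsilon> r. 0 < N \<Longrightarrow> 0 < h \<Longrightarrow> real N * h = U \<Longrightarrow> 0 < \<epsilon> \<Longrightarrow> h \<le> \<epsilon>\<^sup>2 \<Longrightarrow> 0 \<le> r \<Longrightarrow> r + \<epsilon>\<^sup>2 \<le> A \<Longrightarrow>
    grid_kernel d N h \<epsilon> r \<le> C * (1 + real_kernel d (r + \<epsilon>\<^sup>2))"
proof (cases "3 \<le> d")
  case True
  then show ?thesis using grid_kernel_upper_ge3[OF U True] that by metis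
next
  case False
  obtain C where C: "0 \<le> C" "\<And>N h \<epsilon> r. 0 < N \<Longrightarrow> 0 < h \<Longrightarrow> real N * h = U \<Longrightarrow> 0 < \<epsilon> \<Longrightarrow> h \<le> \<epsilon>\<^sup>2 \<Longrightarrow> 0 \<le> r \<Longrightarrow> r + \<epsilon>\<^sup>2 \<le> A \<Longrightarrow>
    grid_kernel 3 N h \<epsilon> r \<le> C * (1 + real_kernel 3 (r + \<epsilon>\<^sup>2))"
    using grid_kernel_upper_ge3[OF U, of 3 A] by auto
  define Y where "Y = sqrt (\<bar>A\<bar> + 2 * U) + 1"
  have Y: "1 \<le> Y" using U by (simp add: Y_def)
  show ?thesis
  proof (rule that[of "Y ^ (3 - d) * C"])
    show "0 \<le> Y ^ (3 - d) * C" using Y C by simp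
    fix N :: nat and h \<epsilon> r :: real assume *: "0 < N" "0 < h" "real N * h = U" "0 < \<epsilon>" "h \<le> \<epsilon>\<^sup>2" "0 \<le> (r::real)" and A: "r + \<epsilon>\<^sup>2 \<le> A"
    have le: "(1 / sqrt (r + (real j + real k) * h + \<epsilon>\<^sup>2)) ^ d \<le> Y ^ (3 - d) * (1 / sqrt (r + (real j + real k) * h + \<epsilon>\<^sup>2)) ^ 3" if "j < N" "k < N" for j k
    proof -
      let ?s = "sqrt (r + (real j + real k) * h + \<epsilon>\<^sup>2)"
      have "0 < r + (real j + real k) * h + \<epsilon>\<^sup>2" using * by (intro add_nonneg_pos add_nonneg_nonneg mult_nonneg_nonneg) auto
      then have s: "0 < ?s" by simp
      have "(real j + real k) * h \<le> (2 * real N) * h" using that * by (intro mult_right_mono) auto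
      also have "\<dots> = 2 * U" using *(3) by simp
      finally have "?s \<le> sqrt (\<bar>A\<bar> + 2 * U)" using A by (intro real_sqrt_le_mono) linarith
      then have "?s \<le> Y" unfolding Y_def by linarith
      then have "?s ^ (3 - d) \<le> Y ^ (3 - d)" using s by (intro power_mono) auto
      then have "?s ^ (3 - d) * (1 / ?s) ^ 3 \<le> Y ^ (3 - d) * (1 / ?s) ^ 3" using s by (intro mult_right_mono) auto
      moreover have "?s ^ (3 - d) * (1 / ?s) ^ 3 = (1 / ?s) ^ d"
      proof -
        have "(1 / ?s) ^ 3 = (1 / ?s) ^ (3 - d) * (1 / ?s) ^ d" using False unfolding power_add[symmetric] by simp
        moreover have "?s ^ (3 - d) * (1 / ?s) ^ (3 - d) = 1" unfolding power_mult_distrib[symmetric] using s by simp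
        ultimately show ?thesis by (simp only: mult.assoc[symmetric] mult_1)
      qed
      ultimately show ?thesis by simp
    qed
    have "grid_kernel d N h \<epsilon> r \<le> Y ^ (3 - d) * grid_kernel 3 N h \<epsilon> r"
      unfolding grid_kernel_def times_divide_eq_right sum_distrib_left
      using le by (intro divide_right_mono sum_mono) auto
    also have "\<dots> \<le> Y ^ (3 - d) * (C * (1 + real_kernel 3 (r + \<epsilon>\<^sup>2)))"
      using C(2)[OF * A] Y by (intro mult_left_mono) auto
    also have "real_kernel 3 (r + \<epsilon>\<^sup>2) = real_kernel d (r + \<epsilon>\<^sup>2)" using False by (simp add: real_kernel_def)
    finally show "grid_kernel d N h \<epsilon> r \<le> Y ^ (3 - d) * C * (1 + real_kernel d (r + \<epsilon>\<^sup>2))" by (simp add: mult.assoc)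
  qed
qed

subsection \<open>Rectangles in a grid\<close>

lemma sum_telescope_pred:
  fixes f :: "nat \<Rightarrow> real"
  shows "a \<le> b \<Longrightarrow> (\<Sum>i\<in>{a<..b}. f i - f (i - 1)) = f b - f a"
proof (induction b rule: dec_induct)
  case (step b)
  have "{a<..Suc b} = insert (Suc b) {a<..b}" using step by auto
  then show ?case using step by simp
qed simp

lemma sum_int_telescope:
  fixes f :: "int \<Rightarrow> real"
  shows "a \<le> b + 1 \<Longrightarrow> (\<Sum>m\<in>{a..b}. f m - f (m - 1)) = f b - f (a - 1)"
proof (induction "nat (b + 1 - a)" arbitrary: b)
  case 0
  then have "b = a - 1" by simp
  then show ?case by simp
next
  case (Suc m)
  then have "a \<le> b" by simp
  then have "{a..b} = insert b {a..b - 1}" by auto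
  then show ?case using Suc.hyps(1)[of "b - 1"] Suc.hyps(2) \<open>a \<le> b\<close> by simp
qed

definition absdiff :: "nat \<Rightarrow> nat \<Rightarrow> nat" where
  "absdiff i j = (if i \<le> j then j - i else i - j)"

text \<open>Distances from j to points on one side of it are distinct, so each side contributes at
  most the sum over m < 2 N, and by monotonicity this is at most twice the sum over m < N.\<close>

lemma sum_absdiff_le:
  fixes f :: "nat \<Rightarrow> real"
  assumes anti: "\<And>i j. i \<le> j \<Longrightarrow> f j \<le> f i" and nonneg: "\<And>i. 0 \<le> f i" and j: "j < 2 * N"
  shows "(\<Sum>j'<2 * N. f (absdiff j j')) \<le> 4 * (\<Sum>m<N. f m)"
proof -
  have "(\<Sum>j'<2 * N. f (absdiff j j')) = (\<Sum>j'\<in>{..<j} \<union> {j..<2 * N}. f (absdiff j j'))"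
    using j by (intro sum.cong) auto
  also have "\<dots> = (\<Sum>j'<j. f (absdiff j j')) + (\<Sum>j'\<in>{j..<2 * N}. f (absdiff j j'))"
    by (rule sum.union_disjoint) auto
  also have "(\<Sum>j'<j. f (absdiff j j')) = (\<Sum>m\<in>{1..j}. f m)"
    by (rule sum.reindex_bij_witness[of _ "\<lambda>m. j - m" "\<lambda>m. j - m"]) (auto simp: absdiff_def)
  also have "\<dots> \<le> (\<Sum>m<2 * N. f m)"
    using j nonneg by (intro sum_mono2) auto
  also have "(\<Sum>j'\<in>{j..<2 * N}. f (absdiff j j')) = (\<Sum>m<2 * N - j. f m)"
    by (rule sum.reindex_bij_witness[of _ "\<lambda>m. m + j" "\<lambda>m. m - j"]) (auto simp: absdiff_def)
  also have "\<dots> \<le> (\<Sum>m<2 * N. f m)"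
    using nonneg by (intro sum_mono2) auto
  also have "(\<Sum>m<2 * N. f m) = (\<Sum>m\<in>{..<N} \<union> {N..<2 * N}. f m)"
    by (intro sum.cong) auto
  also have "\<dots> = (\<Sum>m<N. f m) + (\<Sum>m\<in>{N..<2 * N}. f m)"
    by (rule sum.union_disjoint) auto
  also have "(\<Sum>m\<in>{N..<2 * N}. f m) = (\<Sum>m<N. f (m + N))"
    by (rule sum.reindex_bij_witness[of _ "\<lambda>m. m + N" "\<lambda>m. m - N"]) auto
  also have "\<dots> \<le> (\<Sum>m<N. f m)" by (intro sum_mono anti) auto
  finally show ?thesis by simp
qed

lemma sum_absdiff_le2:
  fixes f :: "nat \<Rightarrow> nat \<Rightarrow> real"
  assumes anti: "\<And>i i' k. i \<le> i' \<Longrightarrow> f i' k \<le> f i k" "\<And>i k k'. k \<le> k' \<Longrightarrow> f i k' \<le> f i k"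
    and nonneg: "\<And>i k. 0 \<le> f i k" and jk: "j < 2 * N" "k < 2 * N"
  shows "(\<Sum>j'<2 * N. \<Sum>k'<2 * N. f (absdiff j j') (absdiff k k')) \<le> 16 * (\<Sum>m<N. \<Sum>m'<N. f m m')"
proof -
  have "(\<Sum>j'<2 * N. \<Sum>k'<2 * N. f (absdiff j j') (absdiff k k'))
      \<le> (\<Sum>j'<2 * N. 4 * (\<Sum>m'<N. f (absdiff j j') m'))"
    using anti nonneg jk by (intro sum_mono sum_absdiff_le) auto
  also have "\<dots> = 4 * (\<Sum>j'<2 * N. (\<lambda>m. \<Sum>m'<N. f m m') (absdiff j j'))"
    by (simp add: sum_distrib_left)
  also have "\<dots> \<le> 4 * (4 * (\<Sum>m<N. \<Sum>m'<N. f m m'))"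
    using anti nonneg jk by (intro mult_left_mono sum_absdiff_le) (auto intro!: sum_mono sum_nonneg)
  finally show ?thesis by simp
qed

text \<open>The values of \<open>x\<close> from 1 to \<open>n\<close> stand for points of F, and
  \<open>x 0 = 0\<close> for the axis at which all rectangles start. \<open>g\<close> is the length
  of the gap between the two time ranges and \<open>h\<close> the mesh in time. Constants in the
  estimates may involve \<open>g\<close>, \<open>s0\<close>, \<open>s1\<close> and the product N h,
  but not the fineness of the grid.\<close>

locale grid_noise =
  fixes n N :: nat and x :: "nat \<Rightarrow> real" and g h s0 s1 \<epsilon> :: real and dim :: "'d::finite itself"
  assumes N_pos: "0 < N"
    and x_0: "x 0 = 0" and x_strict: "\<And>i j. i < j \<Longrightarrow> j \<le> n \<Longrightarrow> x i < x j"
    and g_pos: "0 < g" and h_pos: "0 < h" and \<epsilon>_pos: "0 < \<epsilon>"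
    and s0_pos: "0 < s0" and s0_le: "\<And>i. 1 \<le> i \<Longrightarrow> i \<le> n \<Longrightarrow> s0 \<le> x i"
    and s1_ge: "\<And>i. i \<le> n \<Longrightarrow> x i \<le> s1"
begin

text \<open>Cell \<open>(i, m)\<close> stands for a rectangle whose first coordinates run from \<open>x (i - 1)\<close> to \<open>x i\<close>. In the
  second coordinate, cell 0 is the gap between the two time ranges and has height \<open>g\<close>; the cells of height \<open>h\<close>
  with negative and positive index lie below and above it.\<close>

definition cells :: "(nat \<times> int) set" where
  "cells = {1..n} \<times> {- int (2 * N)..int (2 * N)}"

definition height :: "int \<Rightarrow> real" where
  "height m = (if m = 0 then g else h)"

text \<open>The product of the side lengths is the variance of the noise. The value 1 off the grid
  keeps all weights positive, as \<open>white_noise\<close> demands.\<close>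

definition area :: "nat \<times> int \<Rightarrow> real" where
  "area c = (if c \<in> cells then (x (fst c) - x (fst c - 1)) * height (snd c) else 1)"

lemma height_pos: "0 < height m"
  using g_pos h_pos by (simp add: height_def)

sublocale white_noise cells area dim
proof
  show "finite cells" by (simp add: cells_def)
  fix c
  have "x (fst c - 1) < x (fst c)" if "c \<in> cells"
    using that by (intro x_strict) (auto simp: cells_def)
  then show "0 < area c" using height_pos by (simp add: area_def)
qed

text \<open>For a gap [b, c] this is the rectangle [0, x i] times [b - j h, c + k h], with noise B(x
  i, c + k h) - B(x i, b - j h). It increases in all three indices.\<close>

definition region :: "nat \<Rightarrow> nat \<Rightarrow> nat \<Rightarrow> (nat \<times> int) set" where
  "region i j k = {1..i} \<times> {- int j..int k}"

lemma region_subset: "i \<le> n \<Longrightarrow> j \<le> 2 * N \<Longrightarrow> k \<le> 2 * N \<Longrightarrow> region i j k \<subseteq> cells"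
  by (auto simp: region_def cells_def)

lemma region_Int: "region i j k \<inter> region i' j' k' = region (min i i') (min j j') (min k k')"
  by (auto simp: region_def)

lemma region_mono: "i \<le> i' \<Longrightarrow> j \<le> j' \<Longrightarrow> k \<le> k' \<Longrightarrow> region i j k \<subseteq> region i' j' k'"
  by (auto simp: region_def)

lemma x_mono: "i \<le> j \<Longrightarrow> j \<le> n \<Longrightarrow> x i \<le> x j"
  using x_strict[of i j] by (cases "i = j") auto

lemma sum_area_rect:
  assumes "a \<le> b" "b \<le> n" "T \<subseteq> {- int (2 * N)..int (2 * N)}"
  shows "sum area ({a<..b} \<times> T) = (x b - x a) * sum height T"
proof -
  have "sum area ({a<..b} \<times> T) = (\<Sum>(i, m)\<in>{a<..b} \<times> T. (x i - x (i - 1)) * height m)"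
    using assms by (intro sum.cong) (auto simp: area_def cells_def)
  also have "\<dots> = (\<Sum>i\<in>{a<..b}. x i - x (i - 1)) * sum height T"
    by (simp add: sum.cartesian_product[symmetric] sum_product)
  finally show ?thesis using sum_telescope_pred[OF assms(1), of x] by simp
qed

lemma sum_height: "sum height {- int j..int k} = g + (real j + real k) * h"
proof -
  have "sum height {- int j..int k} = height 0 + sum height ({- int j..int k} - {0})"
    by (rule sum.remove) auto
  also have "sum height ({- int j..int k} - {0}) = (\<Sum>m\<in>{- int j..int k} - {0}. h)"
    by (intro sum.cong) (auto simp: height_def)
  also have "\<dots> = real (card ({- int j..int k} - {0})) * h" by simp
  also have "card ({- int j..int k} - {0}) = j + k" by (subst card_Diff_subset) auto
  finally show ?thesis by (simp add: height_def)
qed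

lemma sum_area_region:
  "i \<le> n \<Longrightarrow> j \<le> 2 * N \<Longrightarrow> k \<le> 2 * N \<Longrightarrow> sum area (region i j k) = x i * (g + (real j + real k) * h)"
  using sum_area_rect[of 0 i "{- int j..int k}"] x_0
  by (auto simp: region_def sum_height atLeastSucAtMost_greaterThanAtMost[symmetric])

lemma sum_area_mono: "S \<subseteq> T \<Longrightarrow> T \<subseteq> cells \<Longrightarrow> sum area S \<le> sum area T"
  using finite_cells w_pos by (intro sum_mono2) (auto intro: finite_subset less_imp_le)

text \<open>The strip over [x i', x i] belongs to the difference at every height, and it includes
  the gap of height \<open>g\<close>.\<close>

lemma area_diff_ge_s:
  assumes "i' \<le> i" "i \<le> n" "j \<le> 2 * N" "k \<le> 2 * N"
  shows "g * (x i - x i') \<le> sum area (region i j k - region i' j' k')"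
proof -
  have "g * (x i - x i') \<le> (x i - x i') * sum height {- int j..int k}"
    unfolding sum_height using assms g_pos h_pos x_mono[of i' i]
    by (subst mult.commute, intro mult_left_mono) auto
  also have "\<dots> = sum area ({i'<..i} \<times> {- int j..int k})"
    using assms by (intro sum_area_rect[symmetric]) auto
  also have "\<dots> \<le> sum area (region i j k - region i' j' k')"
    using assms by (intro sum_area_mono) (auto simp: region_def cells_def)
  finally show ?thesis .
qed

text \<open>\<open>T\<close> consists of rows of height \<open>h\<close> outside the gap, each of
  length \<open>x i\<close>, which is at least \<open>s0\<close>.\<close>

lemma area_diff_ge_t:
  assumes "1 \<le> i" "i \<le> n" "T \<subseteq> {- int (2 * N)..int (2 * N)} - {0}" "{1..i} \<times> T \<subseteq> S" "S \<subseteq> cells"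
  shows "s0 * (real (card T) * h) \<le> sum area S"
proof -
  have card: "real (card T) * h = sum height T"
  proof -
    have "sum height T = (\<Sum>m\<in>T. h)" using assms by (intro sum.cong) (auto simp: height_def)
    then show ?thesis by simp
  qed
  have "s0 * (real (card T) * h) \<le> x i * (real (card T) * h)"
    using assms s0_le h_pos by (intro mult_right_mono) auto
  also have "x i * (real (card T) * h) = sum area ({0<..i} \<times> T)"
    unfolding card using assms x_0 by (subst sum_area_rect) auto
  also have "\<dots> \<le> sum area S"
    using assms by (intro sum_area_mono) (auto simp: subset_iff)
  finally show ?thesis .
qed

text \<open>The l1 distance of two parameters, with the time indices measured in units of
  \<open>h\<close>.\<close>

definition gap :: "nat \<Rightarrow> nat \<Rightarrow> nat \<Rightarrow> nat \<Rightarrow> nat \<Rightarrow> nat \<Rightarrow> real" where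
  "gap i j k i' j' k' = \<bar>x i - x i'\<bar> + (real (absdiff j j') + real (absdiff k k')) * h"

lemma gap_nonneg: "0 \<le> gap i j k i' j' k'"
  using h_pos by (auto simp: gap_def)

text \<open>A change of one parameter adds to one of the two differences a strip of area at least
  \<open>min g s0\<close> times the change. Changes in opposite directions fall into different
  differences, so only the larger difference is controlled; it dominates each strip and therefore
  the mean of the three, whence the 3.\<close>

lemma gap_le_area_diff:
  assumes i: "1 \<le> i" "i \<le> n" "1 \<le> i'" "i' \<le> n" and jk: "j \<le> 2 * N" "k \<le> 2 * N" "j' \<le> 2 * N" "k' \<le> 2 * N"
  shows "min g s0 / 3 * gap i j k i' j' k' \<le> sum area (region i j k - region i' j' k')
    \<or> min g s0 / 3 * gap i j k i' j' k' \<le> sum area (region i' j' k' - region i j k)"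
proof -
  let ?m = "min g s0" and ?D = "sum area (region i j k - region i' j' k')" and ?D' = "sum area (region i' j' k' - region i j k)"
  have m: "0 < ?m" using g_pos s0_pos by simp
  have S: "?m * \<bar>x i - x i'\<bar> \<le> max ?D ?D'"
  proof (cases "i' \<le> i")
    case True
    then have "?m * \<bar>x i - x i'\<bar> \<le> g * (x i - x i')"
      using x_mono[of i' i] i g_pos by (intro mult_mono) auto
    also have "\<dots> \<le> ?D" using True i jk by (intro area_diff_ge_s) auto
    finally show ?thesis by simp
  next
    case False
    then have "?m * \<bar>x i - x i'\<bar> \<le> g * (x i' - x i)"
      using x_mono[of i i'] i g_pos by (intro mult_mono) auto
    also have "\<dots> \<le> ?D'" using False i jk by (intro area_diff_ge_s) auto
    finally show ?thesis by simp
  qed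
  have ms: "?m * (real a * h) \<le> s0 * (real a * h)" for a using h_pos by (intro mult_right_mono) auto
  have J: "?m * (real (absdiff j j') * h) \<le> max ?D ?D'"
  proof (cases "j' \<le> j")
    case True
    have "s0 * (real (card {- int j..- int j' - 1}) * h) \<le> ?D"
      using i jk True by (intro area_diff_ge_t[of i]) (auto simp: region_def cells_def)
    moreover have "card {- int j..- int j' - 1} = absdiff j j'" using True by (auto simp: absdiff_def)
    ultimately show ?thesis using ms[of "absdiff j j'"] by simp
  next
    case False
    have "s0 * (real (card {- int j'..- int j - 1}) * h) \<le> ?D'"
      using i jk False by (intro area_diff_ge_t[of i']) (auto simp: region_def cells_def)
    moreover have "card {- int j'..- int j - 1} = absdiff j j'" using False by (auto simp: absdiff_def)
    ultimately show ?thesis using ms[of "absdiff j j'"] by simp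
  qed
  have K: "?m * (real (absdiff k k') * h) \<le> max ?D ?D'"
  proof (cases "k' \<le> k")
    case True
    have "s0 * (real (card {int k' + 1..int k}) * h) \<le> ?D"
      using i jk True by (intro area_diff_ge_t[of i]) (auto simp: region_def cells_def)
    moreover have "card {int k' + 1..int k} = absdiff k k'" using True by (auto simp: absdiff_def)
    ultimately show ?thesis using ms[of "absdiff k k'"] by simp
  next
    case False
    have "s0 * (real (card {int k + 1..int k'}) * h) \<le> ?D'"
      using i jk False by (intro area_diff_ge_t[of i']) (auto simp: region_def cells_def)
    moreover have "card {int k + 1..int k'} = absdiff k k'" using False by (auto simp: absdiff_def)
    ultimately show ?thesis using ms[of "absdiff k k'"] by simp
  qed
  have avg: "(a + b + c) / 3 \<le> M" if "a \<le> M" "b \<le> M" "c \<le> M" for a b c M :: real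
    using add_mono[OF add_mono[OF that(1,2)] that(3)] by simp
  have "?m / 3 * gap i j k i' j' k' = (?m * \<bar>x i - x i'\<bar> + ?m * (real (absdiff j j') * h) + ?m * (real (absdiff k k') * h)) / 3"
    by (simp add: gap_def algebra_simps)
  also have "\<dots> \<le> max ?D ?D'" by (rule avg[OF S J K])
  finally show ?thesis by (simp add: le_max_iff_disj)
qed

text \<open>For ordered parameters the rectangles are nested and a single difference remains; it is
  made of strips whose other sides are at most \<open>K\<close>.\<close>

lemma area_diff_le_gap:
  assumes i: "i \<le> i'" "i' \<le> n" and jk: "j \<le> j'" "k \<le> k'" "j' \<le> 2 * N" "k' \<le> 2 * N"
    and K: "g + 4 * real N * h \<le> K" "s1 \<le> K"
  shows "sum area (region i' j' k' - region i j k) \<le> K * gap i j k i' j' k'"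
proof -
  have sub: "region i j k \<subseteq> region i' j' k'" using i jk by (intro region_mono) auto
  have "finite (region i' j' k')" by (simp add: region_def)
  then have "sum area (region i' j' k' - region i j k) = sum area (region i' j' k') - sum area (region i j k)"
    using sub by (intro sum_diff)
  also have "\<dots> = x i' * (g + (real j' + real k') * h) - x i * (g + (real j + real k) * h)"
    using i jk by (subst (1 2) sum_area_region) auto
  also have "\<dots> = (x i' - x i) * (g + (real j' + real k') * h) + x i * ((real j' - real j) + (real k' - real k)) * h"
    by (simp add: algebra_simps)
  also have "\<dots> \<le> (x i' - x i) * K + K * ((real j' - real j) + (real k' - real k)) * h"
  proof (intro add_mono mult_left_mono mult_right_mono)
    have "(real j' + real k') * h \<le> (4 * real N) * h" using jk h_pos by (intro mult_right_mono) auto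
    then show "g + (real j' + real k') * h \<le> K" using K by linarith
    show "x i \<le> K" using s1_ge[of i] i K by simp
  qed (use x_mono[of i i'] i jk h_pos g_pos in auto)
  also have "\<dots> = K * gap i j k i' j' k'"
    using x_mono[of i i'] i jk by (simp add: gap_def absdiff_def of_nat_diff algebra_simps)
  finally show ?thesis .
qed

end

subsection \<open>Occupation of a small ball\<close>

lemma sum_triple: "(\<Sum>q\<in>A \<times> B \<times> C. f q) = (\<Sum>i\<in>A. \<Sum>j\<in>B. \<Sum>k\<in>C. f (i, j, k))"
  unfolding sum.cartesian_product by (intro sum.cong) auto

context grid_noise
begin

definition kern :: "real \<Rightarrow> real" where
  "kern r = grid_kernel CARD('d) N h \<epsilon> r"

text \<open>The diagonal is included; its terms are finite because the kernel is regularised at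
  0.\<close>

definition grid_energy :: "(nat \<Rightarrow> real) \<Rightarrow> real" where
  "grid_energy p = (\<Sum>i\<in>{1..n}. \<Sum>i'\<in>{1..n}. p i * p i' * kern \<bar>x i - x i'\<bar>)"

definition hit :: "real \<Rightarrow> nat \<times> nat \<times> nat \<Rightarrow> (((nat \<times> int) \<times> 'd) \<Rightarrow> real) \<Rightarrow> ennreal" where
  "hit r q \<omega> = (case q of (i, j, k) \<Rightarrow> small r (noise (region i j k) \<omega>))"

abbreviation slots :: "nat \<Rightarrow> (nat \<times> nat \<times> nat) set" where
  "slots m \<equiv> {1..n} \<times> {..<m} \<times> {..<m}"

text \<open>Averaging over N^2 time slots and dividing by \<epsilon>^d, the order of a single
  hitting probability, makes the mean occupation of order one.\<close>

definition weight :: "(nat \<Rightarrow> real) \<Rightarrow> nat \<times> nat \<times> nat \<Rightarrow> real" where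
  "weight p q = p (fst q) / ((real N)\<^sup>2 * \<epsilon> ^ CARD('d))"

text \<open>Radius and time range are doubled with respect to a hit: after a hit of radius
  \<epsilon> in the first N slots of each time, a further increment of size \<epsilon> still counts,
  and a full N by N window of later slots is available.\<close>

definition occupation :: "(nat \<Rightarrow> real) \<Rightarrow> (((nat \<times> int) \<times> 'd) \<Rightarrow> real) \<Rightarrow> ennreal" where
  "occupation p \<omega> = (\<Sum>q\<in>slots (2 * N). ennreal (weight p q) * hit (2 * \<epsilon>) q \<omega>)"

section \<open>Moments of the occupation\<close>

lemma measurable_hit: "q \<in> slots (2 * N) \<Longrightarrow> hit r q \<in> borel_measurable noise_space"
proof (cases q)
  case (fields i j k)
  moreover assume "q \<in> slots (2 * N)"
  ultimately have "region i j k \<subseteq> cells" by (intro region_subset) auto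
  then show ?thesis
    unfolding fields hit_def[abs_def] prod.case by (intro borel_measurable_small measurable_noise)
qed

lemma slots_mono: "slots N \<subseteq> slots (2 * N)"
  by auto

lemma measurable_occupation[measurable]: "occupation p \<in> borel_measurable noise_space"
  unfolding occupation_def[abs_def]
  by (intro borel_measurable_sum borel_measurable_times_ennreal measurable_hit borel_measurable_const)

text \<open>Collects the constants of \<open>two_point_le\<close> at radius 2 \<epsilon>: the
  numerators 2 and 8 multiply to 16, \<open>s0 * g\<close> bounds the common area, and
  \<open>min 1 (min g s0 / 3)\<close> bounds the ratio of the regularised variance of the difference
  to \<open>gap\<close> plus \<epsilon>^2.\<close>

definition pair_const :: real where
  "pair_const = 16 / sqrt (s0 * g * min 1 (min g s0 / 3))"

lemma pair_const_pos: "0 < pair_const"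
  unfolding pair_const_def using s0_pos g_pos by auto

lemma hit_pair_le:
  assumes q: "(i, j, k) \<in> slots (2 * N)" "(i', j', k') \<in> slots (2 * N)"
  shows "(\<integral>\<^sup>+\<omega>. hit (2 * \<epsilon>) (i, j, k) \<omega> * hit (2 * \<epsilon>) (i', j', k') \<omega> \<partial>noise_space)
    \<le> ennreal ((pair_const * \<epsilon>\<^sup>2) ^ CARD('d) * (1 / sqrt (gap i j k i' j' k' + \<epsilon>\<^sup>2)) ^ CARD('d))"
proof -
  let ?\<delta> = "gap i j k i' j' k'" and ?m = "min g s0 / 3"
  define m1 where "m1 = min 1 ?m"
  have m1: "0 < m1" "m1 \<le> 1" "m1 \<le> ?m" using g_pos s0_pos by (auto simp: m1_def)
  have \<delta>: "0 \<le> ?\<delta>" by (rule gap_nonneg)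
  \<comment> \<open>Any two rectangles share the gap over [0, s0], whatever their times are.\<close>
  have \<alpha>: "s0 * g \<le> sum area (region i j k \<inter> region i' j' k')"
  proof -
    have "s0 * g \<le> x (min i i') * (g + (real (min j j') + real (min k k')) * h)"
      using q s0_le[of "min i i'"] g_pos h_pos s0_pos x_mono[of 0 "min i i'"] x_0 by (intro mult_mono) auto
    also have "\<dots> = sum area (region i j k \<inter> region i' j' k')"
      unfolding region_Int using q by (intro sum_area_region[symmetric]) auto
    finally show ?thesis .
  qed
  have "(\<integral>\<^sup>+\<omega>. small (2 * \<epsilon>) (noise (region i j k) \<omega>) * small (2 * \<epsilon>) (noise (region i' j' k') \<omega>) \<partial>noise_space)
    \<le> ennreal ((2 * \<epsilon> / sqrt (s0 * g)) ^ CARD('d) * (4 * (2 * \<epsilon>) / sqrt (?m * ?\<delta> + (2 * \<epsilon>)\<^sup>2)) ^ CARD('d))"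
  proof (rule two_point_le[OF _ _ _ \<alpha>])
    show "?m * ?\<delta> \<le> sum area (region i j k - region i' j' k') \<or> ?m * ?\<delta> \<le> sum area (region i' j' k' - region i j k)"
      using q by (intro gap_le_area_diff) auto
  qed (use q \<delta> g_pos s0_pos \<epsilon>_pos in \<open>auto intro!: mult_nonneg_nonneg simp: region_def cells_def\<close>)
  also have "\<dots> \<le> ennreal ((pair_const * \<epsilon>\<^sup>2) ^ CARD('d) * (1 / sqrt (?\<delta> + \<epsilon>\<^sup>2)) ^ CARD('d))"
  proof (rule ennreal_leI)
    have pos: "0 < ?\<delta> + \<epsilon>\<^sup>2" using \<delta> \<epsilon>_pos by (simp add: add_nonneg_pos)
    have "m1 * (?\<delta> + \<epsilon>\<^sup>2) \<le> ?m * ?\<delta> + 1 * \<epsilon>\<^sup>2"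
      unfolding distrib_left using m1 \<delta> by (intro add_mono mult_right_mono) auto
    also have "\<dots> \<le> ?m * ?\<delta> + (2 * \<epsilon>)\<^sup>2"
      using four_x_squared[of \<epsilon>] zero_le_power2[of \<epsilon>] by linarith
    finally have "sqrt (m1 * (?\<delta> + \<epsilon>\<^sup>2)) \<le> sqrt (?m * ?\<delta> + (2 * \<epsilon>)\<^sup>2)"
      by (rule real_sqrt_le_mono)
    then have le: "sqrt m1 * sqrt (?\<delta> + \<epsilon>\<^sup>2) \<le> sqrt (?m * ?\<delta> + (2 * \<epsilon>)\<^sup>2)"
      unfolding real_sqrt_mult[of m1] .
    have "0 < sqrt m1 * sqrt (?\<delta> + \<epsilon>\<^sup>2)" using m1 pos by simp
    with le have "0 < sqrt (?m * ?\<delta> + (2 * \<epsilon>)\<^sup>2)" by (rule order_less_le_trans[rotated])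
    note pos2 = this \<open>0 < sqrt m1 * sqrt (?\<delta> + \<epsilon>\<^sup>2)\<close>
    from le have "4 * (2 * \<epsilon>) / sqrt (?m * ?\<delta> + (2 * \<epsilon>)\<^sup>2) \<le> 4 * (2 * \<epsilon>) / (sqrt m1 * sqrt (?\<delta> + \<epsilon>\<^sup>2))"
      by (intro divide_left_mono le pos2 mult_pos_pos) (use \<epsilon>_pos in simp)
    then have "(2 * \<epsilon> / sqrt (s0 * g)) ^ CARD('d) * (4 * (2 * \<epsilon>) / sqrt (?m * ?\<delta> + (2 * \<epsilon>)\<^sup>2)) ^ CARD('d)
        \<le> (2 * \<epsilon> / sqrt (s0 * g)) ^ CARD('d) * (4 * (2 * \<epsilon>) / (sqrt m1 * sqrt (?\<delta> + \<epsilon>\<^sup>2))) ^ CARD('d)"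
      using \<epsilon>_pos s0_pos g_pos pos2 by (intro mult_left_mono power_mono) (auto simp: less_imp_le)
    also have "\<dots> = (pair_const * \<epsilon>\<^sup>2) ^ CARD('d) * (1 / sqrt (?\<delta> + \<epsilon>\<^sup>2)) ^ CARD('d)"
    proof -
      have "2 * e / A * (4 * (2 * e) / (B * D)) = 16 / (A * B) * e\<^sup>2 * (1 / D)" for e A B D :: real
        by (simp add: power2_eq_square)
      then show ?thesis
        unfolding power_mult_distrib[symmetric] pair_const_def m1_def[symmetric] real_sqrt_mult[of "s0 * g"] by simp
    qed
    finally show "(2 * \<epsilon> / sqrt (s0 * g)) ^ CARD('d) * (4 * (2 * \<epsilon>) / sqrt (?m * ?\<delta> + (2 * \<epsilon>)\<^sup>2)) ^ CARD('d)
       \<le> (pair_const * \<epsilon>\<^sup>2) ^ CARD('d) * (1 / sqrt (?\<delta> + \<epsilon>\<^sup>2)) ^ CARD('d)" .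
  qed
  finally show ?thesis by (simp add: hit_def)
qed

text \<open>The \<epsilon>^(2d) of the pair estimate cancels the normalisation of the weights. For a
  fixed first slot, the times of the second one fold to 16 N^2 \<open>kern\<close>; the (2 N)^2
  times of the first slot supply the remaining 4 of the constant 64.\<close>

lemma second_moment:
  assumes p: "\<And>i. 0 \<le> p i"
  shows "(\<integral>\<^sup>+\<omega>. (occupation p \<omega>)\<^sup>2 \<partial>noise_space) \<le> ennreal (64 * pair_const ^ CARD('d) * grid_energy p)"
proof -
  let ?d = "CARD('d)" and ?Q = "slots (2 * N)"
  let ?G = "\<lambda>q q'. case q of (i, j, k) \<Rightarrow> case q' of (i', j', k') \<Rightarrow> (1 / sqrt (gap i j k i' j' k' + \<epsilon>\<^sup>2)) ^ ?d"
  have w: "0 \<le> weight p q" for q using p \<epsilon>_pos by (simp add: weight_def)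
  have G: "0 \<le> ?G q q'" for q q' using gap_nonneg by (auto split: prod.split)
  have pc: "0 \<le> pair_const" using pair_const_pos by simp
  have sq: "(occupation p \<omega>)\<^sup>2 = (\<Sum>q\<in>?Q. \<Sum>q'\<in>?Q. ennreal (weight p q * weight p q') * (hit (2 * \<epsilon>) q \<omega> * hit (2 * \<epsilon>) q' \<omega>))" for \<omega>
    unfolding occupation_def power2_eq_square sum_product
    by (intro sum.cong refl) (simp add: ennreal_mult w ac_simps)
  have "(\<integral>\<^sup>+\<omega>. (occupation p \<omega>)\<^sup>2 \<partial>noise_space)
      = (\<Sum>q\<in>?Q. \<Sum>q'\<in>?Q. ennreal (weight p q * weight p q') * (\<integral>\<^sup>+\<omega>. hit (2 * \<epsilon>) q \<omega> * hit (2 * \<epsilon>) q' \<omega> \<partial>noise_space))"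
    unfolding sq
    by (subst nn_integral_sum, (intro borel_measurable_sum borel_measurable_times_ennreal measurable_hit borel_measurable_const; assumption),
        intro sum.cong refl, subst nn_integral_sum, (intro borel_measurable_times_ennreal measurable_hit borel_measurable_const; assumption),
        intro sum.cong refl nn_integral_cmult borel_measurable_times_ennreal measurable_hit)
  also have "\<dots> \<le> (\<Sum>q\<in>?Q. \<Sum>q'\<in>?Q. ennreal (weight p q * weight p q') * ennreal ((pair_const * \<epsilon>\<^sup>2) ^ ?d * ?G q q'))"
  proof (intro sum_mono mult_left_mono)
    fix q q' assume "q \<in> ?Q" "q' \<in> ?Q"
    then show "(\<integral>\<^sup>+\<omega>. hit (2 * \<epsilon>) q \<omega> * hit (2 * \<epsilon>) q' \<omega> \<partial>noise_space) \<le> ennreal ((pair_const * \<epsilon>\<^sup>2) ^ ?d * ?G q q')"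
      using hit_pair_le by (cases q; cases q') auto
  qed auto
  also have "\<dots> = ennreal (\<Sum>q\<in>?Q. \<Sum>q'\<in>?Q. weight p q * weight p q' * ((pair_const * \<epsilon>\<^sup>2) ^ ?d * ?G q q'))"
    using w G pc by (simp add: ennreal_mult[symmetric] sum_nonneg flip: sum_ennreal)
  also have "\<dots> \<le> ennreal (64 * pair_const ^ ?d * grid_energy p)"
  proof (rule ennreal_leI)
    have term_eq: "weight p q * weight p q' * ((pair_const * \<epsilon>\<^sup>2) ^ ?d * ?G q q') = pair_const ^ ?d / (real N) ^ 4 * (p (fst q) * p (fst q') * ?G q q')" for q q'
      using \<epsilon>_pos N_pos
      by (simp add: weight_def power_mult_distrib power2_eq_square power4_eq_xxxx field_simps flip: power_mult)
    have sum_eq: "(\<Sum>q\<in>?Q. \<Sum>q'\<in>?Q. weight p q * weight p q' * ((pair_const * \<epsilon>\<^sup>2) ^ ?d * ?G q q'))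
      = pair_const ^ ?d / (real N) ^ 4 * (\<Sum>q\<in>?Q. \<Sum>q'\<in>?Q. p (fst q) * p (fst q') * ?G q q')"
      unfolding term_eq by (simp add: sum_distrib_left)
    have "(\<Sum>q\<in>?Q. \<Sum>q'\<in>?Q. p (fst q) * p (fst q') * ?G q q')
      = (\<Sum>i\<in>{1..n}. \<Sum>j<2 * N. \<Sum>k<2 * N. \<Sum>i'\<in>{1..n}. \<Sum>j'<2 * N. \<Sum>k'<2 * N. p i * p i' * ?G (i, j, k) (i', j', k'))"
      by (simp add: sum_triple)
    also have "\<dots> \<le> (\<Sum>i\<in>{1..n}. \<Sum>j<2 * N. \<Sum>k<2 * N. \<Sum>i'\<in>{1..n}. p i * p i' * (16 * ((real N)\<^sup>2 * kern \<bar>x i - x i'\<bar>)))"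
    proof (intro sum_mono)
      fix i j k i' assume jk: "j \<in> {..<2 * N}" "k \<in> {..<2 * N}"
      let ?f = "\<lambda>m m'. (1 / sqrt (\<bar>x i - x i'\<bar> + (real m + real m') * h + \<epsilon>\<^sup>2)) ^ ?d"
      have pos: "0 < \<bar>x i - x i'\<bar> + (real m + real m') * h + \<epsilon>\<^sup>2" for m m' :: nat
        using h_pos \<epsilon>_pos by (intro add_nonneg_pos add_nonneg_nonneg mult_nonneg_nonneg) auto
      have "(\<Sum>j'<2 * N. \<Sum>k'<2 * N. ?f (absdiff j j') (absdiff k k')) \<le> 16 * (\<Sum>m<N. \<Sum>m'<N. ?f m m')"
        using h_pos pos jk \<epsilon>_pos
        by (intro sum_absdiff_le2 power_mono divide_left_mono real_sqrt_le_mono add_mono mult_right_mono mult_pos_pos)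
           (auto simp: less_imp_le)
      also have "(\<Sum>m<N. \<Sum>m'<N. ?f m m') = (real N)\<^sup>2 * kern \<bar>x i - x i'\<bar>"
        using N_pos by (simp add: kern_def grid_kernel_def)
      finally have "p i * p i' * (\<Sum>j'<2 * N. \<Sum>k'<2 * N. ?f (absdiff j j') (absdiff k k')) \<le> p i * p i' * (16 * ((real N)\<^sup>2 * kern \<bar>x i - x i'\<bar>))"
        using p by (intro mult_left_mono) auto
      then show "(\<Sum>j'<2 * N. \<Sum>k'<2 * N. p i * p i' * ?G (i, j, k) (i', j', k')) \<le> p i * p i' * (16 * ((real N)\<^sup>2 * kern \<bar>x i - x i'\<bar>))"
        by (simp add: sum_distrib_left gap_def)
    qed
    also have "\<dots> = 64 * (real N) ^ 4 * grid_energy p"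
    proof -
      have "(\<Sum>i'\<in>{1..n}. p i * p i' * (16 * ((real N)\<^sup>2 * kern \<bar>x i - x i'\<bar>)))
          = 16 * (real N)\<^sup>2 * (\<Sum>i'\<in>{1..n}. p i * p i' * kern \<bar>x i - x i'\<bar>)" for i
        unfolding sum_distrib_left by (intro sum.cong refl) (simp only: mult_ac)
      then have "(\<Sum>i\<in>{1..n}. \<Sum>j<2 * N. \<Sum>k<2 * N. \<Sum>i'\<in>{1..n}. p i * p i' * (16 * ((real N)\<^sup>2 * kern \<bar>x i - x i'\<bar>)))
        = (\<Sum>i\<in>{1..n}. real (2 * N) * (real (2 * N) * (16 * (real N)\<^sup>2 * (\<Sum>i'\<in>{1..n}. p i * p i' * kern \<bar>x i - x i'\<bar>))))"
        by (simp only: sum_constant card_lessThan)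
      also have "\<dots> = (\<Sum>i\<in>{1..n}. 64 * (real N) ^ 4 * (\<Sum>i'\<in>{1..n}. p i * p i' * kern \<bar>x i - x i'\<bar>))"
        by (intro sum.cong refl) (simp add: power2_eq_square power4_eq_xxxx)
      finally show ?thesis unfolding grid_energy_def sum_distrib_left[symmetric] .
    qed
    finally have "pair_const ^ ?d / (real N) ^ 4 * (\<Sum>q\<in>?Q. \<Sum>q'\<in>?Q. p (fst q) * p (fst q') * ?G q q')
      \<le> pair_const ^ ?d / (real N) ^ 4 * (64 * (real N) ^ 4 * grid_energy p)"
      using pc N_pos by (intro mult_left_mono) auto
    then show "(\<Sum>q\<in>?Q. \<Sum>q'\<in>?Q. weight p q * weight p q' * ((pair_const * \<epsilon>\<^sup>2) ^ ?d * ?G q q')) \<le> 64 * pair_const ^ ?d * grid_energy p"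
      unfolding sum_eq using N_pos by simp
  qed
  finally show ?thesis .
qed

lemma kern_pos: "0 \<le> r \<Longrightarrow> 0 < kern r"
  unfolding kern_def grid_kernel_def using N_pos h_pos \<epsilon>_pos
  by (intro divide_pos_pos sum_pos zero_less_power)
     (auto intro!: add_nonneg_pos add_nonneg_nonneg mult_nonneg_nonneg)

text \<open>No region has area above \<open>v\<close>, so every slot is hit with probability of
  order \<epsilon>^d uniformly. The 4 under the root bounds (2 \<epsilon>)^2.\<close>

lemma first_moment:
  assumes p: "\<And>i. 0 \<le> p i" "(\<Sum>i\<in>{1..n}. p i) = 1" and \<epsilon>: "\<epsilon> \<le> 1" and v: "s1 * (g + 4 * real N * h) \<le> v"
  shows "ennreal ((1 / (2 * sqrt (v + 4))) ^ CARD('d)) \<le> (\<integral>\<^sup>+\<omega>. occupation p \<omega> \<partial>noise_space)"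
proof -
  let ?d = "CARD('d)" and ?b = "1 / (2 * sqrt (v + 4))"
  have w: "0 \<le> weight p q" for q using p \<epsilon>_pos by (simp add: weight_def)
  have "n \<noteq> 0" using p(2) by (auto intro: ccontr)
  then have "0 < s1" using s0_le[of 1] s1_ge[of 1] s0_pos by simp
  then have "0 \<le> v" using v g_pos h_pos by (smt (verit) mult_nonneg_nonneg of_nat_0_le_iff)
  have low: "ennreal ((\<epsilon> * ?b) ^ ?d) \<le> (\<integral>\<^sup>+\<omega>. hit (2 * \<epsilon>) q \<omega> \<partial>noise_space)" if "q \<in> slots (2 * N)" for q
  proof (cases q)
    case (fields i j k)
    then have ijk: "1 \<le> i" "i \<le> n" "j < 2 * N" "k < 2 * N" using that by auto
    have "sum area (region i j k) = x i * (g + (real j + real k) * h)"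
      using ijk by (intro sum_area_region) auto
    also have "\<dots> \<le> s1 * (g + 4 * real N * h)"
      using ijk s1_ge[of i] g_pos h_pos \<open>0 < s1\<close> by (intro mult_mono add_left_mono mult_right_mono) auto
    finally have "sum area (region i j k) \<le> v" using v by simp
    then have "ennreal ((2 * \<epsilon> / (4 * sqrt (v + (2 * \<epsilon>)\<^sup>2))) ^ ?d) \<le> (\<integral>\<^sup>+\<omega>. small (2 * \<epsilon>) (noise (region i j k) \<omega>) \<partial>noise_space)"
      using ijk \<epsilon>_pos by (intro nn_integral_small_noise_ge region_subset) auto
    moreover have "(\<epsilon> * ?b) ^ ?d \<le> (2 * \<epsilon> / (4 * sqrt (v + (2 * \<epsilon>)\<^sup>2))) ^ ?d"
    proof (intro power_mono)
      have "(2 * \<epsilon>)\<^sup>2 \<le> 4" using power_le_one[of \<epsilon> 2] \<epsilon> \<epsilon>_pos four_x_squared[of \<epsilon>] by linarith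
      then have "sqrt (v + (2 * \<epsilon>)\<^sup>2) \<le> sqrt (v + 4)" by (intro real_sqrt_le_mono) simp
      then have "\<epsilon> / (2 * sqrt (v + 4)) \<le> \<epsilon> / (2 * sqrt (v + (2 * \<epsilon>)\<^sup>2))"
        using \<epsilon>_pos \<open>0 \<le> v\<close> by (intro divide_left_mono) (auto intro!: mult_pos_pos add_nonneg_pos)
      then show "\<epsilon> * ?b \<le> 2 * \<epsilon> / (4 * sqrt (v + (2 * \<epsilon>)\<^sup>2))" by simp
    qed (use \<epsilon>_pos \<open>0 \<le> v\<close> in auto)
    ultimately show ?thesis by (auto simp: fields hit_def intro: order_trans ennreal_leI)
  qed
  \<comment> \<open>The (2 N)^2 pairs of times, each of weight 1 / N^2, give the 4.\<close>
  have "(\<Sum>q\<in>slots (2 * N). weight p q) = 4 / \<epsilon> ^ ?d"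
    using N_pos \<epsilon>_pos p(2)
    by (simp add: sum_triple weight_def power2_eq_square flip: sum_divide_distrib sum_distrib_left)
  then have "(\<Sum>q\<in>slots (2 * N). weight p q) * (\<epsilon> * ?b) ^ ?d = 4 * ?b ^ ?d"
    unfolding power_mult_distrib using \<epsilon>_pos by simp
  moreover have "0 \<le> ?b ^ ?d" using \<open>0 \<le> v\<close> by simp
  ultimately have "?b ^ ?d \<le> (\<Sum>q\<in>slots (2 * N). weight p q) * (\<epsilon> * ?b) ^ ?d"
    by linarith
  then have "ennreal (?b ^ ?d) \<le> ennreal ((\<Sum>q\<in>slots (2 * N). weight p q) * (\<epsilon> * ?b) ^ ?d)"
    by (rule ennreal_leI)
  also have "\<dots> = (\<Sum>q\<in>slots (2 * N). ennreal (weight p q) * ennreal ((\<epsilon> * ?b) ^ ?d))"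
    using w \<epsilon>_pos \<open>0 \<le> v\<close> by (simp add: ennreal_mult sum_nonneg sum_distrib_right flip: sum_ennreal)
  also have "\<dots> \<le> (\<Sum>q\<in>slots (2 * N). ennreal (weight p q) * (\<integral>\<^sup>+\<omega>. hit (2 * \<epsilon>) q \<omega> \<partial>noise_space))"
    by (intro sum_mono mult_left_mono low) auto
  also have "\<dots> = (\<integral>\<^sup>+\<omega>. occupation p \<omega> \<partial>noise_space)"
    unfolding occupation_def
    by (subst nn_integral_sum, (intro borel_measurable_times_ennreal measurable_hit borel_measurable_const; assumption),
        intro sum.cong refl nn_integral_cmult[symmetric] measurable_hit)
  finally show ?thesis .
qed

section \<open>Lower bound for the hitting probability in terms of the energy\<close>

lemma prob_hit_ge:
  assumes p: "\<And>i. 0 \<le> p i" "(\<Sum>i\<in>{1..n}. p i) = 1" and \<epsilon>: "\<epsilon> \<le> 1" and v: "s1 * (g + 4 * real N * h) \<le> v"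
  shows "((1 / (2 * sqrt (v + 4))) ^ CARD('d))\<^sup>2
    \<le> measure noise_space {\<omega>\<in>space noise_space. \<exists>q\<in>slots (2 * N). hit (2 * \<epsilon>) q \<omega> \<noteq> 0} * (64 * pair_const ^ CARD('d) * grid_energy p)"
proof -
  let ?d = "CARD('d)" and ?b = "(1 / (2 * sqrt (v + 4))) ^ CARD('d)"
  define H where "H = {\<omega>\<in>space noise_space. \<exists>q\<in>slots (2 * N). hit (2 * \<epsilon>) q \<omega> \<noteq> 0}"
  define e where "e = 64 * pair_const ^ ?d * grid_energy p"
  have e: "0 \<le> e"
    unfolding e_def grid_energy_def using pair_const_pos p(1) kern_pos
    by (intro mult_nonneg_nonneg sum_nonneg) (auto intro: less_imp_le)
  have H[measurable]: "H \<in> sets noise_space"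
    unfolding H_def
  proof (rule sets.sets_Collect_finite_Ex)
    show "{\<omega> \<in> space noise_space. hit (2 * \<epsilon>) q \<omega> \<noteq> 0} \<in> sets noise_space" if "q \<in> slots (2 * N)" for q
      using measurable_hit[OF that, measurable] by measurable
  qed auto
  have fin2: "(\<integral>\<^sup>+\<omega>. (occupation p \<omega>)\<^sup>2 \<partial>noise_space) < \<top>"
    by (rule le_less_trans[OF second_moment[OF p(1)]]) simp
  have Hi: "(\<integral>\<^sup>+\<omega>. (indicator H \<omega>)\<^sup>2 \<partial>noise_space) = emeasure noise_space H"
    by (simp add: power2_eq_square indicator_inter_arith[symmetric])
  \<comment> \<open>The occupation vanishes off \<open>H\<close>, so Cauchy-Schwarz against the
    indicator of \<open>H\<close> compares its first two moments.\<close>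
  have "occupation p \<omega> = occupation p \<omega> * indicator H \<omega>" if "\<omega> \<in> space noise_space" for \<omega>
    using that by (auto simp: H_def occupation_def indicator_def intro!: sum.neutral)
  then have "(\<integral>\<^sup>+\<omega>. occupation p \<omega> \<partial>noise_space) = (\<integral>\<^sup>+\<omega>. occupation p \<omega> * indicator H \<omega> \<partial>noise_space)"
    by (rule nn_integral_cong)
  then have "(\<integral>\<^sup>+\<omega>. occupation p \<omega> \<partial>noise_space)\<^sup>2 \<le> (\<integral>\<^sup>+\<omega>. (occupation p \<omega>)\<^sup>2 \<partial>noise_space) * emeasure noise_space H"
    using nn_integral_Cauchy_Schwarz[of "occupation p" noise_space "indicator H", OF _ _ fin2]
    by (simp add: Hi P.emeasure_eq_measure)
  also have "\<dots> \<le> ennreal e * emeasure noise_space H"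
    unfolding e_def by (intro mult_right_mono second_moment p(1)) auto
  also have "\<dots> = ennreal (measure noise_space H * e)"
    using e by (simp add: P.emeasure_eq_measure ennreal_mult mult.commute)
  finally have "(ennreal ?b)\<^sup>2 \<le> ennreal (measure noise_space H * e)"
    using power_mono[OF first_moment[OF p \<epsilon> v], of 2] by (meson order_trans zero_le)
  moreover have "0 \<le> ?b"
  proof -
    have "n \<noteq> 0" using p(2) by (auto intro: ccontr)
    then have "0 < s1" using s0_le[of 1] s1_ge[of 1] s0_pos by simp
    then have "0 \<le> v" using v g_pos h_pos by (smt (verit) mult_nonneg_nonneg of_nat_0_le_iff)
    then show ?thesis by simp
  qed
  ultimately show ?thesis
    unfolding H_def[symmetric] e_def[symmetric] using e by (simp add: ennreal_power)
qed

section \<open>Upper bound for the hitting probability through the future of a hit\<close>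

definition future :: "nat \<times> nat \<times> nat \<Rightarrow> ((nat \<times> int) \<times> 'd) set" where
  "future q = (case q of (i, j, k) \<Rightarrow> {c\<in>cells. i < fst c} \<times> UNIV \<union> {c\<in>cells. snd c < - int j} \<times> UNIV \<union> {c\<in>cells. int k < snd c} \<times> UNIV)"

text \<open>\<open>future\<close> is a union of one set per parameter, each decreasing in its
  parameter, which is the form taken by \<open>cairoli_dual\<close>. As a whole it is everything
  outside the rectangle, so resampling it amounts to conditioning on the noise inside.\<close>

lemma future_eq: "i \<le> n \<Longrightarrow> j \<le> 2 * N \<Longrightarrow> k \<le> 2 * N \<Longrightarrow> future (i, j, k) = (cells - region i j k) \<times> UNIV"
  by (auto simp: future_def cells_def region_def)

text \<open>The increments from a hitting time to later times are independent of its past.\<close>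

lemma resample_occupation_ge:
  assumes p: "\<And>i. 0 \<le> p i" and q: "(i, j, k) \<in> slots N" and hit: "hit \<epsilon> (i, j, k) \<omega> \<noteq> 0"
    and \<omega>: "\<omega> \<in> space noise_space" and K: "g + 4 * real N * h \<le> K" "s1 \<le> K" "1 \<le> K"
  shows "ennreal ((1 / (4 * sqrt K)) ^ CARD('d) * (\<Sum>i'\<in>{i..n}. p i' * kern \<bar>x i - x i'\<bar>)) \<le> resample (future (i, j, k)) (occupation p) \<omega>"
proof -
  let ?d = "CARD('d)" and ?R = "region i j k"
  have ijk: "1 \<le> i" "i \<le> n" "j < N" "k < N" using q by auto
  have w: "0 \<le> weight p q" for q using p \<epsilon>_pos by (simp add: weight_def)
  \<comment> \<open>The window starts at the hit itself, so the time differences run through 0, ...,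
    N - 1, exactly the range in \<open>kern\<close>; j, k < N keep it inside the doubled
    range.\<close>
  define Q where "Q = {i..n} \<times> {j..<j + N} \<times> {k..<k + N}"
  have Q: "Q \<subseteq> slots (2 * N)" using ijk by (auto simp: Q_def)
  have smallR: "\<bar>noise ?R \<omega> l\<bar> \<le> \<epsilon>" for l using hit by (auto simp: hit_def small_def split: if_splits)
  have one: "ennreal ((\<epsilon> / (4 * sqrt K)) ^ ?d * (1 / sqrt (gap i j k i' j' k' + \<epsilon>\<^sup>2)) ^ ?d) \<le> resample (future (i, j, k)) (hit (2 * \<epsilon>) (i', j', k')) \<omega>"
    if "(i', j', k') \<in> Q" for i' j' k'
  proof -
    have l: "i \<le> i'" "i' \<le> n" "j \<le> j'" "k \<le> k'" "j' \<le> 2 * N" "k' \<le> 2 * N" using that ijk by (auto simp: Q_def)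
    let ?R' = "region i' j' k'"
    have sub: "?R \<subseteq> ?R'" "?R' \<subseteq> cells" "?R \<subseteq> cells" using l ijk by (auto simp: region_def cells_def)
    have f: "future (i, j, k) = (cells - ?R) \<times> UNIV" using ijk by (intro future_eq) auto
    have \<delta>: "0 \<le> gap i j k i' j' k'" by (rule gap_nonneg)
    have "ennreal ((\<epsilon> / (4 * sqrt K)) ^ ?d * (1 / sqrt (gap i j k i' j' k' + \<epsilon>\<^sup>2)) ^ ?d)
        \<le> ennreal ((\<epsilon> / (4 * sqrt (K * gap i j k i' j' k' + \<epsilon>\<^sup>2))) ^ ?d)"
      unfolding power_mult_distrib[symmetric]
    proof (intro ennreal_leI power_mono)
      \<comment> \<open>Since K \<ge> 1, the factor \<open>K\<close> can be pulled out of the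
        regularised variance.\<close>
      have "K * gap i j k i' j' k' + \<epsilon>\<^sup>2 \<le> K * (gap i j k i' j' k' + \<epsilon>\<^sup>2)"
        using K(3) mult_right_mono[of 1 K "\<epsilon>\<^sup>2"] by (simp add: distrib_left)
      then have "sqrt (K * gap i j k i' j' k' + \<epsilon>\<^sup>2) \<le> sqrt (K * (gap i j k i' j' k' + \<epsilon>\<^sup>2))"
        by (rule real_sqrt_le_mono)
      then have "sqrt (K * gap i j k i' j' k' + \<epsilon>\<^sup>2) \<le> sqrt K * sqrt (gap i j k i' j' k' + \<epsilon>\<^sup>2)"
        by (simp only: real_sqrt_mult)
      then have "\<epsilon> / (4 * (sqrt K * sqrt (gap i j k i' j' k' + \<epsilon>\<^sup>2))) \<le> \<epsilon> / (4 * sqrt (K * gap i j k i' j' k' + \<epsilon>\<^sup>2))"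
        using \<epsilon>_pos K \<delta> by (intro divide_left_mono) (auto intro!: mult_pos_pos add_nonneg_pos mult_nonneg_nonneg)
      then show "\<epsilon> / (4 * sqrt K) * (1 / sqrt (gap i j k i' j' k' + \<epsilon>\<^sup>2)) \<le> \<epsilon> / (4 * sqrt (K * gap i j k i' j' k' + \<epsilon>\<^sup>2))"
        by simp
    qed (use \<epsilon>_pos K \<delta> in \<open>auto intro!: mult_nonneg_nonneg add_nonneg_nonneg\<close>)
    also have "\<dots> \<le> (\<integral>\<^sup>+\<omega>'. small \<epsilon> (noise (?R' - ?R) \<omega>') \<partial>noise_space)"
      using l sub \<epsilon>_pos K by (intro nn_integral_small_noise_ge area_diff_le_gap) auto
    also have "\<dots> \<le> (\<integral>\<^sup>+\<omega>'. hit (2 * \<epsilon>) (i', j', k') (mix (future (i, j, k)) \<omega> \<omega>') \<partial>noise_space)"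
    proof (rule nn_integral_mono)
      fix \<omega>'
      let ?m = "mix (future (i, j, k)) \<omega> \<omega>'"
      \<comment> \<open>The noise of the later rectangle splits into that of the hit, which mixing
        keeps, and that of the difference, which comes from the fresh copy.\<close>
      have "noise ?R' ?m l = noise ?R \<omega> l + noise (?R' - ?R) \<omega>' l" for l
      proof -
        have "finite ?R'" by (simp add: region_def)
        then have "noise ?R' ?m l = noise ?R ?m l + noise (?R' - ?R) ?m l"
          using noise_Un[of ?R "?R' - ?R" ?m l] sub(1) by (simp add: Un_absorb1 finite_subset)
        moreover have "noise ?R ?m = noise ?R \<omega>"
          unfolding f using sub by (intro noise_mix_disjoint) auto
        moreover have "noise (?R' - ?R) ?m = noise (?R' - ?R) \<omega>'"
          unfolding f using sub by (intro noise_mix_subset) auto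
        ultimately show ?thesis by simp
      qed
      moreover have "\<bar>noise ?R \<omega> l + noise (?R' - ?R) \<omega>' l\<bar> \<le> 2 * \<epsilon>" if "\<bar>noise (?R' - ?R) \<omega>' l\<bar> \<le> \<epsilon>" for l
        using smallR[of l] that by linarith
      ultimately show "small \<epsilon> (noise (?R' - ?R) \<omega>') \<le> hit (2 * \<epsilon>) (i', j', k') ?m"
        by (auto simp: hit_def small_def)
    qed
    finally show ?thesis by (simp add: resample_def)
  qed
  let ?G = "\<lambda>q. case q of (i', j', k') \<Rightarrow> (1 / sqrt (gap i j k i' j' k' + \<epsilon>\<^sup>2)) ^ ?d"
  have G: "0 \<le> ?G q" for q using gap_nonneg by (auto split: prod.split)
  have "(1 / (4 * sqrt K)) ^ ?d * (\<Sum>i'\<in>{i..n}. p i' * kern \<bar>x i - x i'\<bar>)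
      = (\<Sum>q\<in>Q. weight p q * ((\<epsilon> / (4 * sqrt K)) ^ ?d * ?G q))"
  proof -
    have kern: "(\<Sum>j'\<in>{j..<j + N}. \<Sum>k'\<in>{k..<k + N}. ?G (i', j', k')) = (real N)\<^sup>2 * kern \<bar>x i - x i'\<bar>" for i'
    proof -
      have "(\<Sum>j'\<in>{j..<j + N}. \<Sum>k'\<in>{k..<k + N}. ?G (i', j', k')) = (\<Sum>m<N. \<Sum>m'<N. ?G (i', m + j, m' + k))"
        by (rule sum.reindex_bij_witness[of _ "\<lambda>m. m + j" "\<lambda>m. m - j"], auto intro!: sum.reindex_bij_witness[of _ "\<lambda>m. m - k" "\<lambda>m. m + k"])
      also have "\<dots> = (\<Sum>m<N. \<Sum>m'<N. (1 / sqrt (\<bar>x i - x i'\<bar> + (real m + real m') * h + \<epsilon>\<^sup>2)) ^ ?d)"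
        by (simp add: gap_def absdiff_def)
      finally show ?thesis using N_pos by (simp add: kern_def grid_kernel_def)
    qed
    have "(\<Sum>q\<in>Q. weight p q * ((\<epsilon> / (4 * sqrt K)) ^ ?d * ?G q))
        = (\<Sum>i'\<in>{i..n}. \<Sum>j'\<in>{j..<j + N}. \<Sum>k'\<in>{k..<k + N}. p i' / ((real N)\<^sup>2 * \<epsilon> ^ ?d) * (\<epsilon> / (4 * sqrt K)) ^ ?d * ?G (i', j', k'))"
      unfolding Q_def sum_triple by (simp add: weight_def mult.assoc)
    also have "\<dots> = (\<Sum>i'\<in>{i..n}. p i' / ((real N)\<^sup>2 * \<epsilon> ^ ?d) * (\<epsilon> / (4 * sqrt K)) ^ ?d * ((real N)\<^sup>2 * kern \<bar>x i - x i'\<bar>))"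
      unfolding sum_distrib_left[symmetric] kern ..
    also have "\<dots> = (\<Sum>i'\<in>{i..n}. (1 / (4 * sqrt K)) ^ ?d * (p i' * kern \<bar>x i - x i'\<bar>))"
      using N_pos \<epsilon>_pos by (intro sum.cong refl) (simp add: power_divide)
    finally show ?thesis by (simp add: sum_distrib_left)
  qed
  then have "ennreal ((1 / (4 * sqrt K)) ^ ?d * (\<Sum>i'\<in>{i..n}. p i' * kern \<bar>x i - x i'\<bar>))
      = (\<Sum>q\<in>Q. ennreal (weight p q) * ennreal ((\<epsilon> / (4 * sqrt K)) ^ ?d * ?G q))"
    using w G \<epsilon>_pos K by (simp add: ennreal_mult[symmetric] flip: sum_ennreal)
  also have "\<dots> \<le> (\<Sum>q\<in>Q. ennreal (weight p q) * resample (future (i, j, k)) (hit (2 * \<epsilon>) q) \<omega>)"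
    using one by (intro sum_mono mult_left_mono) auto
  also have "\<dots> \<le> (\<Sum>q\<in>slots (2 * N). ennreal (weight p q) * resample (future (i, j, k)) (hit (2 * \<epsilon>) q) \<omega>)"
    using Q by (intro sum_mono2) auto
  also have "\<dots> = (\<Sum>q\<in>slots (2 * N). resample (future (i, j, k)) (\<lambda>\<omega>. ennreal (weight p q) * hit (2 * \<epsilon>) q \<omega>) \<omega>)"
    by (intro sum.cong refl resample_cmult[symmetric] measurable_hit \<omega>)
  also have "\<dots> = resample (future (i, j, k)) (occupation p) \<omega>"
    unfolding occupation_def[abs_def]
    by (intro resample_sum[symmetric] borel_measurable_times_ennreal measurable_hit borel_measurable_const \<omega>)
  finally show ?thesis .
qed

text \<open>\<open>p\<close> is the law of the first index of a hit selected on \<open>H\<close>.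
  The events \<open>A q\<close> partition \<open>H\<close> and each forces a hit at
  \<open>q\<close>; nothing else is asked of the selection. As \<open>A q\<close> need not be
  determined by the noise of its rectangle, the conditional expectation is moved from the occupation
  onto the indicator of \<open>A q\<close>, and the dual inequality bounds the sum of these.\<close>

lemma prob_hit_le:
  fixes H
  defines "H \<equiv> {\<omega>\<in>space noise_space. \<exists>q\<in>slots N. hit \<epsilon> q \<omega> \<noteq> 0}"
  assumes K: "g + 4 * real N * h \<le> K" "s1 \<le> K" "1 \<le> K" and H_pos: "0 < measure noise_space H"
  obtains p where "\<And>i. 0 \<le> p i" "(\<Sum>i\<in>{1..n}. p i) = 1"
    "measure noise_space H * grid_energy p \<le> 16384 * pair_const ^ CARD('d) * ((4 * sqrt K) ^ CARD('d))\<^sup>2"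
proof -
  let ?d = "CARD('d)" and ?S = "slots N"
  \<comment> \<open>The selected hit is the least one in the enumeration by \<open>to_nat\<close>,
    an arbitrary total order on triples.\<close>
  define A where "A q = {\<omega>\<in>space noise_space. hit \<epsilon> q \<omega> \<noteq> 0 \<and> (\<forall>q'\<in>?S. to_nat q' < to_nat q \<longrightarrow> hit \<epsilon> q' \<omega> = 0)}" for q
  have hm[measurable]: "hit \<epsilon> q \<in> borel_measurable noise_space" if "q \<in> ?S" for q
    using that slots_mono by (intro measurable_hit) auto
  have A[measurable]: "A q \<in> sets noise_space" if "q \<in> ?S" for q
  proof -
    have "{\<omega>\<in>space noise_space. \<forall>q'\<in>?S. to_nat q' < to_nat q \<longrightarrow> hit \<epsilon> q' \<omega> = 0} \<in> sets noise_space"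
    proof (rule sets.sets_Collect_finite_All)
      show "{\<omega> \<in> space noise_space. to_nat q' < to_nat q \<longrightarrow> hit \<epsilon> q' \<omega> = 0} \<in> sets noise_space" if "q' \<in> ?S" for q'
        using hm[OF that, measurable] by measurable
    qed auto
    moreover have "{\<omega>\<in>space noise_space. hit \<epsilon> q \<omega> \<noteq> 0} \<in> sets noise_space"
      using hm[OF that, measurable] by measurable
    ultimately have "{\<omega>\<in>space noise_space. hit \<epsilon> q \<omega> \<noteq> 0} \<inter> {\<omega>\<in>space noise_space. \<forall>q'\<in>?S. to_nat q' < to_nat q \<longrightarrow> hit \<epsilon> q' \<omega> = 0} \<in> sets noise_space"
      by (rule sets.Int[rotated])
    also have "{\<omega>\<in>space noise_space. hit \<epsilon> q \<omega> \<noteq> 0} \<inter> {\<omega>\<in>space noise_space. \<forall>q'\<in>?S. to_nat q' < to_nat q \<longrightarrow> hit \<epsilon> q' \<omega> = 0} = A q"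
      by (auto simp: A_def)
    finally show ?thesis .
  qed
  have H[measurable]: "H \<in> sets noise_space"
    unfolding H_def
  proof (rule sets.sets_Collect_finite_Ex)
    show "{\<omega> \<in> space noise_space. hit \<epsilon> q \<omega> \<noteq> 0} \<in> sets noise_space" if "q \<in> ?S" for q
      using hm[OF that, measurable] by measurable
  qed auto
  have sumA: "(\<Sum>q\<in>?S. indicator (A q) \<omega>) = (indicator H \<omega> :: ennreal)" if "\<omega> \<in> space noise_space" for \<omega>
  proof (cases "\<omega> \<in> H")
    case True
    then obtain q1 where "q1 \<in> ?S \<and> hit \<epsilon> q1 \<omega> \<noteq> 0" unfolding H_def by blast
    from ex_has_least_nat[of "\<lambda>q. q \<in> ?S \<and> hit \<epsilon> q \<omega> \<noteq> 0", OF this, of to_nat] obtain q0 where q0: "q0 \<in> ?S" "hit \<epsilon> q0 \<omega> \<noteq> 0"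
      "\<And>q. q \<in> ?S \<Longrightarrow> hit \<epsilon> q \<omega> \<noteq> 0 \<Longrightarrow> to_nat q0 \<le> to_nat q" by blast
    have "indicator (A q) \<omega> = (if q = q0 then 1 else 0 :: ennreal)" if "q \<in> ?S" for q
    proof (cases "q = q0")
      case True
      then have "\<omega> \<in> A q" using q0 \<open>\<omega> \<in> space noise_space\<close> by (force simp: A_def)
      then show ?thesis using True by simp
    next
      case False
      have "\<omega> \<notin> A q"
      proof
        assume "\<omega> \<in> A q"
        then have "hit \<epsilon> q \<omega> \<noteq> 0" "\<not> to_nat q0 < to_nat q" using q0 by (auto simp: A_def)
        then have "to_nat q0 = to_nat q" using q0(3)[OF that] by simp
        then show False using False by simp
      qed
      then show ?thesis using False by simp
    qed
    then have "(\<Sum>q\<in>?S. indicator (A q) \<omega>) = (\<Sum>q\<in>?S. if q = q0 then 1 else 0 :: ennreal)"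
      by (intro sum.cong) auto
    also have "\<dots> = 1" using q0(1) by (subst sum.delta) auto
    finally show ?thesis using True by simp
  next
    case False
    then have "\<omega> \<notin> A q" if "q \<in> ?S" for q using that by (auto simp: A_def H_def)
    then show ?thesis using False by (auto intro!: sum.neutral)
  qed
  define P where "P = measure noise_space H"
  have P: "0 < P" using H_pos by (simp add: P_def)
  have sum_meas: "(\<Sum>q\<in>?S. measure noise_space (A q)) = P"
  proof -
    have "ennreal P = (\<integral>\<^sup>+\<omega>. indicator H \<omega> \<partial>noise_space)" by (simp add: P_def P.emeasure_eq_measure)
    also have "\<dots> = (\<integral>\<^sup>+\<omega>. (\<Sum>q\<in>?S. indicator (A q) \<omega>) \<partial>noise_space)"
      by (rule nn_integral_cong) (rule sumA[symmetric])
    also have "\<dots> = (\<Sum>q\<in>?S. \<integral>\<^sup>+\<omega>. indicator (A q) \<omega> \<partial>noise_space)"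
      by (intro nn_integral_sum) simp
    also have "\<dots> = (\<Sum>q\<in>?S. ennreal (measure noise_space (A q)))"
      by (intro sum.cong refl) (simp add: P.emeasure_eq_measure)
    also have "\<dots> = ennreal (\<Sum>q\<in>?S. measure noise_space (A q))" by (rule sum_ennreal) simp
    finally show ?thesis using P by (subst (asm) ennreal_inj) (auto intro: sum_nonneg)
  qed
  define p where "p i = (\<Sum>j<N. \<Sum>k<N. measure noise_space (A (i, j, k))) / P" for i
  have p0: "0 \<le> p i" for i unfolding p_def using P by (auto intro!: divide_nonneg_pos sum_nonneg)
  have p1: "(\<Sum>i\<in>{1..n}. p i) = 1"
    using sum_meas P unfolding p_def sum_triple by (simp flip: sum_divide_distrib)
  define E where "E = grid_energy p"
  define c where "c = (1 / (4 * sqrt K)) ^ ?d"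
  have c: "0 < c" using K by (simp add: c_def)
  have kern: "0 < kern \<bar>r\<bar>" for r by (simp add: kern_pos)
  then have kern0: "0 \<le> kern \<bar>r\<bar>" for r by (rule less_imp_le)
  \<comment> \<open>The one-sided potential, over indices from \<open>i\<close> upwards. By symmetry
    of the kernel the two one-sided sums together dominate the energy, the diagonal being counted
    twice.\<close>
  define L where "L i = (\<Sum>i'\<in>{i..n}. p i' * kern \<bar>x i - x i'\<bar>)" for i
  have L: "0 \<le> L i" for i unfolding L_def by (intro sum_nonneg mult_nonneg_nonneg p0 kern0)
  have E_le: "E \<le> 2 * (\<Sum>i\<in>{1..n}. p i * L i)"
  proof -
    let ?f = "\<lambda>i i'. p i * p i' * kern \<bar>x i - x i'\<bar>"
    have f0: "0 \<le> ?f i i'" for i i' by (intro mult_nonneg_nonneg p0 kern0)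
    have "E \<le> (\<Sum>i\<in>{1..n}. \<Sum>i'\<in>{1..n}. (if i \<le> i' then ?f i i' else 0) + (if i' \<le> i then ?f i i' else 0))"
      unfolding E_def grid_energy_def
    proof (intro sum_mono)
      show "?f i i' \<le> (if i \<le> i' then ?f i i' else 0) + (if i' \<le> i then ?f i i' else 0)" for i i'
        by (cases "i \<le> i'"; cases "i' \<le> i") (use f0[of i i'] in simp_all)
    qed
    also have "\<dots> = (\<Sum>i\<in>{1..n}. \<Sum>i'\<in>{1..n}. if i \<le> i' then ?f i i' else 0) + (\<Sum>i\<in>{1..n}. \<Sum>i'\<in>{1..n}. if i' \<le> i then ?f i i' else 0)"
      by (simp add: sum.distrib)
    also have "(\<Sum>i\<in>{1..n}. \<Sum>i'\<in>{1..n}. if i' \<le> i then ?f i i' else 0) = (\<Sum>i\<in>{1..n}. \<Sum>i'\<in>{1..n}. if i \<le> i' then ?f i i' else 0)"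
      by (subst sum.swap, intro sum.cong refl) (simp add: abs_minus_commute mult.commute)
    also have "(\<Sum>i\<in>{1..n}. \<Sum>i'\<in>{1..n}. if i \<le> i' then ?f i i' else 0) = (\<Sum>i\<in>{1..n}. p i * L i)"
    proof (intro sum.cong refl)
      fix i assume "i \<in> {1..n}"
      then have "{i'\<in>{1..n}. i \<le> i'} = {i..n}" by auto
      then have "(\<Sum>i'\<in>{1..n}. if i \<le> i' then ?f i i' else 0) = (\<Sum>i'\<in>{i..n}. ?f i i')"
        by (simp flip: sum.inter_filter)
      then show "(\<Sum>i'\<in>{1..n}. if i \<le> i' then ?f i i' else 0) = p i * L i"
        by (simp add: L_def sum_distrib_left mult.assoc)
    qed
    finally show ?thesis by simp
  qed
  \<comment> \<open>Positivity makes it legitimate to cancel a factor \<open>P * E\<close> at the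
    end.\<close>
  have E_pos: "0 < E"
  proof -
    obtain i where i: "i \<in> {1..n}" "p i \<noteq> 0" using p1 by (metis sum.neutral zero_neq_one)
    have "0 < p i * p i * kern \<bar>x i - x i\<bar>" using i p0[of i] kern[of "x i - x i"] by (simp add: zero_less_mult_iff)
    also have "\<dots> \<le> (\<Sum>i'\<in>{1..n}. p i * p i' * kern \<bar>x i - x i'\<bar>)"
      using i by (intro member_le_sum[of i "{1..n}" "\<lambda>i'. p i * p i' * kern \<bar>x i - x i'\<bar>"] mult_nonneg_nonneg p0 kern0) auto
    also have "\<dots> \<le> E"
      unfolding E_def grid_energy_def using i
      by (intro member_le_sum[of i "{1..n}" "\<lambda>i. \<Sum>i'\<in>{1..n}. p i * p i' * kern \<bar>x i - x i'\<bar>"] sum_nonneg mult_nonneg_nonneg p0 kern0) auto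
    finally show ?thesis .
  qed
  let ?B = "\<lambda>\<omega>. \<Sum>q\<in>?S. resample (future q) (indicator (A q)) \<omega>"
  have rm[measurable]: "resample (future q) (indicator (A q)) \<in> borel_measurable noise_space" if "q \<in> ?S" for q
    by (rule borel_measurable_resample) (use A[OF that] in simp)
  have B2: "(\<integral>\<^sup>+\<omega>. (?B \<omega>)\<^sup>2 \<partial>noise_space) \<le> 64 * ennreal P"
  proof -
    \<comment> \<open>Outside the slots the event is replaced by the empty set, as
      \<open>cairoli_dual\<close> asks for measurability at all indices.\<close>
    define G where "G i j k = (indicator (if (i, j, k) \<in> ?S then A (i, j, k) else {}) :: _ \<Rightarrow> ennreal)" for i j k
    have GA: "G i j k = indicator (A (i, j, k))" if "i \<in> {1..n}" "j \<in> {..<N}" "k \<in> {..<N}" for i j k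
      using that by (simp add: G_def)
    have "(\<integral>\<^sup>+\<omega>. (?B \<omega>)\<^sup>2 \<partial>noise_space) = (\<integral>\<^sup>+\<omega>. (\<Sum>i\<in>{1..n}. \<Sum>j\<in>{..<N}. \<Sum>k\<in>{..<N}.
        resample ({c\<in>cells. i < fst c} \<times> UNIV \<union> {c\<in>cells. snd c < - int j} \<times> UNIV \<union> {c\<in>cells. int k < snd c} \<times> UNIV) (G i j k) \<omega>)\<^sup>2 \<partial>noise_space)"
      unfolding sum_triple by (intro nn_integral_cong arg_cong[where f="\<lambda>x. x\<^sup>2"] sum.cong refl) (simp add: GA future_def)
    also have "\<dots> \<le> 64 * (\<integral>\<^sup>+\<omega>. (\<Sum>i\<in>{1..n}. \<Sum>j\<in>{..<N}. \<Sum>k\<in>{..<N}. G i j k \<omega>)\<^sup>2 \<partial>noise_space)"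
    proof (rule cairoli_dual[where c=1])
      show "G i j k \<in> borel_measurable noise_space" for i j k
        unfolding G_def using A[of "(i, j, k)"] by (cases "(i, j, k) \<in> ?S") auto
      show "G i j k \<omega> \<le> 1" for i j k \<omega> unfolding G_def by (simp add: indicator_def)
    qed auto
    \<comment> \<open>The indicators add up to that of \<open>H\<close>, which equals its own
      square: disjointness turns the second moment into \<open>P\<close>.\<close>
    also have "(\<integral>\<^sup>+\<omega>. (\<Sum>i\<in>{1..n}. \<Sum>j\<in>{..<N}. \<Sum>k\<in>{..<N}. G i j k \<omega>)\<^sup>2 \<partial>noise_space) = (\<integral>\<^sup>+\<omega>. indicator H \<omega> \<partial>noise_space)"
    proof (rule nn_integral_cong)
      fix \<omega> assume "\<omega> \<in> space noise_space"
      have "(\<Sum>i\<in>{1..n}. \<Sum>j\<in>{..<N}. \<Sum>k\<in>{..<N}. G i j k \<omega>) = (\<Sum>q\<in>?S. indicator (A q) \<omega>)"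
        unfolding sum_triple by (intro sum.cong refl) (simp add: GA)
      then show "(\<Sum>i\<in>{1..n}. \<Sum>j\<in>{..<N}. \<Sum>k\<in>{..<N}. G i j k \<omega>)\<^sup>2 = indicator H \<omega>"
        using sumA[OF \<open>\<omega> \<in> space noise_space\<close>] by (simp add: indicator_def)
    qed
    also have "\<dots> = ennreal P" by (simp add: P_def P.emeasure_eq_measure)
    finally show ?thesis .
  qed
  have "ennreal (c * P * (\<Sum>i\<in>{1..n}. p i * L i)) = (\<Sum>q\<in>?S. ennreal (measure noise_space (A q)) * ennreal (c * L (fst q)))"
  proof -
    have "c * P * (\<Sum>i\<in>{1..n}. p i * L i) = (\<Sum>q\<in>?S. measure noise_space (A q) * (c * L (fst q)))"
    proof -
      have Pp: "P * p i = (\<Sum>j<N. \<Sum>k<N. measure noise_space (A (i, j, k)))" for i using P by (simp add: p_def)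
      have "c * P * (\<Sum>i\<in>{1..n}. p i * L i) = (\<Sum>i\<in>{1..n}. (P * p i) * (c * L i))"
        unfolding sum_distrib_left by (intro sum.cong refl) (simp only: mult_ac)
      then show ?thesis unfolding Pp sum_triple sum_distrib_right by simp
    qed
    then show ?thesis using c L by (simp add: ennreal_mult[symmetric] flip: sum_ennreal)
  qed
  also have "\<dots> = (\<Sum>q\<in>?S. \<integral>\<^sup>+\<omega>. indicator (A q) \<omega> * ennreal (c * L (fst q)) \<partial>noise_space)"
    by (intro sum.cong refl) (simp add: nn_integral_multc P.emeasure_eq_measure)
  also have "\<dots> \<le> (\<Sum>q\<in>?S. \<integral>\<^sup>+\<omega>. indicator (A q) \<omega> * resample (future q) (occupation p) \<omega> \<partial>noise_space)"
  proof (intro sum_mono nn_integral_mono)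
    fix q \<omega> assume q: "q \<in> ?S" and \<omega>: "\<omega> \<in> space noise_space"
    obtain i j k where q': "q = (i, j, k)" by (cases q)
    show "indicator (A q) \<omega> * ennreal (c * L (fst q)) \<le> indicator (A q) \<omega> * resample (future q) (occupation p) \<omega>"
    proof (cases "\<omega> \<in> A q")
      case True
      then have "hit \<epsilon> (i, j, k) \<omega> \<noteq> 0" by (simp add: A_def q')
      from resample_occupation_ge[OF p0 q[unfolded q'] this \<omega> K] True
      show ?thesis by (simp add: c_def L_def q')
    qed simp
  qed
  \<comment> \<open>Self-adjointness moves the resampling onto the indicator of
    \<open>A q\<close>.\<close>
  also have "\<dots> = (\<Sum>q\<in>?S. \<integral>\<^sup>+\<omega>. resample (future q) (indicator (A q)) \<omega> * occupation p \<omega> \<partial>noise_space)"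
    by (intro sum.cong refl resample_self_adjoint[symmetric]) auto
  also have "\<dots> = (\<integral>\<^sup>+\<omega>. ?B \<omega> * occupation p \<omega> \<partial>noise_space)"
    unfolding sum_distrib_right by (intro nn_integral_sum[symmetric]) simp
  finally have T: "ennreal (c * P * (\<Sum>i\<in>{1..n}. p i * L i)) \<le> (\<integral>\<^sup>+\<omega>. ?B \<omega> * occupation p \<omega> \<partial>noise_space)" .
  have fin: "(\<integral>\<^sup>+\<omega>. (?B \<omega>)\<^sup>2 \<partial>noise_space) < \<top>" "(\<integral>\<^sup>+\<omega>. (occupation p \<omega>)\<^sup>2 \<partial>noise_space) < \<top>"
    by (rule le_less_trans[OF B2], simp add: ennreal_mult_less_top) (rule le_less_trans[OF second_moment[OF p0]], simp)
  have "(ennreal (c * P * (\<Sum>i\<in>{1..n}. p i * L i)))\<^sup>2 \<le> (\<integral>\<^sup>+\<omega>. ?B \<omega> * occupation p \<omega> \<partial>noise_space)\<^sup>2"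
    using T by (intro power_mono) auto
  also have "\<dots> \<le> (\<integral>\<^sup>+\<omega>. (?B \<omega>)\<^sup>2 \<partial>noise_space) * (\<integral>\<^sup>+\<omega>. (occupation p \<omega>)\<^sup>2 \<partial>noise_space)"
    by (intro nn_integral_Cauchy_Schwarz fin) (auto intro!: borel_measurable_sum rm)
  also have "\<dots> \<le> (64 * ennreal P) * ennreal (64 * pair_const ^ ?d * E)"
    unfolding E_def by (intro mult_mono B2 second_moment p0) auto
  \<comment> \<open>64 from the dual inequality times 64 from the second moment; bounding by half
    the energy below contributes another 4, whence 16384.\<close>
  also have "\<dots> = ennreal (4096 * (P * (pair_const ^ ?d * E)))"
    using P pair_const_pos E_pos by (simp add: ennreal_mult mult.assoc mult.left_commute)
  finally have "ennreal ((c * P * (\<Sum>i\<in>{1..n}. p i * L i))\<^sup>2) \<le> ennreal (4096 * (P * (pair_const ^ ?d * E)))"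
    using c P p0 L by (subst ennreal_power[symmetric]) (auto intro!: mult_nonneg_nonneg sum_nonneg)
  then have "(c * P * (\<Sum>i\<in>{1..n}. p i * L i))\<^sup>2 \<le> 4096 * (P * (pair_const ^ ?d * E))"
    using P pair_const_pos E_pos by (subst (asm) ennreal_le_iff) auto
  moreover have "(c * P * (E / 2))\<^sup>2 \<le> (c * P * (\<Sum>i\<in>{1..n}. p i * L i))\<^sup>2"
    using c P E_le E_pos by (intro power_mono mult_left_mono) auto
  ultimately have "(c * P * (E / 2))\<^sup>2 \<le> 4096 * (P * (pair_const ^ ?d * E))" by simp
  then have "(P * E) * (c\<^sup>2 * (P * E)) \<le> (P * E) * (16384 * pair_const ^ ?d)"
    by (simp add: power2_eq_square algebra_simps)
  then have "c\<^sup>2 * (P * E) \<le> 16384 * pair_const ^ ?d"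
    using P E_pos by (subst (asm) mult_le_cancel_left_pos) auto
  moreover define D where "D = (4 * sqrt K) ^ ?d"
  moreover have "D\<^sup>2 * c\<^sup>2 = 1"
  proof -
    have "0 < D" using K by (simp add: D_def)
    moreover have "c = 1 / D" unfolding c_def D_def power_divide by simp
    ultimately show ?thesis by (simp add: power_divide)
  qed
  ultimately have "D\<^sup>2 * (c\<^sup>2 * (P * E)) \<le> D\<^sup>2 * (16384 * pair_const ^ ?d)"
    by (intro mult_left_mono) auto
  also have "D\<^sup>2 * (c\<^sup>2 * (P * E)) = P * E"
    unfolding mult.assoc[symmetric] \<open>D\<^sup>2 * c\<^sup>2 = 1\<close> by simp
  finally have "P * E \<le> 16384 * pair_const ^ ?d * ((4 * sqrt K) ^ ?d)\<^sup>2"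
    unfolding D_def by (simp only: mult.commute)
  then show ?thesis using that[OF p0 p1] by (simp add: P_def E_def)
qed

end

subsection \<open>The increments of the sheet on a grid\<close>

lemma brownian_sheet_lincomb:
  fixes B :: "real \<times> real \<Rightarrow> 'a \<Rightarrow> real ^ 'd"
  assumes B: "brownian_sheet M B" and K: "finite K"
    and st: "\<And>k. k \<in> K \<Longrightarrow> 0 \<le> s k" "\<And>k. k \<in> K \<Longrightarrow> 0 \<le> t k"
  shows "centered_gaussian_rv M (\<lambda>\<omega>. \<Sum>k\<in>K. a k * (B (s k, t k) \<omega> $ i k))
    (\<Sum>k\<in>K. \<Sum>k'\<in>K. a k * a k' * (min (s k) (s k') * min (t k) (t k') * (if i k = i k' then 1 else 0)))"
proof -
  obtain ks where ks: "distinct ks" "set ks = K" using finite_distinct_list[OF K] by auto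
  let ?xs = "map (\<lambda>k. (s k, t k, i k, a k)) ks"
  have list: "\<And>xs :: (real \<times> real \<times> 'd \<times> real) list.
        (\<forall>(s, t, i, c) \<in> set xs. 0 \<le> s \<and> 0 \<le> t) \<Longrightarrow>
        centered_gaussian_rv M
          (\<lambda>\<omega>. \<Sum>(s, t, i, c) \<leftarrow> xs. c * (B (s, t) \<omega> $ i))
          (\<Sum>(s, t, i, c) \<leftarrow> xs. \<Sum>(u, v, j, e) \<leftarrow> xs.
              c * e * (min s u * min t v * (if i = j then 1 else 0)))"
    using B unfolding brownian_sheet_def by blast
  have "\<forall>(s, t, i, c) \<in> set ?xs. 0 \<le> s \<and> 0 \<le> t" using st ks by auto
  from list[OF this] show ?thesis
    using ks by (simp add: comp_def sum_list_distinct_conv_sum_set)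
qed

text \<open>\<open>min\<close> is the covariance of Brownian motion, and its mixed difference over
  two intervals is the length of their intersection, here 0.\<close>

lemma min_increment_disjoint:
  fixes a b a' b' :: real
  assumes "a \<le> b" "a' \<le> b'" "b \<le> a' \<or> b' \<le> a"
  shows "min b b' - min a b' - min b a' + min a a' = 0"
  using assms by (auto simp: min_def)

text \<open>\<open>b_ge\<close> keeps the lowest line b - 2 N h of the doubled grid at a nonnegative
  time.\<close>

locale sheet_grid = grid_noise n N x "c - b" h s0 s1 \<epsilon> dim
  for n N x b c h s0 s1 \<epsilon> and dim :: "'d::finite itself" +
  fixes M :: "'a measure" and B :: "real \<times> real \<Rightarrow> 'a \<Rightarrow> real ^ 'd"
  assumes sheet: "brownian_sheet M B" and b_ge: "2 * real N * h \<le> b"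
begin

text \<open>The upper end of row \<open>m\<close>. Row 0 is the gap from \<open>b\<close> to
  \<open>c\<close>, so \<open>mesh (- 1) = b\<close>, and the lines below are shifted by one:
  \<open>mesh (- j - 1) = b - j * h\<close>.\<close>

definition mesh :: "int \<Rightarrow> real" where
  "mesh m = (if 0 \<le> m then c + real_of_int m * h else b + real_of_int (m + 1) * h)"

lemma mesh_diff: "mesh m - mesh (m - 1) = height m"
  by (auto simp: mesh_def height_def algebra_simps)

lemma mesh_nonneg:
  assumes "- int (2 * N) - 1 \<le> m"
  shows "0 \<le> mesh m"
proof (cases "0 \<le> m")
  case True
  have "0 \<le> b" using b_ge h_pos by (smt (verit) mult_nonneg_nonneg of_nat_0_le_iff)
  then show ?thesis using True g_pos h_pos by (simp add: mesh_def)
next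
  case False
  have "real_of_int (- int (2 * N)) * h \<le> real_of_int (m + 1) * h"
    using assms h_pos by (intro mult_right_mono) linarith+
  then show ?thesis using False b_ge by (simp add: mesh_def)
qed

lemma mesh_mono: "m \<le> m' \<Longrightarrow> mesh m \<le> mesh m'"
proof (induction m' rule: int_ge_induct)
  case (step m')
  then show ?case using mesh_diff[of "m' + 1"] height_pos[of "m' + 1"] by simp
qed simp

text \<open>Set to 0 on the axis, where the sheet vanishes only almost surely, so that
  \<open>noise_cell_incr\<close> telescopes at every sample point.\<close>

definition path :: "nat \<Rightarrow> int \<Rightarrow> 'd \<Rightarrow> 'a \<Rightarrow> real" where
  "path i m l \<omega> = (if i = 0 then 0 else B (x i, mesh m) \<omega> $ l)"

definition cell_incr :: "(nat \<times> int) \<times> 'd \<Rightarrow> 'a \<Rightarrow> real" where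
  "cell_incr k \<omega> = (case k of ((i, m), l) \<Rightarrow>
     path i m l \<omega> - path (i - 1) m l \<omega> - path i (m - 1) l \<omega> + path (i - 1) (m - 1) l \<omega>)"

lemma x_nonneg: "i \<le> n \<Longrightarrow> 0 \<le> x i"
  using x_mono[of 0 i] x_0 by simp

lemma measurable_path:
  assumes "i \<le> n" "- int (2 * N) - 1 \<le> m"
  shows "path i m l \<in> borel_measurable M"
proof -
  have [measurable]: "B (x i, mesh m) \<in> borel_measurable M"
    using sheet x_nonneg[OF assms(1)] mesh_nonneg[OF assms(2)] by (auto simp: brownian_sheet_def)
  show ?thesis unfolding path_def[abs_def] by (cases "i = 0") (auto intro: measurable_compose[OF _ borel_measurable_nth])
qed

lemma measurable_cell_incr: "k \<in> cells \<times> UNIV \<Longrightarrow> cell_incr k \<in> borel_measurable M"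
  unfolding cell_incr_def[abs_def]
  by (cases k) (auto simp: cells_def intro!: borel_measurable_add borel_measurable_diff measurable_path)

text \<open>The corners with index 0 carry coefficient 0 instead of the almost surely vanishing value of the sheet
  on the axis; this does not change the covariances, because x 0 = 0.\<close>

lemma gaussian_cell_incr:
  "centered_gaussian_rv M (\<lambda>\<omega>. \<Sum>k\<in>cells \<times> UNIV. \<theta> k * cell_incr k \<omega>) (\<Sum>k\<in>cells \<times> UNIV. (\<theta> k)\<^sup>2 * area (fst k))"
proof -
  let ?C = "cells \<times> (UNIV :: 'd set)"
  \<comment> \<open>The two booleans choose a corner of the cell, \<open>True\<close> for the upper
    and \<open>False\<close> for the lower index; the signs in \<open>a\<close> are those of a
    rectangular increment.\<close>
  define K where "K = ?C \<times> (UNIV :: (bool \<times> bool) set)"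
  have fK: "finite K" "finite ?C" using finite_cells by (auto simp: K_def)
  define ix where "ix k = (case k of (((i, m), l), (u, v)) \<Rightarrow> if u then i else i - 1)" for k :: "((nat \<times> int) \<times> 'd) \<times> bool \<times> bool"
  define tm where "tm k = (case k of (((i, m), l), (u, v)) \<Rightarrow> if v then m else m - 1)" for k :: "((nat \<times> int) \<times> 'd) \<times> bool \<times> bool"
  define a where "a k = (case k of (k0, (u, v)) \<Rightarrow> \<theta> k0 * ((if u then 1 else -1) * (if v then 1 else -1)) * (if ix k = 0 then 0 else 1))" for k
  have gauss: "centered_gaussian_rv M (\<lambda>\<omega>. \<Sum>k\<in>K. a k * (B (x (ix k), mesh (tm k)) \<omega> $ snd (fst k)))
    (\<Sum>k\<in>K. \<Sum>k'\<in>K. a k * a k' * (min (x (ix k)) (x (ix k')) * min (mesh (tm k)) (mesh (tm k')) * (if snd (fst k) = snd (fst k') then 1 else 0)))"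
    by (rule brownian_sheet_lincomb[OF sheet fK(1)])
       (auto simp: K_def ix_def tm_def cells_def intro!: x_nonneg mesh_nonneg)
  have lin: "(\<Sum>k\<in>K. a k * (B (x (ix k), mesh (tm k)) \<omega> $ snd (fst k))) = (\<Sum>k\<in>?C. \<theta> k * cell_incr k \<omega>)" for \<omega>
  proof -
    have "(\<Sum>k\<in>K. a k * (B (x (ix k), mesh (tm k)) \<omega> $ snd (fst k)))
      = (\<Sum>k\<in>?C. \<Sum>u\<in>UNIV. \<Sum>v\<in>UNIV. a (k, (u, v)) * (B (x (ix (k, (u, v))), mesh (tm (k, (u, v)))) \<omega> $ snd k))"
      unfolding K_def UNIV_Times_UNIV[symmetric] sum.cartesian_product by (intro sum.cong) auto
    also have "\<dots> = (\<Sum>k\<in>?C. \<theta> k * cell_incr k \<omega>)"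
      by (intro sum.cong refl) (auto simp: UNIV_bool a_def ix_def tm_def cell_incr_def path_def algebra_simps)
    finally show ?thesis .
  qed
  have az: "a (k, (u, v)) * a (k', (u', v')) * (min (x (ix (k, (u, v)))) (x (ix (k', (u', v')))) * r)
     = \<theta> k * \<theta> k' * (((if u then 1 else -1) * (if u' then 1 else -1) * min (x (ix (k, (u, v)))) (x (ix (k', (u', v'))))) * ((if v then 1 else -1) * (if v' then 1 else -1) * r))"
    if "k \<in> ?C" "k' \<in> ?C" for k k' u v u' v' r
  proof -
    have "0 \<le> x (ix (k, (u, v)))" "0 \<le> x (ix (k', (u', v')))"
      using that by (auto simp: ix_def cells_def intro!: x_nonneg)
    then have zz: "(if ix (k, (u, v)) = 0 then 0 else 1) * (if ix (k', (u', v')) = 0 then 0 else 1) * min (x (ix (k, (u, v)))) (x (ix (k', (u', v'))))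
        = min (x (ix (k, (u, v)))) (x (ix (k', (u', v'))))"
      using x_0 by (cases "ix (k, (u, v)) = 0"; cases "ix (k', (u', v')) = 0") (simp_all add: min_def)
    have gen: "(t * (p * q) * z) * (t' * (p' * q') * z') * (m * r) = t * t' * ((p * p' * (z * z' * m)) * (q * q' * r))"
      for t p q z t' p' q' z' m :: real by (simp only: mult_ac)
    show ?thesis unfolding a_def prod.case by (rule trans[OF gen]) (simp only: zz)
  qed
  have cov: "(\<Sum>u\<in>UNIV. \<Sum>v\<in>UNIV. \<Sum>u'\<in>UNIV. \<Sum>v'\<in>UNIV. a (k, (u, v)) * a (k', (u', v')) *
      (min (x (ix (k, (u, v)))) (x (ix (k', (u', v')))) * min (mesh (tm (k, (u, v)))) (mesh (tm (k', (u', v')))) * (if snd k = snd k' then 1 else 0)))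
      = (if k = k' then (\<theta> k)\<^sup>2 * area (fst k) else 0)" if k: "k \<in> ?C" "k' \<in> ?C" for k k'
  proof -
    obtain i m l where k1: "k = ((i, m), l)" by (metis prod.exhaust)
    obtain i' m' l' where k2: "k' = ((i', m'), l')" by (metis prod.exhaust)
    have rng: "1 \<le> i" "i \<le> n" "1 \<le> i'" "i' \<le> n" using k by (auto simp: k1 k2 cells_def)
    \<comment> \<open>The covariance is a product, so the sixteen corner terms factor into mixed
      differences \<open>S\<close> in the first and \<open>T\<close> in the second variable; for
      different cells with the same coordinate one of these vanishes.\<close>
    define S where "S = min (x i) (x i') - min (x (i - 1)) (x i') - min (x i) (x (i' - 1)) + min (x (i - 1)) (x (i' - 1))"
    define T where "T = min (mesh m) (mesh m') - min (mesh (m - 1)) (mesh m') - min (mesh m) (mesh (m' - 1)) + min (mesh (m - 1)) (mesh (m' - 1))"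
    have "(\<Sum>u\<in>UNIV. \<Sum>v\<in>UNIV. \<Sum>u'\<in>UNIV. \<Sum>v'\<in>UNIV. a (k, (u, v)) * a (k', (u', v')) *
      (min (x (ix (k, (u, v)))) (x (ix (k', (u', v')))) * min (mesh (tm (k, (u, v)))) (mesh (tm (k', (u', v')))) * (if snd k = snd k' then 1 else 0)))
      = \<theta> k * \<theta> k' * (S * T * (if l = l' then 1 else 0))"
      unfolding mult.assoc[of "min _ _"] az[OF k] sum_distrib_left[symmetric]
      by (simp add: UNIV_bool k1 k2 ix_def tm_def S_def T_def algebra_simps)
    also have "\<dots> = (if k = k' then (\<theta> k)\<^sup>2 * area (fst k) else 0)"
    proof (cases "k = k'")
      case True
      have "S = x i - x (i - 1)" "T = height m"
        using True rng x_mono[of "i - 1" i] mesh_mono[of "m - 1" m] mesh_diff[of m] by (auto simp: S_def T_def k1 k2)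
      then show ?thesis using True k by (auto simp: k1 k2 area_def power2_eq_square)
    next
      case False
      have "l \<noteq> l' \<or> S = 0 \<or> T = 0"
      proof (cases "i = i'")
        case True
        show ?thesis
        proof (cases "m = m'")
          case False
          then have "mesh m \<le> mesh (m' - 1) \<or> mesh m' \<le> mesh (m - 1)"
            using mesh_mono[of m "m' - 1"] mesh_mono[of m' "m - 1"] by linarith
          then have "T = 0" unfolding T_def by (intro min_increment_disjoint mesh_mono) auto
          then show ?thesis by simp
        qed (use True \<open>k \<noteq> k'\<close> k1 k2 in auto)
      next
        case False
        then have "x i \<le> x (i' - 1) \<or> x i' \<le> x (i - 1)"
          using x_mono[of i "i' - 1"] x_mono[of i' "i - 1"] rng by linarith
        then have "S = 0" unfolding S_def using rng by (intro min_increment_disjoint x_mono) auto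
        then show ?thesis by simp
      qed
      then show ?thesis using False by auto
    qed
    finally show ?thesis .
  qed
  have var: "(\<Sum>k\<in>K. \<Sum>k'\<in>K. a k * a k' * (min (x (ix k)) (x (ix k')) * min (mesh (tm k)) (mesh (tm k')) * (if snd (fst k) = snd (fst k') then 1 else 0)))
    = (\<Sum>k\<in>?C. (\<theta> k)\<^sup>2 * area (fst k))"
  proof -
    let ?f = "\<lambda>k k'. a k * a k' * (min (x (ix k)) (x (ix k')) * min (mesh (tm k)) (mesh (tm k')) * (if snd (fst k) = snd (fst k') then 1 else 0))"
    have quad: "(\<Sum>k\<in>K. F k) = (\<Sum>k\<in>?C. \<Sum>u\<in>UNIV. \<Sum>v\<in>UNIV. F (k, (u, v)))" for F :: "_ \<Rightarrow> real"
      unfolding K_def UNIV_Times_UNIV[symmetric] sum.cartesian_product by (intro sum.cong) auto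
    have "(\<Sum>k\<in>K. \<Sum>k'\<in>K. ?f k k') = (\<Sum>k\<in>?C. \<Sum>u\<in>UNIV. \<Sum>v\<in>UNIV. \<Sum>k'\<in>?C. \<Sum>u'\<in>UNIV. \<Sum>v'\<in>UNIV. ?f (k, (u, v)) (k', (u', v')))"
      unfolding quad ..
    also have "\<dots> = (\<Sum>k\<in>?C. \<Sum>u\<in>UNIV. \<Sum>k'\<in>?C. \<Sum>v\<in>UNIV. \<Sum>u'\<in>UNIV. \<Sum>v'\<in>UNIV. ?f (k, (u, v)) (k', (u', v')))"
      by (intro sum.cong refl sum.swap)
    also have "\<dots> = (\<Sum>k\<in>?C. \<Sum>k'\<in>?C. \<Sum>u\<in>UNIV. \<Sum>v\<in>UNIV. \<Sum>u'\<in>UNIV. \<Sum>v'\<in>UNIV. ?f (k, (u, v)) (k', (u', v')))"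
      by (intro sum.cong refl sum.swap)
    also have "\<dots> = (\<Sum>k\<in>?C. \<Sum>k'\<in>?C. if k = k' then (\<theta> k)\<^sup>2 * area (fst k) else 0)"
      using cov by (intro sum.cong refl) (simp only: fst_conv)
    also have "\<dots> = (\<Sum>k\<in>?C. (\<theta> k)\<^sup>2 * area (fst k))"
      using fK(2) by (intro sum.cong refl) (simp add: sum.delta)
    finally show ?thesis .
  qed
  show ?thesis using gauss unfolding lin var .
qed

sublocale MP: prob_space M
  using sheet by (simp add: brownian_sheet_def)

text \<open>The cell increments realise the white noise exactly, so probabilities computed on
  \<open>noise_space\<close> are probabilities for the sheet.\<close>

lemma distr_cell_incr: "distr M noise_space (\<lambda>\<omega>. \<lambda>k\<in>cells \<times> UNIV. cell_incr k \<omega>) = noise_space"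
proof -
  have "distr M (\<Pi>\<^sub>M k\<in>cells \<times> UNIV. borel) (\<lambda>\<omega>. \<lambda>k\<in>cells \<times> UNIV. cell_incr k \<omega>) = noise_space"
    using finite_cells w_pos
    by (intro MP.distr_PiM_gaussian_family gaussian_cell_incr measurable_cell_incr) auto
  moreover have "sets (\<Pi>\<^sub>M k\<in>cells \<times> (UNIV::'d set). borel :: real measure) = sets noise_space"
    by (intro sets_PiM_cong) auto
  ultimately show ?thesis
    by (metis (no_types, lifting) distr_cong)
qed

text \<open>Rectangular increments telescope in both directions, and the values of
  \<open>path\<close> at index 0 contribute nothing.\<close>

lemma noise_cell_incr:
  assumes "1 \<le> i" "i \<le> n" "j \<le> 2 * N" "k \<le> 2 * N"
  shows "noise (region i j k) (\<lambda>k\<in>cells \<times> UNIV. cell_incr k \<omega>) l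
    = B (x i, c + real k * h) \<omega> $ l - B (x i, b - real j * h) \<omega> $ l"
proof -
  have sub: "region i j k \<subseteq> cells" using assms by (intro region_subset) auto
  have tele: "(\<Sum>i'\<in>{1..i}. f i' - f (i' - 1)) = f i - f 0" for f :: "nat \<Rightarrow> real"
    using sum_telescope_pred[of 0 i f] by (simp add: atLeastSucAtMost_greaterThanAtMost[symmetric])
  have "noise (region i j k) (\<lambda>k\<in>cells \<times> UNIV. cell_incr k \<omega>) l = (\<Sum>c\<in>region i j k. cell_incr (c, l) \<omega>)"
    unfolding noise_def using sub by (intro sum.cong) auto
  also have "\<dots> = (\<Sum>i'\<in>{1..i}. \<Sum>m\<in>{- int j..int k}. cell_incr ((i', m), l) \<omega>)"
    unfolding region_def by (simp add: sum.cartesian_product)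
  also have "\<dots> = (\<Sum>m\<in>{- int j..int k}. \<Sum>i'\<in>{1..i}. (path i' m l \<omega> - path i' (m - 1) l \<omega>) - (path (i' - 1) m l \<omega> - path (i' - 1) (m - 1) l \<omega>))"
    by (subst sum.swap) (simp add: cell_incr_def algebra_simps)
  also have "\<dots> = (\<Sum>m\<in>{- int j..int k}. (path i m l \<omega> - path i (m - 1) l \<omega>) - (path 0 m l \<omega> - path 0 (m - 1) l \<omega>))"
    by (intro sum.cong refl tele)
  also have "\<dots> = (\<Sum>m\<in>{- int j..int k}. path i m l \<omega> - path i (m - 1) l \<omega>)"
    by (simp add: path_def)
  also have "\<dots> = path i (int k) l \<omega> - path i (- int j - 1) l \<omega>"
    by (rule sum_int_telescope) simp
  also have "\<dots> = B (x i, c + real k * h) \<omega> $ l - B (x i, b - real j * h) \<omega> $ l"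
    using assms by (simp add: path_def mesh_def)
  finally show ?thesis .
qed

lemma prob_hit_eq:
  assumes m: "m \<le> 2 * N"
  shows "measure noise_space {\<omega>\<in>space noise_space. \<exists>q\<in>slots m. hit r q \<omega> \<noteq> 0}
    = measure M {\<omega>\<in>space M. \<exists>i\<in>{1..n}. \<exists>j<m. \<exists>k<m. \<forall>l. \<bar>B (x i, c + real k * h) \<omega> $ l - B (x i, b - real j * h) \<omega> $ l\<bar> \<le> r}"
proof -
  let ?X = "\<lambda>\<omega>. \<lambda>k\<in>cells \<times> (UNIV::'d set). cell_incr k \<omega>"
  let ?H = "{\<omega>\<in>space noise_space. \<exists>q\<in>slots m. hit r q \<omega> \<noteq> 0}"
  have "?H \<in> sets noise_space"
  proof (rule sets.sets_Collect_finite_Ex)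
    show "{\<omega> \<in> space noise_space. hit r q \<omega> \<noteq> 0} \<in> sets noise_space" if "q \<in> slots m" for q
    proof -
      have [measurable]: "hit r q \<in> borel_measurable noise_space" using that m by (intro measurable_hit) auto
      show ?thesis by measurable
    qed
  qed auto
  moreover have X: "?X \<in> M \<rightarrow>\<^sub>M noise_space"
    using measurable_cell_incr by (intro measurable_restrict) (auto simp: measurable_def)
  ultimately have "measure (distr M noise_space ?X) ?H = measure M (?X -` ?H \<inter> space M)"
    by (intro measure_distr)
  also have "?X -` ?H \<inter> space M = {\<omega>\<in>space M. \<exists>q\<in>slots m. hit r q (?X \<omega>) \<noteq> 0}"
    using measurable_space[OF X] by auto
  also have "\<dots> = {\<omega>\<in>space M. \<exists>i\<in>{1..n}. \<exists>j<m. \<exists>k<m. \<forall>l. \<bar>B (x i, c + real k * h) \<omega> $ l - B (x i, b - real j * h) \<omega> $ l\<bar> \<le> r}"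
  proof -
    have "hit r (i, j, k) (?X \<omega>) \<noteq> 0 \<longleftrightarrow> (\<forall>l. \<bar>B (x i, c + real k * h) \<omega> $ l - B (x i, b - real j * h) \<omega> $ l\<bar> \<le> r)"
      if "i \<in> {1..n}" "j < m" "k < m" for i j k \<omega>
      using that m by (simp add: hit_def small_def noise_cell_incr)
    then show ?thesis by (intro Collect_cong conj_cong refl) (simp add: Bex_def; blast)
  qed
  finally show ?thesis unfolding distr_cell_incr .
qed

end

subsection \<open>Approximation and compactness\<close>

text \<open>On a compact set the continuous function attains its infimum, so the bound at some point
  is equivalent to approximate bounds on a countable dense subset, one for every tolerance.\<close>

lemma sets_Collect_compact_Ex_le:
  fixes f :: "'b::{metric_space, second_countable_topology} \<Rightarrow> 'a \<Rightarrow> real"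
  assumes K: "compact K" and f[measurable]: "\<And>p. p \<in> K \<Longrightarrow> f p \<in> borel_measurable M"
    and cont: "\<And>\<omega>. \<omega> \<in> space M \<Longrightarrow> continuous_on K (\<lambda>p. f p \<omega>)"
  shows "{\<omega>\<in>space M. \<exists>p\<in>K. f p \<omega> \<le> e} \<in> sets M"
proof -
  obtain D where D: "countable D" "D \<subseteq> K" "K \<subseteq> closure D" using separable by metis
  have "{\<omega>\<in>space M. \<exists>p\<in>K. f p \<omega> \<le> e} = (\<Inter>n. \<Union>q\<in>D. {\<omega>\<in>space M. f q \<omega> < e + 1 / real (Suc n)})"
  proof (intro set_eqI iffI)
    fix \<omega> assume "\<omega> \<in> {\<omega>\<in>space M. \<exists>p\<in>K. f p \<omega> \<le> e}"
    then obtain p where p: "\<omega> \<in> space M" "p \<in> K" "f p \<omega> \<le> e" by auto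
    show "\<omega> \<in> (\<Inter>n. \<Union>q\<in>D. {\<omega>\<in>space M. f q \<omega> < e + 1 / real (Suc n)})"
    proof
      fix n
      obtain \<delta> where \<delta>: "0 < \<delta>" "\<And>q. q \<in> K \<Longrightarrow> dist q p < \<delta> \<Longrightarrow> dist (f q \<omega>) (f p \<omega>) < 1 / real (Suc n)"
        using cont[OF p(1)] p(2) unfolding continuous_on_iff by (metis of_nat_0_less_iff zero_less_Suc zero_less_divide_1_iff)
      obtain q where q: "q \<in> D" "dist q p < \<delta>" using D(3) p(2) \<delta>(1) by (meson closure_approachable subsetD)
      then have "f q \<omega> < e + 1 / real (Suc n)" using \<delta>(2)[of q] D(2) p(3) by (auto simp: dist_real_def)
      then show "\<omega> \<in> (\<Union>q\<in>D. {\<omega>\<in>space M. f q \<omega> < e + 1 / real (Suc n)})" using q p by auto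
    qed
  next
    fix \<omega> assume *: "\<omega> \<in> (\<Inter>n. \<Union>q\<in>D. {\<omega>\<in>space M. f q \<omega> < e + 1 / real (Suc n)})"
    then have \<omega>: "\<omega> \<in> space M" "K \<noteq> {}" using D(2) by auto
    obtain p where p: "p \<in> K" "\<And>q. q \<in> K \<Longrightarrow> f p \<omega> \<le> f q \<omega>"
      using continuous_attains_inf[OF K \<omega>(2) cont[OF \<omega>(1)]] by auto
    have "f p \<omega> \<le> e + 1 / real (Suc n)" for n
    proof -
      obtain q where "q \<in> D" "f q \<omega> < e + 1 / real (Suc n)" using * by blast
      then show ?thesis using p(2)[of q] D(2) by auto
    qed
    then have "f p \<omega> \<le> e + \<delta>" if "0 < \<delta>" for \<delta>
      using reals_Archimedean[OF that] by (metis add_left_mono inverse_eq_divide less_imp_le order_trans)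
    then have "f p \<omega> \<le> e" by (rule field_le_epsilon)
    then show "\<omega> \<in> {\<omega>\<in>space M. \<exists>p\<in>K. f p \<omega> \<le> e}" using p \<omega> by auto
  qed
  moreover have "{\<omega>\<in>space M. f q \<omega> < e + 1 / real (Suc n)} \<in> sets M" if "q \<in> D" for q n
  proof -
    have [measurable]: "f q \<in> borel_measurable M" using that D(2) by auto
    show ?thesis by measurable
  qed
  ultimately show ?thesis using D(1) by (auto intro!: sets.countable_INT sets.countable_UN')
qed

text \<open>One point of \<open>F\<close> is chosen in each occupied interval of length \<eta>. The
  map factors through the floor function and is Borel whatever the choice is.\<close>

lemma compact_discretization:
  fixes F :: "real set"
  assumes F: "compact F" and \<eta>: "0 < \<eta>"
  obtains \<pi> where "\<pi> \<in> borel_measurable borel" "finite (\<pi> ` F)" "\<pi> ` F \<subseteq> F" "\<And>s. s \<in> F \<Longrightarrow> \<bar>\<pi> s - s\<bar> \<le> \<eta>"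
proof -
  define g where "g z = (SOME y. y \<in> F \<and> \<lfloor>y / \<eta>\<rfloor> = z)" for z :: int
  have g: "g \<lfloor>s / \<eta>\<rfloor> \<in> F \<and> \<lfloor>g \<lfloor>s / \<eta>\<rfloor> / \<eta>\<rfloor> = \<lfloor>s / \<eta>\<rfloor>" if "s \<in> F" for s
    unfolding g_def by (rule someI[of _ s]) (use that in auto)
  show ?thesis
  proof
    have "(\<lambda>s::real. \<lfloor>s / \<eta>\<rfloor>) \<in> borel \<rightarrow>\<^sub>M count_space UNIV" by measurable
    then show "(\<lambda>s. g \<lfloor>s / \<eta>\<rfloor>) \<in> borel_measurable borel"
      by (rule measurable_compose) simp
    show "(\<lambda>s. g \<lfloor>s / \<eta>\<rfloor>) ` F \<subseteq> F" using g by auto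
    obtain a where a: "\<And>s. s \<in> F \<Longrightarrow> \<bar>s\<bar> \<le> a" using compact_imp_bounded[OF F] unfolding bounded_iff by auto
    have "(\<lambda>s. \<lfloor>s / \<eta>\<rfloor>) ` F \<subseteq> {\<lfloor>- a / \<eta>\<rfloor>..\<lfloor>a / \<eta>\<rfloor>}"
    proof
      fix z assume "z \<in> (\<lambda>s. \<lfloor>s / \<eta>\<rfloor>) ` F"
      then obtain s where s: "s \<in> F" "z = \<lfloor>s / \<eta>\<rfloor>" by auto
      then have "- a \<le> s" "s \<le> a" using a[of s] by auto
      then have "- a / \<eta> \<le> s / \<eta>" "s / \<eta> \<le> a / \<eta>" using \<eta> by (intro divide_right_mono; simp)+
      then show "z \<in> {\<lfloor>- a / \<eta>\<rfloor>..\<lfloor>a / \<eta>\<rfloor>}" unfolding s by (auto intro: floor_mono)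
    qed
    then have "finite ((\<lambda>s. \<lfloor>s / \<eta>\<rfloor>) ` F)" by (rule finite_subset) simp
    then show "finite ((\<lambda>s. g \<lfloor>s / \<eta>\<rfloor>) ` F)" by (metis finite_imageI image_image)
    fix s assume "s \<in> F"
    define y where "y = g \<lfloor>s / \<eta>\<rfloor>"
    have "\<lfloor>y / \<eta>\<rfloor> = \<lfloor>s / \<eta>\<rfloor>" using g[OF \<open>s \<in> F\<close>] by (simp add: y_def)
    then have "\<bar>y / \<eta> - s / \<eta>\<bar> \<le> 1" by linarith
    then have "\<bar>(y - s) / \<eta>\<bar> \<le> 1" by (simp add: diff_divide_distrib)
    then show "\<bar>g \<lfloor>s / \<eta>\<rfloor> - s\<bar> \<le> \<eta>" using \<eta> by (simp add: y_def abs_divide)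
  qed
qed

lemma finite_positive_enumeration:
  fixes G :: "real set"
  assumes G: "finite G" "G \<subseteq> {0<..}"
  obtains n and x :: "nat \<Rightarrow> real" where "x 0 = 0" "\<And>i j. i < j \<Longrightarrow> j \<le> n \<Longrightarrow> x i < x j" "x ` {1..n} = G"
proof -
  define x where "x i = (if i = 0 then 0 else sorted_list_of_set G ! (i - 1))" for i
  let ?n = "card G"
  have len: "length (sorted_list_of_set G) = ?n" by simp
  have mem: "x i \<in> G" if "1 \<le> i" "i \<le> ?n" for i
  proof -
    have "sorted_list_of_set G ! (i - 1) \<in> set (sorted_list_of_set G)" using that len by (intro nth_mem) auto
    then show ?thesis using that G by (simp add: x_def)
  qed
  have "x 0 = 0" by (simp add: x_def)
  moreover have "x i < x j" if "i < j" "j \<le> ?n" for i j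
  proof (cases "i = 0")
    case True
    then show ?thesis using mem[of j] that G by (auto simp: x_def)
  next
    case False
    have "sorted_wrt (<) (sorted_list_of_set G)" by (rule strict_sorted_list_of_set)
    then have "sorted_list_of_set G ! (i - 1) < sorted_list_of_set G ! (j - 1)"
      using that False len by (intro sorted_wrt_nth_less[of "(<)"]) auto
    then show ?thesis using False that by (simp add: x_def)
  qed
  moreover have "x ` {1..?n} = G"
  proof
    show "x ` {1..?n} \<subseteq> G" using mem by auto
    show "G \<subseteq> x ` {1..?n}"
    proof
      fix y assume "y \<in> G"
      then have "y \<in> set (sorted_list_of_set G)" using G by simp
      then obtain i where "i < ?n" "sorted_list_of_set G ! i = y" using len by (metis in_set_conv_nth)
      then show "y \<in> x ` {1..?n}" by (intro image_eqI[of _ _ "Suc i"]) (auto simp: x_def)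
    qed
  qed
  ultimately show ?thesis by (rule that[of x ?n])
qed

section \<open>Lower semicontinuity of the energy\<close>

lemma borel_measurable_real_kernel[measurable]: "real_kernel d \<in> borel_measurable borel"
  unfolding real_kernel_def[abs_def] by measurable

lemma borel_measurable_riesz_kernel[measurable]: "riesz_kernel \<beta> \<in> borel_measurable borel"
  unfolding riesz_kernel_def[abs_def] by measurable

text \<open>Away from 0 the kernel is continuous, and at 0 with d \<ge> 4 the approximants diverge.
  Convergence of the arguments suffices, without monotonicity.\<close>

lemma riesz_kernel_le_liminf:
  assumes a: "a \<longlonglongrightarrow> \<bar>r\<bar>" and a_pos: "\<And>n. 0 < a n"
  shows "riesz_kernel ((real d - 4) / 2) r \<le> liminf (\<lambda>n. ennreal (real_kernel d (a n)))"
proof (cases "d < 4")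
  case True
  then show ?thesis unfolding riesz_kernel_eq by (auto simp: real_kernel_def intro!: Liminf_bounded)
next
  case d: False
  show ?thesis
  proof (cases "r = 0")
    case False
    have "(\<lambda>n. real_kernel d (a n)) \<longlonglongrightarrow> real_kernel d \<bar>r\<bar>"
    proof (cases "d = 4")
      case True
      have "(\<lambda>n. max 0 (ln (1 / a n))) \<longlonglongrightarrow> max 0 (ln (1 / \<bar>r\<bar>))"
        using a False by (intro tendsto_intros) auto
      then show ?thesis using True by (simp add: real_kernel_def)
    next
      case F: False
      have "(\<lambda>n. a n powr (- ((real d - 4) / 2))) \<longlonglongrightarrow> \<bar>r\<bar> powr (- ((real d - 4) / 2))"
        using a False by (intro tendsto_powr tendsto_const) auto
      then show ?thesis using F d by (simp add: real_kernel_def)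
    qed
    then have "(\<lambda>n. ennreal (real_kernel d (a n))) \<longlonglongrightarrow> ennreal (real_kernel d \<bar>r\<bar>)" by (rule tendsto_ennrealI)
    then show ?thesis using False d lim_imp_Liminf[OF sequentially_bot] unfolding riesz_kernel_eq by fastforce
  next
    case True
    have large: "\<exists>\<delta>>0. \<forall>y. 0 < y \<longrightarrow> y < \<delta> \<longrightarrow> C \<le> real_kernel d y" for C
    proof (cases "d = 4")
      case True
      have "C \<le> real_kernel d y" if "0 < y" "y < exp (- C)" for y
      proof -
        have "ln y < - C" using that by (metis exp_gt_zero ln_exp ln_less_cancel_iff)
        then show ?thesis using True that by (simp add: real_kernel_def ln_div)
      qed
      then show ?thesis by (intro exI[of _ "exp (- C)"]) auto
    next
      case False
      define q where "q = (real d - 4) / 2"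
      have q: "0 < q" using d False by (simp add: q_def)
      define C' where "C' = \<bar>C\<bar> + 1"
      \<comment> \<open>The threshold solves y powr (- q) = C', and C' is at least 1 to keep it
        positive.\<close>
      have "C \<le> real_kernel d y" if "0 < y" "y < C' powr (- (1 / q))" for y
      proof -
        have "(C' powr (- (1 / q))) powr (- q) \<le> y powr (- q)" using that q by (intro powr_mono2') auto
        moreover have "(C' powr (- (1 / q))) powr (- q) = C'" using q by (simp add: powr_powr C'_def)
        ultimately show ?thesis using d False by (simp add: real_kernel_def q_def C'_def)
      qed
      then show ?thesis by (intro exI[of _ "C' powr (- (1 / q))"]) (auto simp: C'_def)
    qed
    have ge: "ennreal C \<le> liminf (\<lambda>n. ennreal (real_kernel d (a n)))" for C
    proof (rule Liminf_bounded)
      obtain \<delta> where \<delta>: "0 < \<delta>" "\<And>y. 0 < y \<Longrightarrow> y < \<delta> \<Longrightarrow> C \<le> real_kernel d y" using large by blast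
      have "eventually (\<lambda>n. a n < \<delta>) sequentially" using a True \<delta>(1) by (intro order_tendstoD(2)) auto
      then show "eventually (\<lambda>n. ennreal C \<le> ennreal (real_kernel d (a n))) sequentially"
        by eventually_elim (use \<delta>(2) a_pos in \<open>auto intro: ennreal_leI\<close>)
    qed
    have "liminf (\<lambda>n. ennreal (real_kernel d (a n))) = \<top>"
    proof (rule ccontr)
      assume "liminf (\<lambda>n. ennreal (real_kernel d (a n))) \<noteq> \<top>"
      then obtain L where L: "liminf (\<lambda>n. ennreal (real_kernel d (a n))) = ennreal L" "0 \<le> L"
        by (cases "liminf (\<lambda>n. ennreal (real_kernel d (a n)))") auto
      then show False using ge[of "L + 1"] by simp
    qed
    then show ?thesis by simp
  qed
qed

lemma nn_integral_distr_twice: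
  assumes \<Omega>: "prob_space \<Omega>" and Z[measurable]: "Z \<in> borel_measurable \<Omega>"
    and k[measurable]: "case_prod k \<in> borel_measurable (borel \<Otimes>\<^sub>M borel)"
  shows "(\<integral>\<^sup>+x. \<integral>\<^sup>+y. k x y \<partial>distr \<Omega> borel Z \<partial>distr \<Omega> borel Z) = (\<integral>\<^sup>+\<omega>. \<integral>\<^sup>+\<omega>'. k (Z \<omega>) (Z \<omega>') \<partial>\<Omega> \<partial>\<Omega>)"
proof -
  interpret \<Omega>: prob_space \<Omega> by (rule \<Omega>)
  have inner: "(\<integral>\<^sup>+y. k x y \<partial>distr \<Omega> borel Z) = (\<integral>\<^sup>+\<omega>'. k x (Z \<omega>') \<partial>\<Omega>)" for x
    by (rule nn_integral_distr) measurable
  show ?thesis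
    unfolding inner by (rule nn_integral_distr) measurable
qed

text \<open>Pass to an almost surely convergent coupling and apply Fatou's lemma in both variables.\<close>

lemma finite_energy_limit:
  fixes \<mu> :: "nat \<Rightarrow> real measure"
  assumes F: "compact F" and \<mu>: "\<And>n. real_distribution (\<mu> n)" and supp: "\<And>n. AE x in \<mu> n. x \<in> F"
    and e: "\<And>n. 0 < e n" "e \<longlonglongrightarrow> 0"
    and bound: "\<And>n. (\<integral>\<^sup>+x. \<integral>\<^sup>+y. ennreal (real_kernel d (\<bar>x - y\<bar> + e n)) \<partial>\<mu> n \<partial>\<mu> n) \<le> C"
  obtains \<nu> where "\<nu> \<in> prob_measures_on F" "riesz_energy ((real d - 4) / 2) \<nu> \<le> C"
proof -
  have Fb: "F \<in> sets borel" using F by (simp add: borel_compact)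
  obtain a where a: "\<And>s. s \<in> F \<Longrightarrow> \<bar>s\<bar> \<le> a" using compact_imp_bounded[OF F] unfolding bounded_iff by auto
  have "tight \<mu>"
    unfolding tight_def
  proof (intro conjI allI impI)
    fix \<epsilon> :: real assume "0 < \<epsilon>"
    \<comment> \<open>All the measures are carried by one bounded set; the margin 1 makes room for a
      half-open interval.\<close>
    have "1 - \<epsilon> < measure (\<mu> n) {- (\<bar>a\<bar> + 1)<..\<bar>a\<bar> + 1}" for n
    proof -
      interpret real_distribution "\<mu> n" by (rule \<mu>)
      have "AE x in \<mu> n. x \<in> {- (\<bar>a\<bar> + 1)<..\<bar>a\<bar> + 1}"
        using supp[of n] by eventually_elim (use a in force)
      then have "measure (\<mu> n) {- (\<bar>a\<bar> + 1)<..\<bar>a\<bar> + 1} = 1"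
        by (intro prob_eq_1[THEN iffD2]) auto
      then show ?thesis using \<open>0 < \<epsilon>\<close> by simp
    qed
    then show "\<exists>a b. a < b \<and> (\<forall>n. 1 - \<epsilon> < measure (\<mu> n) {a<..b})"
      by (intro exI[of _ "- (\<bar>a\<bar> + 1)"] exI[of _ "\<bar>a\<bar> + 1"]) auto
  qed (rule \<mu>)
  from tight_imp_convergent_subsubsequence[OF this strict_mono_id]
  obtain r \<nu> where r: "strict_mono r" and \<nu>: "real_distribution \<nu>" and conv: "weak_conv_m (\<lambda>n. \<mu> (r n)) \<nu>"
    by (auto simp: comp_def)
  obtain \<Omega> :: "real measure" and Y Z where \<Omega>: "prob_space \<Omega>"
    and Y[measurable]: "\<And>n. Y n \<in> borel_measurable \<Omega>" and dY: "\<And>n. distr \<Omega> borel (Y n) = \<mu> (r n)"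
    and Z': "Z \<in> \<Omega> \<rightarrow>\<^sub>M lborel" and dZ: "distr \<Omega> borel Z = \<nu>"
    and lim: "\<And>\<omega>. \<omega> \<in> space \<Omega> \<Longrightarrow> (\<lambda>n. Y n \<omega>) \<longlonglongrightarrow> Z \<omega>"
    using Skorohod[OF \<mu> \<nu> conv] by metis
  have Z[measurable]: "Z \<in> borel_measurable \<Omega>" using Z' by simp
  interpret \<Omega>: prob_space \<Omega> by (rule \<Omega>)
  \<comment> \<open>Countably many null sets are discarded; after that the limit lies in
    \<open>F\<close> because \<open>F\<close> is closed.\<close>
  have "AE \<omega> in \<Omega>. \<forall>n. Y n \<omega> \<in> F"
    unfolding AE_all_countable
  proof
    fix n
    have "AE x in distr \<Omega> borel (Y n). x \<in> F" unfolding dY by (rule supp)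
    then show "AE \<omega> in \<Omega>. Y n \<omega> \<in> F" using Fb by (subst (asm) AE_distr_iff) auto
  qed
  then have "AE \<omega> in \<Omega>. Z \<omega> \<in> F"
    using AE_space
  proof eventually_elim
    case (elim \<omega>)
    then show ?case
      using closed_sequentially[OF compact_imp_closed[OF F], of "\<lambda>n. Y n \<omega>" "Z \<omega>"] lim[of \<omega>] by auto
  qed
  then have "AE x in \<nu>. x \<in> F" unfolding dZ[symmetric] using Fb by (subst AE_distr_iff) auto
  then have "\<nu> \<in> prob_measures_on F"
  proof -
    assume AE: "AE x in \<nu>. x \<in> F"
    interpret \<nu>: real_distribution \<nu> by (rule \<nu>)
    have "emeasure \<nu> F = 1" using AE Fb by (intro \<nu>.emeasure_eq_1_AE) auto
    then show ?thesis using \<nu>.prob_space_axioms by (simp add: prob_measures_on_def)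
  qed
  moreover have "riesz_energy ((real d - 4) / 2) \<nu> \<le> C"
  proof -
    let ?k = "riesz_kernel ((real d - 4) / 2)"
    let ?f = "\<lambda>n x y. ennreal (real_kernel d (\<bar>x - y\<bar> + e (r n)))"
    interpret \<nu>: real_distribution \<nu> by (rule \<nu>)
    have "riesz_energy ((real d - 4) / 2) \<nu> = (\<integral>\<^sup>+\<omega>. \<integral>\<^sup>+\<omega>'. ?k (Z \<omega> - Z \<omega>') \<partial>\<Omega> \<partial>\<Omega>)"
      unfolding riesz_energy_def dZ[symmetric]
      by (rule nn_integral_distr_twice[OF \<Omega> Z]) measurable
    also have "\<dots> \<le> (\<integral>\<^sup>+\<omega>. \<integral>\<^sup>+\<omega>'. liminf (\<lambda>n. ?f n (Y n \<omega>) (Y n \<omega>')) \<partial>\<Omega> \<partial>\<Omega>)"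
    proof (intro nn_integral_mono riesz_kernel_le_liminf)
      fix \<omega> \<omega>' assume "\<omega> \<in> space \<Omega>" "\<omega>' \<in> space \<Omega>"
      then have "(\<lambda>n. \<bar>Y n \<omega> - Y n \<omega>'\<bar> + e (r n)) \<longlonglongrightarrow> \<bar>Z \<omega> - Z \<omega>'\<bar> + 0"
        using LIMSEQ_subseq_LIMSEQ[OF e(2) r] lim by (intro tendsto_intros) (auto simp: comp_def)
      then show "(\<lambda>n. \<bar>Y n \<omega> - Y n \<omega>'\<bar> + e (r n)) \<longlonglongrightarrow> \<bar>Z \<omega> - Z \<omega>'\<bar>" by simp
      show "0 < \<bar>Y n \<omega> - Y n \<omega>'\<bar> + e (r n)" for n using e(1) by (simp add: add_nonneg_pos)
    qed
    also have "\<dots> \<le> (\<integral>\<^sup>+\<omega>. liminf (\<lambda>n. \<integral>\<^sup>+\<omega>'. ?f n (Y n \<omega>) (Y n \<omega>') \<partial>\<Omega>) \<partial>\<Omega>)"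
      by (intro nn_integral_mono nn_integral_liminf) measurable
    also have "\<dots> \<le> liminf (\<lambda>n. \<integral>\<^sup>+\<omega>. \<integral>\<^sup>+\<omega>'. ?f n (Y n \<omega>) (Y n \<omega>') \<partial>\<Omega> \<partial>\<Omega>)"
      by (intro nn_integral_liminf) measurable
    also have "\<dots> \<le> C"
    proof -
      have "(\<integral>\<^sup>+\<omega>. \<integral>\<^sup>+\<omega>'. ?f n (Y n \<omega>) (Y n \<omega>') \<partial>\<Omega> \<partial>\<Omega>) \<le> C" for n
      proof -
        interpret \<mu>n: real_distribution "\<mu> (r n)" by (rule \<mu>)
        have "(\<integral>\<^sup>+\<omega>. \<integral>\<^sup>+\<omega>'. ?f n (Y n \<omega>) (Y n \<omega>') \<partial>\<Omega> \<partial>\<Omega>) = (\<integral>\<^sup>+x. \<integral>\<^sup>+y. ?f n x y \<partial>distr \<Omega> borel (Y n) \<partial>distr \<Omega> borel (Y n))"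
          by (rule nn_integral_distr_twice[OF \<Omega> Y, symmetric]) measurable
        then show ?thesis using bound[of "r n"] by (simp add: dY)
      qed
      then have "liminf (\<lambda>n. \<integral>\<^sup>+\<omega>. \<integral>\<^sup>+\<omega>'. ?f n (Y n \<omega>) (Y n \<omega>') \<partial>\<Omega> \<partial>\<Omega>) \<le> liminf (\<lambda>n. C)"
        by (intro Liminf_mono) auto
      then show ?thesis by (simp add: Liminf_const)
    qed
    finally show ?thesis .
  qed
  ultimately show ?thesis by (rule that)
qed

subsection \<open>Hitting probabilities and energies\<close>

text \<open>The weights from \<open>prob_hit_le\<close> become a measure on the points
  \<open>x i\<close>, with grid energy at most a constant over \<open>q\<close>. The hypothesis on
  \<open>C\<close> passes from the lattice kernel to the regularised Riesz kernel; its additive 1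
  integrates to 1.\<close>

lemma (in sheet_grid) energy_measure_of_hit:
  assumes K: "c - b + 4 * real N * h \<le> K" "s1 \<le> K" "1 \<le> K" and q: "0 < q"
    and hit: "q \<le> measure M {\<omega>\<in>space M. \<exists>i\<in>{1..n}. \<exists>j<N. \<exists>k<N. \<forall>l. \<bar>B (x i, c + real k * h) \<omega> $ l - B (x i, b - real j * h) \<omega> $ l\<bar> \<le> \<epsilon>}"
    and C: "0 \<le> C" "\<And>r. 0 \<le> r \<Longrightarrow> real_kernel CARD('d) (r + \<epsilon>\<^sup>2) \<le> C * (1 + grid_kernel CARD('d) N h \<epsilon> r)"
  obtains \<mu> where "real_distribution \<mu>" "AE y in \<mu>. y \<in> x ` {1..n}"
    "(\<integral>\<^sup>+y. \<integral>\<^sup>+z. ennreal (real_kernel CARD('d) (\<bar>y - z\<bar> + \<epsilon>\<^sup>2)) \<partial>\<mu> \<partial>\<mu>)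
      \<le> ennreal (C * (1 + 16384 * pair_const ^ CARD('d) * ((4 * sqrt K) ^ CARD('d))\<^sup>2 / q))"
proof -
  let ?d = "CARD('d)"
  define A where "A = 16384 * pair_const ^ ?d * ((4 * sqrt K) ^ ?d)\<^sup>2"
  define P where "P = measure noise_space {\<omega>\<in>space noise_space. \<exists>q\<in>slots N. hit \<epsilon> q \<omega> \<noteq> 0}"
  have "N \<le> 2 * N" by simp
  have P: "q \<le> P" unfolding P_def by (rule ord_le_eq_trans[OF hit prob_hit_eq[OF \<open>N \<le> 2 * N\<close>, symmetric]])
  have pos: "0 < measure noise_space {\<omega>\<in>space noise_space. \<exists>q\<in>slots N. hit \<epsilon> q \<omega> \<noteq> 0}"
    using P q unfolding P_def by linarith
  obtain p where p: "\<And>i. 0 \<le> p i" "(\<Sum>i\<in>{1..n}. p i) = 1"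
    and "measure noise_space {\<omega>\<in>space noise_space. \<exists>q\<in>slots N. hit \<epsilon> q \<omega> \<noteq> 0} * grid_energy p
      \<le> 16384 * pair_const ^ ?d * ((4 * sqrt K) ^ ?d)\<^sup>2"
    by (rule prob_hit_le[OF K pos]) (rule that)
  then have pE: "P * grid_energy p \<le> A" unfolding P_def A_def by (simp only:)
  have E0: "0 \<le> grid_energy p"
    unfolding grid_energy_def using p(1) kern_pos by (intro sum_nonneg mult_nonneg_nonneg) (auto intro: less_imp_le)
  have "q * grid_energy p \<le> A" using pE mult_right_mono[OF P E0] by linarith
  then have Eq: "grid_energy p \<le> A / q" using q by (simp add: field_simps)
  define \<pi> where "\<pi> = point_measure {1..n} (\<lambda>i. ennreal (p i))"
  have \<pi>: "prob_space \<pi>"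
  proof
    have "emeasure \<pi> (space \<pi>) = (\<Sum>i\<in>{1..n}. ennreal (p i))"
      unfolding \<pi>_def space_point_measure by (rule emeasure_point_measure_finite) auto
    also have "\<dots> = ennreal (\<Sum>i\<in>{1..n}. p i)" using p(1) by (rule sum_ennreal)
    finally show "emeasure \<pi> (space \<pi>) = 1" using p(2) by simp
  qed
  interpret \<pi>: prob_space \<pi> by (rule \<pi>)
  have x[measurable]: "x \<in> borel_measurable \<pi>" unfolding \<pi>_def by simp
  define \<mu> where "\<mu> = distr \<pi> borel x"
  show ?thesis
  proof
    show "real_distribution \<mu>" unfolding \<mu>_def by (rule \<pi>.real_distribution_distr) (rule x)
    have "x ` {1..n} \<in> sets borel" by (intro borel_closed finite_imp_closed) auto
    then show "AE y in \<mu>. y \<in> x ` {1..n}"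
      unfolding \<mu>_def by (subst AE_distr_iff) (auto simp: \<pi>_def space_point_measure intro!: AE_I2)
    have "(\<integral>\<^sup>+y. \<integral>\<^sup>+z. ennreal (real_kernel ?d (\<bar>y - z\<bar> + \<epsilon>\<^sup>2)) \<partial>\<mu> \<partial>\<mu>)
        = (\<integral>\<^sup>+i. \<integral>\<^sup>+i'. ennreal (real_kernel ?d (\<bar>x i - x i'\<bar> + \<epsilon>\<^sup>2)) \<partial>\<pi> \<partial>\<pi>)"
      unfolding \<mu>_def by (rule nn_integral_distr_twice[OF \<pi> x]) measurable
    also have "\<dots> = (\<Sum>i\<in>{1..n}. ennreal (p i) * (\<Sum>i'\<in>{1..n}. ennreal (p i') * ennreal (real_kernel ?d (\<bar>x i - x i'\<bar> + \<epsilon>\<^sup>2))))"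
      unfolding \<pi>_def by (simp add: nn_integral_point_measure_finite)
    also have "\<dots> = ennreal (\<Sum>i\<in>{1..n}. p i * (\<Sum>i'\<in>{1..n}. p i' * real_kernel ?d (\<bar>x i - x i'\<bar> + \<epsilon>\<^sup>2)))"
    proof -
      have k: "0 \<le> p i' * real_kernel ?d (\<bar>x i - x i'\<bar> + \<epsilon>\<^sup>2)" for i i' using p(1) real_kernel_nonneg by (intro mult_nonneg_nonneg)
      have "ennreal (p i) * (\<Sum>i'\<in>{1..n}. ennreal (p i') * ennreal (real_kernel ?d (\<bar>x i - x i'\<bar> + \<epsilon>\<^sup>2)))
        = ennreal (p i * (\<Sum>i'\<in>{1..n}. p i' * real_kernel ?d (\<bar>x i - x i'\<bar> + \<epsilon>\<^sup>2)))" for i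
        using p(1) real_kernel_nonneg k by (simp add: ennreal_mult sum_nonneg flip: sum_ennreal)
      then show ?thesis
        using p(1) k by (simp only:) (intro sum_ennreal mult_nonneg_nonneg sum_nonneg real_kernel_nonneg)
    qed
    also have "\<dots> \<le> ennreal (C * (1 + A / q))"
    proof (rule ennreal_leI)
      have "(\<Sum>i\<in>{1..n}. p i * (\<Sum>i'\<in>{1..n}. p i' * real_kernel ?d (\<bar>x i - x i'\<bar> + \<epsilon>\<^sup>2)))
          \<le> (\<Sum>i\<in>{1..n}. p i * (\<Sum>i'\<in>{1..n}. p i' * (C * (1 + kern \<bar>x i - x i'\<bar>))))"
        unfolding kern_def using p(1) C by (intro sum_mono mult_left_mono) auto
      also have "\<dots> = (\<Sum>i\<in>{1..n}. C * (p i * (\<Sum>i'\<in>{1..n}. p i')) + C * (\<Sum>i'\<in>{1..n}. p i * p i' * kern \<bar>x i - x i'\<bar>))"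
        unfolding sum_distrib_left sum.distrib[symmetric] by (intro sum.cong refl) (simp add: algebra_simps)
      also have "\<dots> = C * (1 + grid_energy p)"
        unfolding p(2) grid_energy_def sum.distrib sum_distrib_left[symmetric] using p(2) by (simp add: distrib_left)
      also have "\<dots> \<le> C * (1 + A / q)" using C Eq by (intro mult_left_mono) auto
      finally show "(\<Sum>i\<in>{1..n}. p i * (\<Sum>i'\<in>{1..n}. p i' * real_kernel ?d (\<bar>x i - x i'\<bar> + \<epsilon>\<^sup>2))) \<le> C * (1 + A / q)" .
    qed
    finally show "(\<integral>\<^sup>+y. \<integral>\<^sup>+z. ennreal (real_kernel ?d (\<bar>y - z\<bar> + \<epsilon>\<^sup>2)) \<partial>\<mu> \<partial>\<mu>) \<le> ennreal (C * (1 + 16384 * pair_const ^ ?d * ((4 * sqrt K) ^ ?d)\<^sup>2 / q))"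
      unfolding A_def .
  qed
qed

text \<open>Two time windows of length \<open>U\<close> face each other across [b, c], and p is the
  triple of s and the two times. With r = 0 this is exact coincidence; positive r is what a grid can
  detect.\<close>

definition close_event :: "'a measure \<Rightarrow> (real \<times> real \<Rightarrow> 'a \<Rightarrow> real ^ 'd) \<Rightarrow> real set \<Rightarrow> real \<Rightarrow> real \<Rightarrow> real \<Rightarrow> real \<Rightarrow> 'a set" where
  "close_event M B F b c U r = {\<omega>\<in>space M. \<exists>p\<in>F \<times> {b - U..b} \<times> {c..c + U}.
     norm (B (fst p, snd (snd p)) \<omega> - B (fst p, fst (snd p)) \<omega>) \<le> r}"

lemma continuous_on_sheet_increment:
  assumes B: "brownian_sheet M B" and F: "F \<subseteq> {0<..}" and bc: "U \<le> b" "0 \<le> c" and \<omega>: "\<omega> \<in> space M"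
  shows "continuous_on (F \<times> {b - U..b} \<times> {c..c + U}) (\<lambda>p. norm (B (fst p, snd (snd p)) \<omega> - B (fst p, fst (snd p)) \<omega>))"
proof -
  have "continuous_on ({0..} \<times> {0..}) (\<lambda>p. B p \<omega>)" using B \<omega> by (auto simp: brownian_sheet_def)
  note comp = continuous_on_compose2[OF this]
  have nonneg: "0 \<le> s" if "s \<in> F" for s using F that by (auto simp: less_imp_le)
  have "continuous_on (F \<times> {b - U..b} \<times> {c..c + U}) (\<lambda>p. B (fst p, snd (snd p)) \<omega>)"
    by (rule comp) (use bc nonneg in \<open>auto intro!: continuous_intros\<close>)
  moreover have "continuous_on (F \<times> {b - U..b} \<times> {c..c + U}) (\<lambda>p. B (fst p, fst (snd p)) \<omega>)"
    by (rule comp) (use bc nonneg in \<open>auto intro!: continuous_intros\<close>)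
  ultimately show ?thesis by (intro continuous_on_norm continuous_on_diff)
qed

lemma sets_close_event:
  assumes B: "brownian_sheet M B" and F: "compact F" "F \<subseteq> {0<..}" and bc: "U \<le> b" "0 \<le> c"
  shows "close_event M B F b c U r \<in> sets M"
  unfolding close_event_def
proof (rule sets_Collect_compact_Ex_le)
  show "compact (F \<times> {b - U..b} \<times> {c..c + U})" using F by (intro compact_Times) auto
  fix p assume p: "p \<in> F \<times> {b - U..b} \<times> {c..c + U}"
  then have "0 \<le> fst p" "0 \<le> fst (snd p)" "0 \<le> snd (snd p)" using F bc by (auto simp: subset_iff less_imp_le)
  then have [measurable]: "B (fst p, snd (snd p)) \<in> borel_measurable M" "B (fst p, fst (snd p)) \<in> borel_measurable M"
    using B by (auto simp: brownian_sheet_def)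
  show "(\<lambda>\<omega>. norm (B (fst p, snd (snd p)) \<omega> - B (fst p, fst (snd p)) \<omega>)) \<in> borel_measurable M" by measurable
qed (rule continuous_on_sheet_increment[OF B F(2) bc])

section \<open>From coincidences of positive probability to a measure of finite energy\<close>

lemma compact_positive_bounds:
  fixes F :: "real set"
  assumes "compact F" "F \<subseteq> {0<..}" "F \<noteq> {}"
  obtains s0 s1 where "0 < s0" "\<And>s. s \<in> F \<Longrightarrow> s0 \<le> s" "\<And>s. s \<in> F \<Longrightarrow> s \<le> s1"
proof -
  obtain s0 where "s0 \<in> F" "\<And>s. s \<in> F \<Longrightarrow> s0 \<le> s" using compact_attains_inf[OF assms(1,3)] by auto
  moreover obtain s1 where "\<And>s. s \<in> F \<Longrightarrow> s \<le> s1" using compact_attains_sup[OF assms(1,3)] by auto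
  ultimately show ?thesis using assms(2) by (intro that[of s0 s1]) auto
qed

lemma grid_point_near:
  fixes t :: real
  assumes t: "0 \<le> t" "t \<le> U" and h: "0 < h" "real N * h = U" "0 < N"
  obtains j where "j < N" "\<bar>real j * h - t\<bar> \<le> h"
proof -
  \<comment> \<open>Indices stop at N - 1, so for t near \<open>U\<close> the last grid point is
    taken; it is still within one mesh width.\<close>
  define j where "j = min (nat \<lfloor>t / h\<rfloor>) (N - 1)"
  have nn: "0 \<le> \<lfloor>t / h\<rfloor>" using t h by simp
  have fl: "real (nat \<lfloor>t / h\<rfloor>) \<le> t / h" "t / h < real (nat \<lfloor>t / h\<rfloor>) + 1"
    using nn by (simp_all add: of_nat_nat)
  have tN: "t / h \<le> real N" using t h by (simp add: field_simps)
  have "real j \<le> t / h" "t / h \<le> real j + 1"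
    using fl tN h(3) unfolding j_def by (auto simp: min_def of_nat_diff)
  then have "\<bar>real j - t / h\<bar> \<le> 1" by linarith
  then have "\<bar>real j - t / h\<bar> * h \<le> 1 * h" using h by (intro mult_right_mono) auto
  moreover have "\<bar>real j - t / h\<bar> * h = \<bar>real j * h - t\<bar>"
    using h(1) abs_mult_pos[of h "real j - t / h"] by (simp add: left_diff_distrib)
  ultimately have "\<bar>real j * h - t\<bar> \<le> h" by simp
  moreover have "j < N" using h(3) by (auto simp: j_def)
  ultimately show ?thesis by (rule that[rotated])
qed

text \<open>By continuity an exact coincidence is seen as an \<epsilon>-hit by all sufficiently fine
  grids, so the coincidence event lies in the increasing union of the \<open>S k\<close>. The strict
  inequality for \<open>q\<close> then singles out one grid.\<close>

lemma exists_grid_hit: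
  fixes B :: "real \<times> real \<Rightarrow> 'a \<Rightarrow> real ^ 'd"
  assumes B: "brownian_sheet M B" and F: "compact F" "F \<subseteq> {0<..}" and U: "0 < U" "U \<le> b" "0 \<le> c"
    and q: "q < measure M (close_event M B F b c U 0)" and \<epsilon>: "0 < \<epsilon>"
  obtains n N and x :: "nat \<Rightarrow> real" and h where "0 < N" "0 < h" "real N * h = U" "x 0 = 0"
    "\<And>i j. i < j \<Longrightarrow> j \<le> n \<Longrightarrow> x i < x j" "x ` {1..n} \<subseteq> F"
    "q \<le> measure M {\<omega>\<in>space M. \<exists>i\<in>{1..n}. \<exists>j<N. \<exists>k<N. \<forall>l. \<bar>B (x i, c + real k * h) \<omega> $ l - B (x i, b - real j * h) \<omega> $ l\<bar> \<le> \<epsilon>}"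
proof -
  interpret prob_space M using B by (simp add: brownian_sheet_def)
  have "\<exists>n (x :: nat \<Rightarrow> real). x 0 = 0 \<and> (\<forall>i j. i < j \<longrightarrow> j \<le> n \<longrightarrow> x i < x j) \<and> x ` {1..n} \<subseteq> F \<and> (\<forall>s\<in>F. \<exists>i\<in>{1..n}. \<bar>x i - s\<bar> \<le> 1 / real (Suc m))" for m
  proof -
    have "0 < 1 / real (Suc m)" by simp
    then obtain \<pi> where "\<pi> \<in> borel_measurable borel"
      and \<pi>: "finite (\<pi> ` F)" "\<pi> ` F \<subseteq> F" "\<And>s. s \<in> F \<Longrightarrow> \<bar>\<pi> s - s\<bar> \<le> 1 / real (Suc m)"
      by (rule compact_discretization[OF F(1)]) blast
    obtain n and x :: "nat \<Rightarrow> real" where x: "x 0 = 0" "\<And>i j. i < j \<Longrightarrow> j \<le> n \<Longrightarrow> x i < x j" "x ` {1..n} = \<pi> ` F"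
      using finite_positive_enumeration[of "\<pi> ` F"] \<pi>(1,2) F(2) by (metis order_trans)
    have near: "\<exists>i\<in>{1..n}. \<bar>x i - s\<bar> \<le> 1 / real (Suc m)" if "s \<in> F" for s
    proof -
      have "\<pi> s \<in> x ` {1..n}" using that x(3) by auto
      then show ?thesis using \<pi>(3)[OF that] by auto
    qed
    have sub: "x ` {1..n} \<subseteq> F" unfolding x(3) by (rule \<pi>(2))
    show ?thesis by (intro exI[of _ n] exI[of _ x] conjI allI impI ballI x(1,2) sub near)
  qed
  then have "\<forall>m. \<exists>n (x :: nat \<Rightarrow> real). x 0 = 0 \<and> (\<forall>i j. i < j \<longrightarrow> j \<le> n \<longrightarrow> x i < x j) \<and> x ` {1..n} \<subseteq> F \<and> (\<forall>s\<in>F. \<exists>i\<in>{1..n}. \<bar>x i - s\<bar> \<le> 1 / real (Suc m))" ..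
  then obtain n :: "nat \<Rightarrow> nat" and x :: "nat \<Rightarrow> nat \<Rightarrow> real" where
    "\<forall>m. x m 0 = 0 \<and> (\<forall>i j. i < j \<longrightarrow> j \<le> n m \<longrightarrow> x m i < x m j) \<and> x m ` {1..n m} \<subseteq> F \<and> (\<forall>s\<in>F. \<exists>i\<in>{1..n m}. \<bar>x m i - s\<bar> \<le> 1 / real (Suc m))"
    by (simp only: choice_iff) blast
  then have x0: "\<And>m. x m 0 = (0::real)" and xs: "\<And>m i j. i < j \<Longrightarrow> j \<le> n m \<Longrightarrow> x m i < x m j"
    and xF: "\<And>m. x m ` {1..n m} \<subseteq> F" and xnear: "\<And>m s. s \<in> F \<Longrightarrow> \<exists>i\<in>{1..n m}. \<bar>x m i - s\<bar> \<le> 1 / real (Suc m)"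
    by simp_all
  define h where "h m = U / real (Suc m)" for m
  have h: "0 < h m" "real (Suc m) * h m = U" for m using U by (auto simp: h_def)
  define A where "A m = {\<omega>\<in>space M. \<exists>i\<in>{1..n m}. \<exists>j<Suc m. \<exists>k<Suc m. \<forall>l. \<bar>B (x m i, c + real k * h m) \<omega> $ l - B (x m i, b - real j * h m) \<omega> $ l\<bar> \<le> \<epsilon>}" for m
  have jh: "real j * h m \<le> U" if "j < Suc m" for j m
    using mult_right_mono[of "real j" "real (Suc m)" "h m"] that h[of m] by auto
  have A[measurable]: "A m \<in> sets M" for m
  proof -
    have eq: "A m = (\<Union>i\<in>{1..n m}. \<Union>j\<in>{..<Suc m}. \<Union>k\<in>{..<Suc m}. {\<omega>\<in>space M. \<forall>l. \<bar>B (x m i, c + real k * h m) \<omega> $ l - B (x m i, b - real j * h m) \<omega> $ l\<bar> \<le> \<epsilon>})"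
      unfolding A_def by blast
    have "{\<omega>\<in>space M. \<forall>l. \<bar>B (x m i, c + real k * h m) \<omega> $ l - B (x m i, b - real j * h m) \<omega> $ l\<bar> \<le> \<epsilon>} \<in> sets M"
      if "i \<in> {1..n m}" "j < Suc m" "k < Suc m" for i j k
    proof -
      have "0 \<le> x m i" using that xF[of m] F(2) by (force simp: less_imp_le)
      moreover have "0 \<le> c + real k * h m" using U h by (simp add: less_imp_le)
      moreover have "0 \<le> b - real j * h m" using jh[OF that(2)] U by simp
      ultimately have "B (x m i, c + real k * h m) \<in> borel_measurable M" "B (x m i, b - real j * h m) \<in> borel_measurable M"
        using B by (auto simp: brownian_sheet_def)
      then have [measurable]: "(\<lambda>\<omega>. B (x m i, c + real k * h m) \<omega> $ l) \<in> borel_measurable M"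
        "(\<lambda>\<omega>. B (x m i, b - real j * h m) \<omega> $ l) \<in> borel_measurable M" for l
        by (auto intro: measurable_compose[OF _ borel_measurable_nth])
      show ?thesis by measurable
    qed
    then show ?thesis unfolding eq by (intro sets.finite_UN) auto
  qed
  define S where "S k = (\<Inter>m\<in>{k..}. A m)" for k
  have S[measurable]: "S k \<in> sets M" for k unfolding S_def by (intro sets.countable_INT') auto
  have "incseq S" unfolding incseq_def S_def by (auto intro: order_trans)
  have sub: "close_event M B F b c U 0 \<subseteq> (\<Union>k. S k)"
  proof
    fix \<omega> assume "\<omega> \<in> close_event M B F b c U 0"
    then obtain s t1 t2 where \<omega>: "\<omega> \<in> space M" and s: "s \<in> F" "t1 \<in> {b - U..b}" "t2 \<in> {c..c + U}" and eq: "B (s, t2) \<omega> = B (s, t1) \<omega>"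
      by (auto simp: close_event_def)
    let ?K = "F \<times> {b - U..b} \<times> {c..c + U}" and ?f = "\<lambda>p. norm (B (fst p, snd (snd p)) \<omega> - B (fst p, fst (snd p)) \<omega>)"
    have "continuous_on ?K ?f" by (rule continuous_on_sheet_increment[OF B F(2) U(2,3) \<omega>])
    then obtain \<delta> where \<delta>: "0 < \<delta>" "\<And>p. p \<in> ?K \<Longrightarrow> dist p (s, t1, t2) < \<delta> \<Longrightarrow> dist (?f p) (?f (s, t1, t2)) < \<epsilon>"
      unfolding continuous_on_iff using s \<epsilon> by (metis mem_Sigma_iff)
    \<comment> \<open>\<open>L / real (Suc m)\<close> bounds the distance to a grid parameter: 1 /
      Suc m in s and U / Suc m in each of the two times.\<close>
    define L where "L = 1 + 2 * U"
    have L: "0 < L" using U by (simp add: L_def)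
    obtain k where k: "L / real (Suc k) < \<delta>"
      using reals_Archimedean[of "\<delta> / L"] \<delta>(1) L by (auto simp: field_simps)
    have "\<omega> \<in> A m" if "k \<le> m" for m
    proof -
      obtain i where i: "i \<in> {1..n m}" "\<bar>x m i - s\<bar> \<le> 1 / real (Suc m)" using xnear[OF s(1), of m] by blast
      obtain j where j: "j < Suc m" "\<bar>real j * h m - (b - t1)\<bar> \<le> h m"
        using grid_point_near[of "b - t1" U "h m" "Suc m"] s(2) h by auto
      obtain l where l: "l < Suc m" "\<bar>real l * h m - (t2 - c)\<bar> \<le> h m"
        using grid_point_near[of "t2 - c" U "h m" "Suc m"] s(3) h by auto
      let ?p = "(x m i, b - real j * h m, c + real l * h m)"
      have "?p \<in> ?K" using i xF[of m] jh[OF j(1)] jh[OF l(1)] h(1)[of m] by auto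
      moreover have "dist ?p (s, t1, t2) < \<delta>"
      proof -
        have "dist ?p (s, t1, t2) \<le> dist (x m i) s + (dist (b - real j * h m) t1 + dist (c + real l * h m) t2)"
          unfolding dist_Pair_Pair
          by (intro order_trans[OF sqrt_sum_squares_le_sum] add_left_mono) auto
        also have "\<dots> \<le> 1 / real (Suc m) + (h m + h m)"
          using i j l by (intro add_mono) (auto simp: dist_real_def)
        also have "\<dots> = L / real (Suc m)" by (simp add: L_def h_def add_divide_distrib)
        also have "\<dots> \<le> L / real (Suc k)" using that L by (intro divide_left_mono) auto
        finally show ?thesis using k by simp
      qed
      ultimately have "?f ?p < \<epsilon>" using \<delta>(2)[of ?p] eq by simp
      then have "\<forall>l'. \<bar>B (x m i, c + real l * h m) \<omega> $ l' - B (x m i, b - real j * h m) \<omega> $ l'\<bar> \<le> \<epsilon>"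
        using component_le_norm_cart[of "B (x m i, c + real l * h m) \<omega> - B (x m i, b - real j * h m) \<omega>"]
        by (auto intro: order_trans less_imp_le)
      then show ?thesis using i j l \<omega> unfolding A_def by blast
    qed
    then show "\<omega> \<in> (\<Union>k. S k)" unfolding S_def by auto
  qed
  have "(\<lambda>k. measure M (S k)) \<longlonglongrightarrow> measure M (\<Union>k. S k)"
    using \<open>incseq S\<close> by (intro finite_Lim_measure_incseq) auto
  moreover have "q < measure M (\<Union>k. S k)"
    using q finite_measure_mono[OF sub] by simp
  ultimately have "eventually (\<lambda>k. q < measure M (S k)) sequentially" by (rule order_tendstoD(1))
  then obtain k where "q < measure M (S k)" by (auto simp: eventually_sequentially)
  also have "measure M (S k) \<le> measure M (A k)" by (intro finite_measure_mono) (auto simp: S_def)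
  finally show ?thesis
    using that[of "Suc k" "h k" "x k" "n k"] h x0 xs xF unfolding A_def by (auto simp: less_imp_le)
qed

text \<open>With windows of length b / 4 the doubled time range reaches down to b / 2 only, so the
  grid stays at positive times. The hitting probability is at least \<open>q\<close> for every
  \<epsilon>, on a grid depending on \<epsilon>, hence the energies have a common bound and pass to
  a limit.\<close>

lemma finite_energy_of_close_event:
  fixes B :: "real \<times> real \<Rightarrow> 'a \<Rightarrow> real ^ 'd"
  assumes B: "brownian_sheet M B" and F: "compact F" "F \<subseteq> {0<..}" and bc: "0 < b" "b < c"
    and pos: "0 < measure M (close_event M B F b c (b / 4) 0)"
  obtains \<nu> where "\<nu> \<in> prob_measures_on F" "riesz_energy ((real CARD('d) - 4) / 2) \<nu> < \<top>"
proof -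
  let ?d = "CARD('d)" and ?U = "b / 4"
  have "F \<noteq> {}" using pos by (auto simp: close_event_def)
  then obtain s0 s1 where s: "0 < s0" "\<And>s. s \<in> F \<Longrightarrow> s0 \<le> s" "\<And>s. s \<in> F \<Longrightarrow> s \<le> s1"
    using compact_positive_bounds[OF F] by blast
  have U: "0 < ?U" using bc by simp
  obtain C where C: "0 \<le> C" "\<And>N h \<epsilon> r. 0 < N \<Longrightarrow> 0 < h \<Longrightarrow> real N * h = ?U \<Longrightarrow> 0 < \<epsilon> \<Longrightarrow> 0 \<le> r \<Longrightarrow>
    real_kernel ?d (r + \<epsilon>\<^sup>2) \<le> C * (1 + grid_kernel ?d N h \<epsilon> r)"
    by (rule grid_kernel_lower[OF U]) (rule that)
  define q where "q = measure M (close_event M B F b c ?U 0) / 2"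
  have q: "0 < q" "q < measure M (close_event M B F b c ?U 0)" using pos by (auto simp: q_def)
  \<comment> \<open>As 4 N h = b, the largest height c - b + 4 N h equals c.\<close>
  define K where "K = max 1 (max s1 (2 * c))"
  \<comment> \<open>The value of \<open>pair_const\<close> is spelled out because the grid is chosen
    anew for each \<epsilon>; it depends on s0 and c - b alone.\<close>
  define D where "D = C * (1 + 16384 * (16 / sqrt (s0 * (c - b) * min 1 (min (c - b) s0 / 3))) ^ ?d * ((4 * sqrt K) ^ ?d)\<^sup>2 / q)"
  have "\<exists>\<mu>. real_distribution \<mu> \<and> (AE y in \<mu>. y \<in> F) \<and>
    (\<integral>\<^sup>+y. \<integral>\<^sup>+z. ennreal (real_kernel ?d (\<bar>y - z\<bar> + (1 / real (Suc m))\<^sup>2)) \<partial>\<mu> \<partial>\<mu>) \<le> ennreal D" for m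
  proof -
    let ?\<epsilon> = "1 / real (Suc m)"
    have \<epsilon>: "0 < ?\<epsilon>" by simp
    have le: "?U \<le> b" "0 \<le> c" using bc by auto
    obtain n N and x :: "nat \<Rightarrow> real" and h where N: "0 < N" and h: "0 < h" and Nh: "real N * h = ?U" and x0: "x 0 = 0"
      and xs: "\<And>i j. i < j \<Longrightarrow> j \<le> n \<Longrightarrow> x i < x j" and xF: "x ` {1..n} \<subseteq> F"
      and hit: "q \<le> measure M {\<omega>\<in>space M. \<exists>i\<in>{1..n}. \<exists>j<N. \<exists>k<N. \<forall>l. \<bar>B (x i, c + real k * h) \<omega> $ l - B (x i, b - real j * h) \<omega> $ l\<bar> \<le> ?\<epsilon>}"
      by (rule exists_grid_hit[OF B F U le q(2) \<epsilon>]) (rule that)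
    have s1: "x i \<le> s1" if "i \<le> n" for i
    proof (cases "i = 0")
      case True
      obtain s where "s \<in> F" using \<open>F \<noteq> {}\<close> by auto
      then show ?thesis using True x0 s(1) s(2)[of s] s(3)[of s] by simp
    next
      case False
      then show ?thesis using that xF by (intro s(3)) auto
    qed
    interpret sheet_grid n N x b c h s0 s1 ?\<epsilon> "TYPE('d)" M B
    proof
      show "s0 \<le> x i" if "1 \<le> i" "i \<le> n" for i using that xF by (intro s(2)) auto
      show "2 * real N * h \<le> b" using Nh bc by simp
    qed (use N h x0 xs bc s(1) s1 B in auto)
    have K: "c - b + 4 * real N * h \<le> K" "s1 \<le> K" "1 \<le> K" using Nh bc by (auto simp: K_def)
    obtain \<mu> where "real_distribution \<mu>" and "AE y in \<mu>. y \<in> x ` {1..n}"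
      and "(\<integral>\<^sup>+y. \<integral>\<^sup>+z. ennreal (real_kernel ?d (\<bar>y - z\<bar> + ?\<epsilon>\<^sup>2)) \<partial>\<mu> \<partial>\<mu>)
        \<le> ennreal (C * (1 + 16384 * pair_const ^ ?d * ((4 * sqrt K) ^ ?d)\<^sup>2 / q))"
      by (rule energy_measure_of_hit[OF K q(1) hit C(1) C(2)[OF N h Nh \<epsilon>]]) (assumption, rule that)
    moreover from this(2) have "AE y in \<mu>. y \<in> F" by eventually_elim (use xF in auto)
    ultimately show ?thesis unfolding D_def pair_const_def by blast
  qed
  then have "\<forall>m. \<exists>\<mu>. real_distribution \<mu> \<and> (AE y in \<mu>. y \<in> F) \<and>
    (\<integral>\<^sup>+y. \<integral>\<^sup>+z. ennreal (real_kernel ?d (\<bar>y - z\<bar> + (1 / real (Suc m))\<^sup>2)) \<partial>\<mu> \<partial>\<mu>) \<le> ennreal D" ..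
  then obtain \<mu> where \<mu>: "\<And>m. real_distribution (\<mu> m)" "\<And>m. AE y in \<mu> m. y \<in> F"
    "\<And>m. (\<integral>\<^sup>+y. \<integral>\<^sup>+z. ennreal (real_kernel ?d (\<bar>y - z\<bar> + (1 / real (Suc m))\<^sup>2)) \<partial>\<mu> m \<partial>\<mu> m) \<le> ennreal D"
    unfolding choice_iff by blast
  have "(\<lambda>m. (1 / real (Suc m))\<^sup>2) \<longlonglongrightarrow> 0\<^sup>2"
    by (intro tendsto_power LIMSEQ_Suc[OF lim_1_over_n])
  then have lim: "(\<lambda>m. (1 / real (Suc m))\<^sup>2) \<longlonglongrightarrow> 0" by simp
  have e0: "0 < (1 / real (Suc m))\<^sup>2" for m by simp
  obtain \<nu> where "\<nu> \<in> prob_measures_on F" and "riesz_energy ((real ?d - 4) / 2) \<nu> \<le> ennreal D"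
    by (rule finite_energy_limit[OF F(1) \<mu>(1,2) e0 lim \<mu>(3)]) (rule that)
  then show ?thesis using that[of \<nu>] by (simp add: le_less_trans)
qed

section \<open>From a measure of finite energy to coincidences of positive probability\<close>

lemma nn_integral_finite_range:
  assumes \<mu>: "prob_space \<mu>" and \<pi>[measurable]: "\<pi> \<in> borel_measurable \<mu>" and range: "AE y in \<mu>. \<pi> y \<in> x ` J"
    and J: "finite J" "inj_on x J"
  shows "(\<integral>\<^sup>+y. g (\<pi> y :: real) \<partial>\<mu>) = (\<Sum>i\<in>J. ennreal (measure \<mu> {y\<in>space \<mu>. \<pi> y = x i}) * g (x i))"
proof -
  interpret prob_space \<mu> by (rule \<mu>)
  have "(\<integral>\<^sup>+y. g (\<pi> y) \<partial>\<mu>) = (\<integral>\<^sup>+y. (\<Sum>i\<in>J. g (x i) * indicator {y\<in>space \<mu>. \<pi> y = x i} y) \<partial>\<mu>)"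
  proof (rule nn_integral_cong_AE)
    show "AE y in \<mu>. g (\<pi> y) = (\<Sum>i\<in>J. g (x i) * indicator {y\<in>space \<mu>. \<pi> y = x i} y)"
      using range AE_space
    proof eventually_elim
      case (elim y)
      then obtain i where i: "i \<in> J" "\<pi> y = x i" by auto
      have "(\<Sum>i'\<in>J. g (x i') * indicator {y\<in>space \<mu>. \<pi> y = x i'} y) = (\<Sum>i'\<in>J. if i' = i then g (x i) else 0)"
        using i J(2) elim by (intro sum.cong) (auto simp: inj_on_def indicator_def)
      then show ?case using i J(1) by simp
    qed
  qed
  also have "\<dots> = (\<Sum>i\<in>J. \<integral>\<^sup>+y. g (x i) * indicator {y\<in>space \<mu>. \<pi> y = x i} y \<partial>\<mu>)"
    by (rule nn_integral_sum) measurable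
  also have "\<dots> = (\<Sum>i\<in>J. ennreal (measure \<mu> {y\<in>space \<mu>. \<pi> y = x i}) * g (x i))"
    by (intro sum.cong refl) (simp add: nn_integral_cmult_indicator emeasure_eq_measure mult.commute)
  finally show ?thesis .
qed

text \<open>The measure is moved onto a finite grid by a map that displaces points by at most
  \<epsilon>^2, the scale at which the kernel is regularised, so its grid energy is at most a
  constant times 1 plus its Riesz energy. The times 1 and 2 are a fixed choice of gap.\<close>

lemma prob_close_event_ge:
  fixes B :: "real \<times> real \<Rightarrow> 'a \<Rightarrow> real ^ 'd"
  assumes B: "brownian_sheet M B" and F: "compact F" "F \<subseteq> {0<..}"
    and \<mu>: "\<mu> \<in> prob_measures_on F" and energy: "riesz_energy ((real CARD('d) - 4) / 2) \<mu> < \<top>"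
  obtains \<kappa> where "0 < \<kappa>" "\<And>m. \<kappa> \<le> measure M (close_event M B F 1 2 (1/2) (real CARD('d) * (2 * (1 / real (Suc m)))))"
proof -
  let ?d = "CARD('d)"
  let ?k = "riesz_kernel ((real ?d - 4) / 2)"
  have \<mu>p: "prob_space \<mu>" and \<mu>s[measurable_cong]: "sets \<mu> = sets borel" and \<mu>F: "emeasure \<mu> F = 1"
    using \<mu> by (auto simp: prob_measures_on_def)
  interpret \<mu>: prob_space \<mu> by (rule \<mu>p)
  interpret MS: prob_space M using B by (simp add: brownian_sheet_def)
  have "F \<noteq> {}" using \<mu>F by auto
  then obtain s0 s1 where s: "0 < s0" "\<And>s. s \<in> F \<Longrightarrow> s0 \<le> s" "\<And>s. s \<in> F \<Longrightarrow> s \<le> s1"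
    using compact_positive_bounds[OF F] by blast
  have s1: "0 < s1" using \<open>F \<noteq> {}\<close> s by force
  have AEF: "AE y in \<mu>. y \<in> F"
    using \<mu>F borel_compact[OF F(1)] by (intro \<mu>.AE_prob_1) (simp add: measure_def)
  \<comment> \<open>The range is U = 1/4, so that the doubled range has length 1/2; distances within
    \<open>F\<close> plus \<epsilon>^2 are at most s1 + 1.\<close>
  obtain Cu where Cu: "0 \<le> Cu" "\<And>N h \<epsilon> r. 0 < N \<Longrightarrow> 0 < h \<Longrightarrow> real N * h = 1/4 \<Longrightarrow> 0 < \<epsilon> \<Longrightarrow> h \<le> \<epsilon>\<^sup>2 \<Longrightarrow> 0 \<le> r \<Longrightarrow> r + \<epsilon>\<^sup>2 \<le> s1 + 1 \<Longrightarrow>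
    grid_kernel ?d N h \<epsilon> r \<le> Cu * (1 + real_kernel ?d (r + \<epsilon>\<^sup>2))"
    by (rule grid_kernel_upper[of "1/4"]) (simp, rule that)
  obtain C3 where C3: "0 \<le> C3" "\<And>a. 0 < a \<Longrightarrow> real_kernel ?d (a / 3) \<le> C3 * (1 + real_kernel ?d a)"
    by (rule real_kernel_third) (rule that)
  \<comment> \<open>One summand per use: positivity, the dimensions d < 4 where the kernel is 1, and
    the comparison of distances up to a factor 3.\<close>
  define C where "C = 1 + 2 * Cu + Cu * (1 + C3)"
  have C: "1 \<le> C" "2 * Cu \<le> C" "Cu * (1 + C3) \<le> C" using Cu C3 by (auto simp: C_def)
  have "ennreal C * (1 + riesz_energy ((real ?d - 4) / 2) \<mu>) < \<top>"
    using energy by (simp add: ennreal_mult_less_top)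
  then obtain E where E: "ennreal C * (1 + riesz_energy ((real ?d - 4) / 2) \<mu>) = ennreal E" "0 \<le> E"
    by (cases "ennreal C * (1 + riesz_energy ((real ?d - 4) / 2) \<mu>)") auto
  have total: "(\<integral>\<^sup>+y. \<integral>\<^sup>+z. ennreal C * (1 + ?k (y - z)) \<partial>\<mu> \<partial>\<mu>) = ennreal C * (1 + riesz_energy ((real ?d - 4) / 2) \<mu>)"
  proof -
    have inner: "(\<integral>\<^sup>+z. ennreal C * (1 + ?k (y - z)) \<partial>\<mu>) = ennreal C * (1 + (\<integral>\<^sup>+z. ?k (y - z) \<partial>\<mu>))" for y
    proof -
      have "(\<integral>\<^sup>+z. ennreal C * (1 + ?k (y - z)) \<partial>\<mu>) = ennreal C * (\<integral>\<^sup>+z. 1 + ?k (y - z) \<partial>\<mu>)"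
        by (rule nn_integral_cmult) measurable
      also have "(\<integral>\<^sup>+z. 1 + ?k (y - z) \<partial>\<mu>) = (\<integral>\<^sup>+z. 1 \<partial>\<mu>) + (\<integral>\<^sup>+z. ?k (y - z) \<partial>\<mu>)"
        by (rule nn_integral_add) measurable
      finally show ?thesis using \<mu>.emeasure_space_1 by simp
    qed
    have "(\<integral>\<^sup>+y. ennreal C * (1 + (\<integral>\<^sup>+z. ?k (y - z) \<partial>\<mu>)) \<partial>\<mu>) = ennreal C * (\<integral>\<^sup>+y. 1 + (\<integral>\<^sup>+z. ?k (y - z) \<partial>\<mu>) \<partial>\<mu>)"
      by (rule nn_integral_cmult) measurable
    also have "(\<integral>\<^sup>+y. 1 + (\<integral>\<^sup>+z. ?k (y - z) \<partial>\<mu>) \<partial>\<mu>) = (\<integral>\<^sup>+y. 1 \<partial>\<mu>) + (\<integral>\<^sup>+y. (\<integral>\<^sup>+z. ?k (y - z) \<partial>\<mu>) \<partial>\<mu>)"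
      by (rule nn_integral_add) measurable
    finally show ?thesis unfolding inner riesz_energy_def using \<mu>.emeasure_space_1 by simp
  qed
  \<comment> \<open>s1 * 2 bounds the areas, since heights are at most (2 - 1) + 4 N h = 2.\<close>
  define b0 where "b0 = (1 / (2 * sqrt (s1 * 2 + 4))) ^ ?d"
  define Z where "Z = 64 * (16 / sqrt (s0 * (2 - 1) * min 1 (min (2 - 1) s0 / 3))) ^ ?d * E"
  have b0: "0 < b0" using s1 by (simp add: b0_def)
  have main: "b0\<^sup>2 \<le> measure M (close_event M B F 1 2 (1/2) (real ?d * (2 * (1 / real (Suc m))))) * Z" for m
  proof -
    define \<epsilon> where "\<epsilon> = 1 / real (Suc m)"
    \<comment> \<open>N = 1 / \<epsilon>^2 makes h = \<epsilon>^2 / 4, as the upper bound for the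
      lattice kernel needs h \<le> \<epsilon>^2.\<close>
    define N where "N = Suc m * Suc m"
    define h where "h = 1 / (4 * real N)"
    have \<epsilon>: "0 < \<epsilon>" "\<epsilon> \<le> 1" by (auto simp: \<epsilon>_def)
    have N: "0 < N" by (simp add: N_def)
    have h: "0 < h" "real N * h = 1/4" using N by (auto simp: h_def)
    have "\<epsilon>\<^sup>2 = 1 / real N" by (simp only: \<epsilon>_def N_def of_nat_mult power2_eq_square times_divide_times_eq mult_1)
    then have h\<epsilon>: "h \<le> \<epsilon>\<^sup>2" using N by (simp add: h_def field_simps)
    have "0 < \<epsilon>\<^sup>2" using \<epsilon> by simp
    obtain \<pi> where \<pi>[measurable]: "\<pi> \<in> borel_measurable borel" and \<pi>F: "finite (\<pi> ` F)" "\<pi> ` F \<subseteq> F" "\<And>s. s \<in> F \<Longrightarrow> \<bar>\<pi> s - s\<bar> \<le> \<epsilon>\<^sup>2"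
      by (rule compact_discretization[OF F(1) \<open>0 < \<epsilon>\<^sup>2\<close>]) (rule that)
    have "\<pi> ` F \<subseteq> {0<..}" using \<pi>F(2) F(2) by auto
    then obtain n and x :: "nat \<Rightarrow> real" where x0: "x 0 = 0" and xs: "\<And>i j. i < j \<Longrightarrow> j \<le> n \<Longrightarrow> x i < x j" and xG: "x ` {1..n} = \<pi> ` F"
      by (rule finite_positive_enumeration[OF \<pi>F(1)]) (rule that)
    have xF: "x i \<in> F" if "i \<in> {1..n}" for i using that xG \<pi>F(2) by blast
    have inj: "inj_on x {1..n}"
    proof (rule inj_onI)
      fix i j assume "i \<in> {1..n}" "j \<in> {1..n}" "x i = x j"
      then show "i = j" using xs[of i j] xs[of j i] by (cases i j rule: linorder_cases) auto
    qed
    interpret sheet_grid n N x 1 2 h s0 s1 \<epsilon> "TYPE('d)" M B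
    proof
      show "s0 \<le> x i" if "1 \<le> i" "i \<le> n" for i using that xF by (intro s(2)) auto
      show "x i \<le> s1" if "i \<le> n" for i
        using that xF[of i] x0 s1 by (cases "i = 0") (auto intro!: s(3))
      show "2 * real N * h \<le> 1" using h by simp
    qed (use N h x0 xs s(1) \<epsilon> B in auto)
    define p where "p i = measure \<mu> {y\<in>space \<mu>. \<pi> y = x i}" for i
    have p0: "0 \<le> p i" for i by (simp add: p_def)
    have \<pi>\<mu>: "\<pi> \<in> borel_measurable \<mu>" using \<pi> unfolding measurable_cong_sets[OF \<mu>s refl] .
    have range: "AE y in \<mu>. \<pi> y \<in> x ` {1..n}" using AEF unfolding xG by eventually_elim (rule imageI)
    note disc = nn_integral_finite_range[OF \<mu>p \<pi>\<mu> range finite_atLeastAtMost inj, folded p_def]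
    have p1: "(\<Sum>i\<in>{1..n}. p i) = 1"
    proof -
      have "ennreal (\<Sum>i\<in>{1..n}. p i) = (\<integral>\<^sup>+y. 1 \<partial>\<mu>)" using disc[of "\<lambda>_. 1"] p0 by (simp add: sum_ennreal)
      then show ?thesis using \<mu>.emeasure_space_1 p0 by (simp add: sum_nonneg)
    qed
    have kernel_le: "ennreal (kern \<bar>\<pi> y - \<pi> z\<bar>) \<le> ennreal C * (1 + ?k (y - z))" if yz: "y \<in> F" "z \<in> F" for y z
    proof -
      let ?a = "\<bar>\<pi> y - \<pi> z\<bar> + \<epsilon>\<^sup>2"
      have "\<pi> y \<in> F" "\<pi> z \<in> F" using yz \<pi>F(2) by auto
      then have "\<bar>\<pi> y - \<pi> z\<bar> \<le> s1" using s(1) s(2,3)[of "\<pi> y"] s(2,3)[of "\<pi> z"] by auto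
      moreover have "\<epsilon>\<^sup>2 \<le> 1" using \<epsilon> by (simp add: power_le_one)
      ultimately have g: "kern \<bar>\<pi> y - \<pi> z\<bar> \<le> Cu * (1 + real_kernel ?d ?a)"
        unfolding kern_def using N h \<epsilon> h\<epsilon> by (intro Cu(2)) auto
      consider "?d < 4" | "\<not> ?d < 4" "y = z" | "\<not> ?d < 4" "y \<noteq> z" by blast
      then show ?thesis
      proof cases
        case 1
        then have "kern \<bar>\<pi> y - \<pi> z\<bar> \<le> C * 2" using g C by (simp add: real_kernel_def)
        then have "ennreal (kern \<bar>\<pi> y - \<pi> z\<bar>) \<le> ennreal (C * 2)" by (rule ennreal_leI)
        also have "\<dots> = ennreal C * (1 + ?k (y - z))" using 1 C by (simp add: riesz_kernel_eq ennreal_mult one_add_one)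
        finally show ?thesis .
      next
        case 2
        then have "ennreal C * (1 + ?k (y - z)) = \<top>" using C by (simp add: riesz_kernel_eq ennreal_mult_top)
        then show ?thesis by simp
      next
        case 3
        \<comment> \<open>Displacements of at most \<epsilon>^2 at both points give a distance of at
          most 3 times \<open>?a\<close>. The diagonal, where the Riesz kernel is infinite, is the
          preceding case.\<close>
        have "\<bar>y - z\<bar> \<le> \<bar>\<pi> y - \<pi> z\<bar> + \<bar>\<pi> y - y\<bar> + \<bar>\<pi> z - z\<bar>" by linarith
        also have "\<dots> \<le> ?a + ?a + ?a"
          using \<pi>F(3)[OF yz(1)] \<pi>F(3)[OF yz(2)] zero_le_power2[of \<epsilon>] abs_ge_zero[of "\<pi> y - \<pi> z"] by linarith
        finally have "\<bar>y - z\<bar> / 3 \<le> ?a" by simp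
        then have "real_kernel ?d ?a \<le> real_kernel ?d (\<bar>y - z\<bar> / 3)" using 3 by (intro real_kernel_antimono) auto
        also have "\<dots> \<le> C3 * (1 + real_kernel ?d \<bar>y - z\<bar>)" using 3 by (intro C3(2)) auto
        finally have "1 + real_kernel ?d ?a \<le> (1 + C3) * (1 + real_kernel ?d \<bar>y - z\<bar>)"
          using real_kernel_nonneg[of ?d "\<bar>y - z\<bar>"] by (simp add: distrib_right)
        then have "Cu * (1 + real_kernel ?d ?a) \<le> Cu * ((1 + C3) * (1 + real_kernel ?d \<bar>y - z\<bar>))" using Cu by (intro mult_left_mono) auto
        also have "\<dots> \<le> C * (1 + real_kernel ?d \<bar>y - z\<bar>)"
          unfolding mult.assoc[symmetric] using C real_kernel_nonneg[of ?d "\<bar>y - z\<bar>"] by (intro mult_right_mono) auto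
        finally have "ennreal (kern \<bar>\<pi> y - \<pi> z\<bar>) \<le> ennreal (C * (1 + real_kernel ?d \<bar>y - z\<bar>))" using g by (intro ennreal_leI) simp
        also have "\<dots> = ennreal C * (1 + ?k (y - z))"
          using 3 C real_kernel_nonneg by (simp add: riesz_kernel_eq ennreal_mult)
        finally show ?thesis .
      qed
    qed
    have kern0: "0 \<le> kern \<bar>r\<bar>" for r using kern_pos[of "\<bar>r\<bar>"] by simp
    have "ennreal (grid_energy p) = (\<Sum>i\<in>{1..n}. ennreal (p i) * (\<Sum>i'\<in>{1..n}. ennreal (p i') * ennreal (kern \<bar>x i - x i'\<bar>)))"
    proof -
      have "ennreal (p i) * (\<Sum>i'\<in>{1..n}. ennreal (p i') * ennreal (kern \<bar>x i - x i'\<bar>)) = ennreal (\<Sum>i'\<in>{1..n}. p i * p i' * kern \<bar>x i - x i'\<bar>)" for i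
      proof -
        have "ennreal (p i) * (\<Sum>i'\<in>{1..n}. ennreal (p i') * ennreal (kern \<bar>x i - x i'\<bar>)) = (\<Sum>i'\<in>{1..n}. ennreal (p i * p i' * kern \<bar>x i - x i'\<bar>))"
          unfolding sum_distrib_left by (intro sum.cong refl) (simp add: ennreal_mult p0 kern0 mult.assoc)
        also have "\<dots> = ennreal (\<Sum>i'\<in>{1..n}. p i * p i' * kern \<bar>x i - x i'\<bar>)"
          by (intro sum_ennreal mult_nonneg_nonneg p0 kern0)
        finally show ?thesis .
      qed
      then show ?thesis
        unfolding grid_energy_def by (simp only:) (intro sum_ennreal[symmetric] sum_nonneg mult_nonneg_nonneg p0 kern0)
    qed
    also have "\<dots> = (\<integral>\<^sup>+y. \<integral>\<^sup>+z. ennreal (kern \<bar>\<pi> y - \<pi> z\<bar>) \<partial>\<mu> \<partial>\<mu>)"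
    proof -
      have "(\<integral>\<^sup>+z. ennreal (kern \<bar>u - \<pi> z\<bar>) \<partial>\<mu>) = (\<Sum>i'\<in>{1..n}. ennreal (p i') * ennreal (kern \<bar>u - x i'\<bar>))" for u
        by (rule disc[of "\<lambda>v. ennreal (kern \<bar>u - v\<bar>)"])
      then show ?thesis
        by (simp only: disc[of "\<lambda>u. \<Sum>i'\<in>{1..n}. ennreal (p i') * ennreal (kern \<bar>u - x i'\<bar>)"])
    qed
    also have "\<dots> \<le> (\<integral>\<^sup>+y. \<integral>\<^sup>+z. ennreal C * (1 + ?k (y - z)) \<partial>\<mu> \<partial>\<mu>)"
    proof (rule nn_integral_mono_AE)
      show "AE y in \<mu>. (\<integral>\<^sup>+z. ennreal (kern \<bar>\<pi> y - \<pi> z\<bar>) \<partial>\<mu>) \<le> (\<integral>\<^sup>+z. ennreal C * (1 + ?k (y - z)) \<partial>\<mu>)"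
        using AEF
      proof eventually_elim
        case (elim y)
        show ?case
        proof (rule nn_integral_mono_AE)
          show "AE z in \<mu>. ennreal (kern \<bar>\<pi> y - \<pi> z\<bar>) \<le> ennreal C * (1 + ?k (y - z))"
            using AEF by eventually_elim (rule kernel_le[OF elim])
        qed
      qed
    qed
    also note total
    finally have EE: "grid_energy p \<le> E" unfolding E(1) using E(2) by simp
    have v: "s1 * (2 - 1 + 4 * real N * h) \<le> s1 * 2" unfolding mult.assoc h(2) by simp
    have "b0\<^sup>2 \<le> measure noise_space {\<omega>\<in>space noise_space. \<exists>q\<in>slots (2 * N). hit (2 * \<epsilon>) q \<omega> \<noteq> 0} * (64 * pair_const ^ ?d * grid_energy p)"
      unfolding b0_def by (rule prob_hit_ge[OF p0 p1 \<epsilon>(2) v])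
    also have "\<dots> \<le> measure noise_space {\<omega>\<in>space noise_space. \<exists>q\<in>slots (2 * N). hit (2 * \<epsilon>) q \<omega> \<noteq> 0} * Z"
      unfolding Z_def pair_const_def[symmetric] using EE pair_const_pos by (intro mult_left_mono) auto
    also have "\<dots> \<le> measure M (close_event M B F 1 2 (1/2) (real ?d * (2 * \<epsilon>))) * Z"
    proof (rule mult_right_mono)
      have "{\<omega>\<in>space M. \<exists>i\<in>{1..n}. \<exists>j<2 * N. \<exists>k<2 * N. \<forall>l. \<bar>B (x i, 2 + real k * h) \<omega> $ l - B (x i, 1 - real j * h) \<omega> $ l\<bar> \<le> 2 * \<epsilon>}
          \<subseteq> close_event M B F 1 2 (1/2) (real ?d * (2 * \<epsilon>))"
      proof
        fix \<omega> assume "\<omega> \<in> {\<omega>\<in>space M. \<exists>i\<in>{1..n}. \<exists>j<2 * N. \<exists>k<2 * N. \<forall>l. \<bar>B (x i, 2 + real k * h) \<omega> $ l - B (x i, 1 - real j * h) \<omega> $ l\<bar> \<le> 2 * \<epsilon>}"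
        then obtain i j k where \<omega>: "\<omega> \<in> space M" and ijk: "i \<in> {1..n}" "j < 2 * N" "k < 2 * N"
          and le: "\<And>l. \<bar>B (x i, 2 + real k * h) \<omega> $ l - B (x i, 1 - real j * h) \<omega> $ l\<bar> \<le> 2 * \<epsilon>" by blast
        have jh: "real j' * h \<le> 1/2" if "j' < 2 * N" for j'
        proof -
          have "real j' * h \<le> real (2 * N) * h" using that h by (intro mult_right_mono) auto
          also have "\<dots> = 2 * (real N * h)" by simp
          finally show ?thesis unfolding h(2) by simp
        qed
        \<comment> \<open>The grid controls coordinates and the event the Euclidean norm; the
          dimension enters through the l1 bound.\<close>
        have "norm (B (x i, 2 + real k * h) \<omega> - B (x i, 1 - real j * h) \<omega>)
            \<le> (\<Sum>l\<in>UNIV. \<bar>(B (x i, 2 + real k * h) \<omega> - B (x i, 1 - real j * h) \<omega>) $ l\<bar>)" by (rule norm_le_l1_cart)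
        also have "\<dots> \<le> real ?d * (2 * \<epsilon>)" using le by (intro sum_bounded_above) simp
        finally show "\<omega> \<in> close_event M B F 1 2 (1/2) (real ?d * (2 * \<epsilon>))"
          unfolding close_event_def using \<omega> xF[OF ijk(1)] jh[OF ijk(2)] jh[OF ijk(3)] h(1)
          by (intro CollectI conjI bexI[of _ "(x i, 1 - real j * h, 2 + real k * h)"]) auto
      qed
      then show "measure noise_space {\<omega>\<in>space noise_space. \<exists>q\<in>slots (2 * N). hit (2 * \<epsilon>) q \<omega> \<noteq> 0} \<le> measure M (close_event M B F 1 2 (1/2) (real ?d * (2 * \<epsilon>)))"
        unfolding prob_hit_eq[OF order_refl]
        by (rule MS.finite_measure_mono) (rule sets_close_event[OF B F], auto)
      show "0 \<le> Z" unfolding Z_def pair_const_def[symmetric] using pair_const_pos E(2) by (intro mult_nonneg_nonneg) auto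
    qed
    finally show ?thesis unfolding \<epsilon>_def .
  qed
  have "0 < Z"
  proof (rule ccontr)
    assume "\<not> 0 < Z"
    then have "measure M (close_event M B F 1 2 (1/2) (real ?d * (2 * (1 / real (Suc 0))))) * Z \<le> 0" by (intro mult_nonneg_nonpos) auto
    then show False using main[of 0] b0 by (smt (verit) zero_less_power)
  qed
  show ?thesis
  proof (rule that)
    show "0 < b0\<^sup>2 / Z" using b0 \<open>0 < Z\<close> by simp
    show "b0\<^sup>2 / Z \<le> measure M (close_event M B F 1 2 (1/2) (real ?d * (2 * (1 / real (Suc m)))))" for m
      using main[of m] \<open>0 < Z\<close> by (simp add: pos_divide_le_eq)
  qed
qed

text \<open>The radii decrease to 0 while the probability stays above \<kappa>, so continuity from
  above applies. By compactness the increment attains its minimum, hence a sample point in all the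
  events has an exact coincidence.\<close>

lemma prob_close_event_pos:
  fixes B :: "real \<times> real \<Rightarrow> 'a \<Rightarrow> real ^ 'd"
  assumes B: "brownian_sheet M B" and F: "compact F" "F \<subseteq> {0<..}"
    and \<mu>: "\<mu> \<in> prob_measures_on F" and energy: "riesz_energy ((real CARD('d) - 4) / 2) \<mu> < \<top>"
  shows "0 < measure M (close_event M B F 1 2 (1/2) 0)"
proof -
  interpret M: prob_space M using B by (simp add: brownian_sheet_def)
  obtain \<kappa> where \<kappa>: "0 < \<kappa>" "\<And>m. \<kappa> \<le> measure M (close_event M B F 1 2 (1/2) (real CARD('d) * (2 * (1 / real (Suc m)))))"
    by (rule prob_close_event_ge[OF B F \<mu> energy]) (rule that)
  define r where "r m = real CARD('d) * (2 * (1 / real (Suc m)))" for m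
  define H where "H m = close_event M B F 1 2 (1/2) (r m)" for m
  have r_dec: "r m' \<le> r m" if "m \<le> m'" for m m'
    unfolding r_def using that by (intro mult_left_mono divide_left_mono) auto
  have r_lim: "r \<longlonglongrightarrow> real CARD('d) * (2 * 0)"
    unfolding r_def by (intro tendsto_mult tendsto_const LIMSEQ_Suc[OF lim_1_over_n])
  have "decseq H"
    unfolding decseq_def H_def close_event_def using r_dec by (fastforce intro: order_trans)
  have Hs: "range H \<subseteq> sets M" unfolding H_def using sets_close_event[OF B F] by auto
  have "(\<lambda>m. measure M (H m)) \<longlonglongrightarrow> measure M (\<Inter>m. H m)"
    by (rule M.finite_Lim_measure_decseq[OF Hs \<open>decseq H\<close>])
  then have "\<kappa> \<le> measure M (\<Inter>m. H m)"
    by (rule LIMSEQ_le_const) (use \<kappa>(2) in \<open>auto simp: H_def r_def\<close>)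
  also have "(\<Inter>m. H m) \<subseteq> close_event M B F 1 2 (1/2) 0"
  proof
    fix \<omega> assume \<omega>: "\<omega> \<in> (\<Inter>m. H m)"
    let ?K = "F \<times> {1 - 1/2..1::real} \<times> {2..2 + 1/2::real}" and ?f = "\<lambda>p. norm (B (fst p, snd (snd p)) \<omega> - B (fst p, fst (snd p)) \<omega>)"
    have sp: "\<omega> \<in> space M" and ne: "?K \<noteq> {}" using \<omega> unfolding H_def close_event_def by blast+
    have "compact ?K" using F by (intro compact_Times) auto
    moreover have "continuous_on ?K ?f" by (rule continuous_on_sheet_increment[OF B F(2) _ _ sp]) auto
    ultimately obtain p where p: "p \<in> ?K" "\<And>p'. p' \<in> ?K \<Longrightarrow> ?f p \<le> ?f p'"
      using continuous_attains_inf[of ?K ?f] ne by blast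
    have "?f p \<le> r m" for m
    proof -
      have "\<omega> \<in> H m" using \<omega> by blast
      then obtain p' where "p' \<in> ?K" "?f p' \<le> r m" unfolding H_def close_event_def by blast
      then show ?thesis using p(2)[of p'] by (blast intro: order_trans)
    qed
    then have "?f p \<le> real CARD('d) * (2 * 0)" by (intro LIMSEQ_le_const[OF r_lim]) auto
    then show "\<omega> \<in> close_event M B F 1 2 (1/2) 0" unfolding close_event_def using p(1) sp by (intro CollectI conjI bexI[of _ p]) auto
  qed
  then have "measure M (\<Inter>m. H m) \<le> measure M (close_event M B F 1 2 (1/2) 0)"
    by (rule M.finite_measure_mono) (rule sets_close_event[OF B F], auto)
  finally show ?thesis using \<kappa>(1) by simp
qed

text \<open>Rational pairs make the union countable, which gives measurability and lets a single
  pair carry positive probability.\<close>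

lemma double_times_event_eq:
  fixes B :: "real \<times> real \<Rightarrow> 'a \<Rightarrow> real ^ 'd"
  assumes F: "F \<subseteq> {0<..}"
  shows "{\<omega>\<in>space M. double_times B \<omega> \<inter> F \<noteq> {}} = (\<Union>(b, c)\<in>{(b, c)\<in>\<rat> \<times> \<rat>. 0 < b \<and> b < c}. close_event M B F b c (b / 4) 0)"
proof (intro set_eqI iffI)
  fix \<omega> assume "\<omega> \<in> {\<omega>\<in>space M. double_times B \<omega> \<inter> F \<noteq> {}}"
  then obtain s t1 t2 where *: "\<omega> \<in> space M" "s \<in> F" "0 < t1" "t1 < t2" "B (s, t1) \<omega> = B (s, t2) \<omega>"
    by (auto simp: double_times_def)
  \<comment> \<open>b < 4/3 t1 means that t1 lies above b - b / 4, and \<open>c\<close> is taken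
    within b / 4 below t2, so both times fall into their windows.\<close>
  have "t1 < min (4 / 3 * t1) t2" using * by simp
  then obtain b where b: "b \<in> \<rat>" "t1 < b" "b < min (4 / 3 * t1) t2" using Rats_dense_in_real by blast
  have "max b (t2 - b / 4) < t2" using b * by simp
  then obtain c where c: "c \<in> \<rat>" "max b (t2 - b / 4) < c" "c < t2" using Rats_dense_in_real by blast
  have "\<omega> \<in> close_event M B F b c (b / 4) 0"
    unfolding close_event_def using * b c by (intro CollectI conjI bexI[of _ "(s, t1, t2)"]) auto
  then show "\<omega> \<in> (\<Union>(b, c)\<in>{(b, c)\<in>\<rat> \<times> \<rat>. 0 < b \<and> b < c}. close_event M B F b c (b / 4) 0)"
    using b c * by (intro UN_I[of "(b, c)"]) auto
next
  fix \<omega> assume "\<omega> \<in> (\<Union>(b, c)\<in>{(b, c)\<in>\<rat> \<times> \<rat>. 0 < b \<and> b < c}. close_event M B F b c (b / 4) 0)"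
  then obtain b c s t1 t2 where *: "0 < b" "b < c" "\<omega> \<in> space M" "s \<in> F" "b - b / 4 \<le> t1" "t1 \<le> b" "c \<le> t2" "B (s, t2) \<omega> = B (s, t1) \<omega>"
    by (auto simp: close_event_def)
  then have "0 < t1" "t1 < t2" "0 \<le> s" using F by (auto simp: less_imp_le)
  then have "s \<in> double_times B \<omega>"
    unfolding double_times_def using *(8) by (intro CollectI conjI exI[of _ t1] exI[of _ t2]) auto
  then show "\<omega> \<in> {\<omega>\<in>space M. double_times B \<omega> \<inter> F \<noteq> {}}" using *(3,4) by blast
qed

theorem theorem1p3:
  fixes M :: "'a measure"
    and B :: "real \<times> real \<Rightarrow> 'a \<Rightarrow> real ^ 'd"
    and F :: "real set"
  assumes "brownian_sheet M B"
    and "compact F" and "F \<subseteq> {0<..}"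
  shows "emeasure M {\<omega> \<in> space M. double_times B \<omega> \<inter> F \<noteq> {}} > 0
           \<longleftrightarrow> riesz_cap ((real CARD('d) - 4) / 2) F > 0"
proof -
  let ?\<beta> = "(real CARD('d) - 4) / 2" and ?D = "{\<omega> \<in> space M. double_times B \<omega> \<inter> F \<noteq> {}}"
  let ?I = "{(b, c)\<in>\<rat> \<times> \<rat>. 0 < b \<and> b < c} :: (real \<times> real) set"
  interpret M: prob_space M using assms(1) by (simp add: brownian_sheet_def)
  have cI: "countable ?I" by (rule countable_subset[of _ "\<rat> \<times> \<rat>"]) (auto intro: countable_rat)
  have sets: "close_event M B F b c U r \<in> sets M" if "U \<le> b" "0 \<le> c" for b c U r
    using sets_close_event[OF assms that] .
  note D_eq = double_times_event_eq[OF assms(3), of M B]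
  have D: "?D \<in> sets M" unfolding D_eq using cI by (intro sets.countable_UN') (auto intro!: sets)
  \<comment> \<open>Capacity is the inverse of an infimum, so it is positive exactly if some energy
    is finite; an empty \<open>F\<close> carries no measure and has capacity 0.\<close>
  have cap: "riesz_cap ?\<beta> F > 0 \<longleftrightarrow> (\<exists>\<mu>\<in>prob_measures_on F. riesz_energy ?\<beta> \<mu> < \<top>)"
    unfolding riesz_cap_def by (simp add: zero_less_iff_neq_zero INF_less_iff flip: top.not_eq_extremum)
  show ?thesis unfolding cap
  proof
    assume pos: "emeasure M ?D > 0"
    have "\<exists>(b, c)\<in>?I. emeasure M (close_event M B F b c (b / 4) 0) \<noteq> 0"
    proof (rule ccontr)
      assume "\<not> ?thesis"
      then have "(\<Union>(b, c)\<in>?I. close_event M B F b c (b / 4) 0) \<in> null_sets M"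
        using cI by (intro null_sets_UN') (auto intro!: null_setsI sets)
      then show False using pos unfolding D_eq by (auto simp: null_sets_def)
    qed
    then obtain b c where bc: "0 < b" "b < c" and "0 < measure M (close_event M B F b c (b / 4) 0)"
      by (auto simp: M.emeasure_eq_measure zero_less_measure_iff)
    then obtain \<nu> where "\<nu> \<in> prob_measures_on F" "riesz_energy ?\<beta> \<nu> < \<top>"
      by (rule finite_energy_of_close_event[OF assms]) (rule that)
    then show "\<exists>\<mu>\<in>prob_measures_on F. riesz_energy ?\<beta> \<mu> < \<top>" by blast
  next
    assume "\<exists>\<mu>\<in>prob_measures_on F. riesz_energy ?\<beta> \<mu> < \<top>"
    then obtain \<mu> where "\<mu> \<in> prob_measures_on F" "riesz_energy ?\<beta> \<mu> < \<top>" by blast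
    \<comment> \<open>One fixed pair of windows is enough in this direction.\<close>
    then have "0 < measure M (close_event M B F 1 2 (1/2) 0)" by (rule prob_close_event_pos[OF assms])
    also have "close_event M B F 1 2 (1/2) 0 \<subseteq> ?D"
    proof
      fix \<omega> assume "\<omega> \<in> close_event M B F 1 2 (1/2) 0"
      then obtain s t1 t2 where *: "\<omega> \<in> space M" "s \<in> F" "1 - 1/2 \<le> t1" "t1 \<le> 1" "2 \<le> t2" "B (s, t2) \<omega> = B (s, t1) \<omega>"
        by (auto simp: close_event_def)
      then have "0 < t1" "t1 < t2" "0 \<le> s" using assms(3) by (auto simp: less_imp_le)
      then have "s \<in> double_times B \<omega>"
        unfolding double_times_def using *(6) by (intro CollectI conjI exI[of _ t1] exI[of _ t2]) auto
      then show "\<omega> \<in> ?D" using *(1,2) by blast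
    qed
    then have "measure M (close_event M B F 1 2 (1/2) 0) \<le> measure M ?D"
      using D by (rule M.finite_measure_mono)
    finally show "emeasure M ?D > 0" by (simp add: M.emeasure_eq_measure)
  qed
qed

end
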